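(* Let $0<\gamma\le\pi\le\beta\le2\pi$. Then the Hardy constant of the domain $E_{\beta,\gamma}$ equals $c_\beta$.
   Context: For angles $\beta,\gamma>0$ with $\beta\ge\pi$ and $\beta+\gamma\le3\pi$, let $O=(0,0)$, $P=(1,0)$, $L_2$ the segment $[O,P]$, $L_3=\{t(\cos\beta,\sin\beta):t\ge0\}$ and $L_1=\{(1-t\cos\gamma,\ t\sin\gamma): t\ge0\}$ (the halflines $L_1,L_3$ do not intersect). $E_{\beta,\gamma}$ is the unbounded domain bounded by $L_3\cup L_2\cup L_1$ which contains the points $(x,y)$ with $0<x<1$ and $y>0$ small; its interior angle at $O$ is $\beta$ and at $P$ is $\gamma$. The Hardy constant of a domain $\Omega\subset\mathbb{R}^2$ is the largest $c\ge0$ such that $\int_\Omega|\nabla u|^2\,dx\ge c\int_\Omega u^2/d^2\,dx$ for all $u\in C_c^\infty(\Omega)$, where $d(x)=\mathrm{dist}(x,\partial\Omega)$. For $\beta\in[\pi,2\pi]$, $\Lambda_\beta=\{(r\cos\theta,r\sin\theta): r>0,\ 0<\theta<\beta\}$ and $c_\beta$ denotes the Hardy constant of $\Lambda_\beta$. It is known that $c_\beta\in(0,1/4]$; $c_\beta=1/4$ for $\pi\le\beta\le\beta_{cr}$, where $\beta_{cr}\in(\pi,2\pi)$ is the unique solution in $(\pi,2\pi)$ of $\tan\big(\frac{\beta_{cr}-\pi}{4}\big)=4\big(\Gamma(3/4)/\Gamma(1/4)\big)^2$; and for $\beta_{cr}\le\beta<2\pi$, $c_\beta$ is the unique solution of $\sqrt{c}\tan\big(\sqrt{c}\,\frac{\beta-\pi}{2}\big)=2\Big(\frac{\Gamma(\frac{3+\sqrt{1-4c}}{4})}{\Gamma(\frac{1+\sqrt{1-4c}}{4})}\Big)^2$.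 *)

theory Defs
  imports "HOL-Analysis.Analysis"
begin

coinductive smooth :: "('a::euclidean_space \<Rightarrow> real) \<Rightarrow> bool" where
  "f differentiable_on UNIV \<Longrightarrow>
   (\<forall>i\<in>Basis. smooth (\<lambda>x. frechet_derivative f (at x) i)) \<Longrightarrow> smooth f"

text \<open>Test functions C_c^infinity(Omega) (extended by zero to the whole plane).\<close>
definition test_fun :: "(real \<times> real) set \<Rightarrow> (real \<times> real \<Rightarrow> real) \<Rightarrow> bool" where
  "test_fun \<Omega> u \<longleftrightarrow> smooth u \<and> compact (closure {x. u x \<noteq> 0})
      \<and> closure {x. u x \<noteq> 0} \<subseteq> \<Omega>"

definition grad_sq :: "(real \<times> real \<Rightarrow> real) \<Rightarrow> real \<times> real \<Rightarrow> real" where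
  "grad_sq u x = (\<Sum>i\<in>Basis. (frechet_derivative u (at x) i)\<^sup>2)"

definition bdist :: "(real \<times> real) set \<Rightarrow> real \<times> real \<Rightarrow> real" where
  "bdist \<Omega> x = infdist x (frontier \<Omega>)"

definition hardy_constant :: "(real \<times> real) set \<Rightarrow> real" where
  "hardy_constant \<Omega> = Sup {c. c \<ge> 0 \<and> (\<forall>u. test_fun \<Omega> u \<longrightarrow>
      integral \<Omega> (grad_sq u) \<ge> c * integral \<Omega> (\<lambda>x. (u x)\<^sup>2 / (bdist \<Omega> x)\<^sup>2))}"

definition Lambda :: "real \<Rightarrow> (real \<times> real) set" where
  "Lambda \<beta> = {(r * cos \<theta>, r * sin \<theta>) | r \<theta>. r > 0 \<and> 0 < \<theta> \<and> \<theta> < \<beta>}"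

definition c_beta :: "real \<Rightarrow> real" where
  "c_beta \<beta> = hardy_constant (Lambda \<beta>)"

definition L1 :: "real \<Rightarrow> (real \<times> real) set" where
  "L1 \<gamma> = {(1 - t * cos \<gamma>, t * sin \<gamma>) | t. t \<ge> 0}"

definition L2 :: "(real \<times> real) set" where
  "L2 = closed_segment (0,0) (1,0)"

definition L3 :: "real \<Rightarrow> (real \<times> real) set" where
  "L3 \<beta> = {(t * cos \<beta>, t * sin \<beta>) | t. t \<ge> 0}"

definition E :: "real \<Rightarrow> real \<Rightarrow> (real \<times> real) set" where
  "E \<beta> \<gamma> = {z. \<forall>\<^sub>F t in at_right 0.
      z \<in> connected_component_set (- (L3 \<beta> \<union> L2 \<union> L1 \<gamma>)) (1/2, t)}"

end

theory Submission
  imports Defs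
begin

text \<open>
  Rescaling a test function of \<open>Lambda \<beta>\<close> towards the vertex \<open>O\<close>, near which the two domains coincide, shows that
  every Hardy inequality on \<open>E \<beta> \<gamma>\<close> holds on \<open>Lambda \<beta>\<close>. Conversely, suppose that the sector has constant \<open>c\<close> and
  let \<open>c' < c\<close>. The distance to its boundary is \<open>r wD(\<theta>)\<close>, and the solution of \<open>y'' + c' y / wD\<^sup>2 = 0\<close> symmetric
  about \<open>\<beta>/2\<close> stays positive on \<open>[a, \<beta> - a]\<close>: otherwise the positive part of \<open>y(\<theta>) cos(\<mu> ln r)\<close>, raised to a power
  slightly above 1, would violate the inequality on the sector. So \<open>F\<^sub>B = - \<nabla> ln y(\<theta>)\<close> satisfies
  \<open>div F\<^sub>B - \<bar>F\<^sub>B\<bar>\<^sup>2 = c' / (r wD(\<theta>))\<^sup>2\<close>. Where \<open>L1\<close> is the nearest side it is replaced by a field \<open>F\<^sub>A\<close> of the same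
  kind, for the distance to \<open>L1\<close>, centred at the image of \<open>O\<close> under the rotation about \<open>P\<close> that aligns \<open>L2\<close> with
  \<open>L1\<close>. The two are interpolated with a cutoff \<open>\<eta>\<close> in a thin layer along the interface; the term
  \<open>\<nabla>\<eta> \<cdot> (F\<^sub>A - F\<^sub>B)\<close> this creates in the divergence turns out to be nonnegative. The inequality
  \<open>\<bar>\<nabla>u\<bar>\<^sup>2 + div (u\<^sup>2 F) \<ge> u\<^sup>2 (div F - \<bar>F\<bar>\<^sup>2)\<close> then gives the Hardy inequality on \<open>E \<beta> \<gamma>\<close> up to a factor that tends
  to 1 with the width of the layer.
\<close>

section \<open>Differentiable functions of two variables\<close>

text \<open>The potential is singular at the sides, so the angular equation is solved only on
  \<open>[a, \<beta> - a]\<close>, with \<open>a\<close> taken from the support of the test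
  function; the gap between \<open>c'\<close> and \<open>c\<close> pays for the radial cosine and
  for the power above 1, which makes the positive part continuously differentiable. The sign of the
  interface term rests on two facts. Both centres have distance 1 from \<open>P\<close>, so in the
  frame of \<open>L1\<close> the vertex \<open>O\<close> lies in direction \<open>\<gamma>/2\<close>
  from the second centre; a point is therefore seen from there in a direction between
  \<open>\<gamma>/2\<close> and its direction from \<open>O\<close>. And the profile of
  \<open>F\<^sub>A\<close> belongs to the solution vanishing at \<open>a\<close>, which has the
  larger logarithmic derivative; since \<open>fA sin\<close> decreases,
  \<open>fB t sin t \<le> fA s sin s\<close> for \<open>s \<le> t \<le> pi/2\<close>. Where the
  vertex is the nearest boundary point of the sector, the decay of \<open>fB\<close> towards \<pi>
  is needed as well; it holds because \<open>fB\<close> vanishes at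
  \<open>\<beta>/2 \<le> pi\<close>. A cutoff replaces a sharp interface so that only divergences of
  compactly supported \<open>C^1\<close> fields on the plane are integrated.\<close>

lemma DERIV_imp_continuous_on:
  fixes f :: "real \<Rightarrow> real"
  assumes "\<And>x. (f has_real_derivative f' x) (at x)"
  shows "continuous_on S f"
  using assms by (intro continuous_at_imp_continuous_on ballI) (rule DERIV_isCont)

text \<open>The partial derivatives are arguments rather than \<open>frechet_derivative\<close>
  terms, so that divergences of composite fields can be computed symbolically. Differentiability is
  \<open>at z\<close> in the plane even when \<open>N\<close> is not open; the derivative at a point
  therefore does not depend on \<open>N\<close>, and local pieces can be glued.\<close>

definition C1_on :: "(real \<times> real) set \<Rightarrow> (real \<times> real \<Rightarrow> real) \<Rightarrow> (real \<times> real \<Rightarrow> real)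
    \<Rightarrow> (real \<times> real \<Rightarrow> real) \<Rightarrow> bool" where
  "C1_on N f fx fy \<longleftrightarrow>
     (\<forall>z\<in>N. (f has_derivative (\<lambda>h. fst h * fx z + snd h * fy z)) (at z)) \<and>
     continuous_on N fx \<and> continuous_on N fy"

lemma C1_on_cont: "C1_on N f fx fy \<Longrightarrow> continuous_on N f"
  unfolding C1_on_def
  by (meson continuous_at_imp_continuous_on has_derivative_continuous)

lemma C1_on_subset: "C1_on N f fx fy \<Longrightarrow> M \<subseteq> N \<Longrightarrow> C1_on M f fx fy"
  unfolding C1_on_def by (meson continuous_on_subset subsetD)

lemma C1_on_const: "C1_on N (\<lambda>z. c) (\<lambda>z. 0) (\<lambda>z. 0)"
  unfolding C1_on_def by (auto intro!: derivative_eq_intros)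

lemma C1_on_fst: "C1_on N fst (\<lambda>z. 1) (\<lambda>z. 0)"
  unfolding C1_on_def by (auto intro!: derivative_eq_intros)

lemma C1_on_snd: "C1_on N snd (\<lambda>z. 0) (\<lambda>z. 1)"
  unfolding C1_on_def by (auto intro!: derivative_eq_intros)

lemma C1_on_add:
  assumes "C1_on N f fx fy" "C1_on N g gx gy"
  shows "C1_on N (\<lambda>z. f z + g z) (\<lambda>z. fx z + gx z) (\<lambda>z. fy z + gy z)"
  using assms unfolding C1_on_def
  by (auto intro!: derivative_eq_intros continuous_intros simp: algebra_simps)

lemma C1_on_diff:
  assumes "C1_on N f fx fy" "C1_on N g gx gy"
  shows "C1_on N (\<lambda>z. f z - g z) (\<lambda>z. fx z - gx z) (\<lambda>z. fy z - gy z)"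
  using assms unfolding C1_on_def
  by (auto intro!: derivative_eq_intros continuous_intros simp: algebra_simps)

lemma C1_on_mult:
  assumes "C1_on N f fx fy" "C1_on N g gx gy"
  shows "C1_on N (\<lambda>z. f z * g z) (\<lambda>z. fx z * g z + f z * gx z) (\<lambda>z. fy z * g z + f z * gy z)"
  using assms C1_on_cont[OF assms(1)] C1_on_cont[OF assms(2)] unfolding C1_on_def
  by (auto intro!: derivative_eq_intros continuous_intros simp: algebra_simps)

lemma C1_on_comp:
  assumes "C1_on N f fx fy" "\<And>z. z \<in> N \<Longrightarrow> (\<phi> has_real_derivative \<phi>' (f z)) (at (f z))"
    "continuous_on (f ` N) \<phi>'"
  shows "C1_on N (\<lambda>z. \<phi> (f z)) (\<lambda>z. \<phi>' (f z) * fx z) (\<lambda>z. \<phi>' (f z) * fy z)"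
proof -
  have c: "continuous_on N (\<lambda>z. \<phi>' (f z))"
    by (rule continuous_on_compose2[OF assms(3) C1_on_cont[OF assms(1)]]) auto
  have "((\<lambda>z. \<phi> (f z)) has_derivative (\<lambda>h. fst h * (\<phi>' (f z) * fx z) + snd h * (\<phi>' (f z) * fy z))) (at z)"
    if "z \<in> N" for z
  proof -
    have "(f has_derivative (\<lambda>h. fst h * fx z + snd h * fy z)) (at z)"
      using assms(1) that unfolding C1_on_def by auto
    from has_derivative_compose[OF this assms(2)[OF that, unfolded has_field_derivative_def]]
    show ?thesis by (auto simp: algebra_simps)
  qed
  then show ?thesis using assms(1) c unfolding C1_on_def
    by (auto intro!: continuous_intros)
qed

lemma C1_on_cong:
  assumes "C1_on N f fx fy" "open N" "\<And>z. z \<in> N \<Longrightarrow> g z = f z"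
    "\<And>z. z \<in> N \<Longrightarrow> gx z = fx z" "\<And>z. z \<in> N \<Longrightarrow> gy z = fy z"
  shows "C1_on N g gx gy"
proof -
  have "(g has_derivative (\<lambda>h. fst h * gx z + snd h * gy z)) (at z)" if "z \<in> N" for z
  proof -
    have "(f has_derivative (\<lambda>h. fst h * gx z + snd h * gy z)) (at z)"
      using assms that unfolding C1_on_def by auto
    then show ?thesis
      by (rule has_derivative_transform_within_open[OF _ assms(2) that]) (use assms(3) in auto)
  qed
  moreover have "continuous_on N gx" "continuous_on N gy"
    using assms(1) unfolding C1_on_def
    by (simp_all only: continuous_on_cong[OF refl assms(4)] continuous_on_cong[OF refl assms(5)])
  ultimately show ?thesis unfolding C1_on_def by auto
qed

lemma C1_on_fx_partial:
  assumes "C1_on N f fx fy" "(x,y) \<in> N"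
  shows "((\<lambda>t. f (t,y)) has_real_derivative fx (x,y)) (at x)"
    "((\<lambda>t. f (x,t)) has_real_derivative fy (x,y)) (at y)"
proof -
  have d: "(f has_derivative (\<lambda>h. fst h * fx (x,y) + snd h * fy (x,y))) (at (x,y))"
    using assms unfolding C1_on_def by blast
  have "((\<lambda>t. (t,y)) has_derivative (\<lambda>h. (h,0))) (at x)" "((\<lambda>t. (x,t)) has_derivative (\<lambda>h. (0,h))) (at y)"
    by (auto intro!: derivative_eq_intros)
  from has_derivative_compose[OF this(1) d] has_derivative_compose[OF this(2) d]
  show "((\<lambda>t. f (t,y)) has_real_derivative fx (x,y)) (at x)"
    "((\<lambda>t. f (x,t)) has_real_derivative fy (x,y)) (at y)"
    by (simp_all add: has_field_derivative_def mult.commute[of _ "fx (x,y)"] mult.commute[of _ "fy (x,y)"])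
qed

lemma C1_on_unique:
  assumes "C1_on N f fx fy" "C1_on M f gx gy" "z \<in> N" "z \<in> M"
  shows "fx z = gx z" "fy z = gy z"
proof -
  obtain x y where z: "z = (x,y)" by (cases z)
  from C1_on_fx_partial[OF assms(1)] C1_on_fx_partial[OF assms(2)] assms(3,4) z
  show "fx z = gx z" "fy z = gy z" using DERIV_unique by blast+
qed

lemma C1_on_frechet:
  assumes "C1_on N f fx fy" "z \<in> N"
  shows "frechet_derivative f (at z) (1,0) = fx z" "frechet_derivative f (at z) (0,1) = fy z"
proof -
  have "(f has_derivative (\<lambda>h. fst h * fx z + snd h * fy z)) (at z)"
    using assms unfolding C1_on_def by blast
  from frechet_derivative_at[OF this]
  have "frechet_derivative f (at z) = (\<lambda>h. fst h * fx z + snd h * fy z)" by simp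
  then show "frechet_derivative f (at z) (1,0) = fx z" "frechet_derivative f (at z) (0,1) = fy z" by auto
qed

lemma C1_on_locally:
  assumes "\<And>z. z \<in> S \<Longrightarrow> \<exists>N. open N \<and> z \<in> N \<and> C1_on N f fx fy"
  shows "C1_on S f fx fy"
proof -
  have "isCont fx z \<and> isCont fy z" if "z \<in> S" for z
    using assms[OF that] unfolding C1_on_def by (auto simp: continuous_on_eq_continuous_at)
  then have "continuous_on S fx" "continuous_on S fy"
    by (auto intro!: continuous_at_imp_continuous_on)
  moreover have "\<forall>z\<in>S. (f has_derivative (\<lambda>h. fst h * fx z + snd h * fy z)) (at z)"
    using assms unfolding C1_on_def by blast
  ultimately show ?thesis unfolding C1_on_def by auto
qed

section \<open>Integrals of partial derivatives with compact support\<close>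

lemma has_integral_cbox_UNIV:
  fixes f :: "'a::euclidean_space \<Rightarrow> real"
  assumes "(f has_integral I) (cbox a b)" "\<And>z. z \<notin> cbox a b \<Longrightarrow> f z = 0"
  shows "(f has_integral I) UNIV"
  using has_integral_on_superset[OF assms] by auto

text \<open>The divergence theorem for compactly supported fields, one component at a time. Fubini
  on a large box reduces it to the fundamental theorem on lines, where the boundary values vanish;
  for \<open>fx\<close> the order of integration is swapped first.\<close>

lemma partial_integral_zero:
  fixes f :: "real \<times> real \<Rightarrow> real"
  assumes C: "C1_on UNIV f fx fy" and z: "\<And>z. z \<notin> K \<Longrightarrow> f z = 0" and K: "compact K"
  shows "(fx has_integral 0) UNIV" "(fy has_integral 0) UNIV"
proof -
  obtain R where R: "K \<subseteq> ball 0 R" "R > 0"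
    using bounded_subset_ballD[OF compact_imp_bounded[OF K]] by blast
  have nb: "R \<le> norm (x,y)" if "\<bar>x\<bar> \<ge> R \<or> \<bar>y\<bar> \<ge> R" for x y :: real
    using that norm_fst_le[of x y] norm_snd_le[of y x] by auto
  have z0: "f (x,y) = 0" if "\<bar>x\<bar> \<ge> R \<or> \<bar>y\<bar> \<ge> R" for x y
  proof (rule z)
    show "(x,y) \<notin> K" using R nb[OF that] by fastforce
  qed
  have zop: "fx w = 0 \<and> fy w = 0" if "w \<notin> K" for w
  proof -
    have o: "open (-K)" using K by (simp add: compact_imp_closed open_Compl)
    have "C1_on (-K) f (\<lambda>z. 0) (\<lambda>z. 0)"
      by (rule C1_on_cong[OF C1_on_const[of _ 0] o]) (use z in auto)
    from C1_on_unique[OF C this] that show ?thesis by auto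
  qed
  have out: "w \<notin> K" if "w \<notin> cbox (-R,-R) (R,R)" for w
    using that R nb[of "fst w" "snd w"] by (cases w) (force simp: cbox_Pair_eq)
  have cx: "continuous_on (cbox (-R,-R) (R,R)) fx" "continuous_on (cbox (-R,-R) (R,R)) fy"
    using C unfolding C1_on_def by (auto intro: continuous_on_subset)
  have ix: "integral (cbox (-R) R) (\<lambda>x. fx (x,y)) = 0" for y
  proof -
    have "((\<lambda>x. fx (x,y)) has_integral f (R,y) - f (-R,y)) {-R..R}"
      using C1_on_fx_partial(1)[OF C, of _ y] R
      by (intro fundamental_theorem_of_calculus)
        (auto simp: has_real_derivative_iff_has_vector_derivative[symmetric] intro: DERIV_subset)
    then show ?thesis using R z0 by (simp add: integral_unique)
  qed
  have iy: "integral (cbox (-R) R) (\<lambda>y. fy (x,y)) = 0" for x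
  proof -
    have "((\<lambda>y. fy (x,y)) has_integral f (x,R) - f (x,-R)) {-R..R}"
      using C1_on_fx_partial(2)[OF C, of x] R
      by (intro fundamental_theorem_of_calculus)
        (auto simp: has_real_derivative_iff_has_vector_derivative[symmetric] intro: DERIV_subset)
    then show ?thesis using R z0 by (simp add: integral_unique)
  qed
  have "integral (cbox (-R,-R) (R,R)) fy = integral (cbox (-R) R) (\<lambda>x. integral (cbox (-R) R) (\<lambda>y. fy (x,y)))"
    by (rule integral_prod_continuous[OF cx(2)])
  also have "\<dots> = 0" using iy by simp
  finally have y0: "integral (cbox (-R,-R) (R,R)) fy = 0" .
  have "integral (cbox (-R,-R) (R,R)) fx = integral (cbox (-R) R) (\<lambda>x. integral (cbox (-R) R) (\<lambda>y. fx (x,y)))"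
    by (rule integral_prod_continuous[OF cx(1)])
  also have "\<dots> = integral (cbox (-R) R) (\<lambda>y. integral (cbox (-R) R) (\<lambda>x. fx (x,y)))"
    by (rule integral_swap_continuous) (use cx in simp)
  also have "\<dots> = 0" using ix by simp
  finally have x0: "integral (cbox (-R,-R) (R,R)) fx = 0" .
  show "(fx has_integral 0) UNIV" "(fy has_integral 0) UNIV"
    by (rule has_integral_cbox_UNIV[where a="(-R,-R)" and b="(R,R)"];
        use integrable_continuous[OF cx(1)] integrable_continuous[OF cx(2)] x0 y0 out zop integrable_integral in metis)+
qed

section \<open>Polar coordinates\<close>

text \<open>The branch with values in [0, 2\<pi>) has its cut along the nonnegative x-axis, which
  lies outside \<open>Lambda \<beta>\<close>. As \<open>ang 0 = 0\<close>, the single condition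
  \<open>0 < ang z\<close> excludes the origin together with the cut.\<close>

definition ang :: "real \<times> real \<Rightarrow> real" where
  "ang z = Arg2pi (Complex (fst z) (snd z))"

lemma norm_Complex_pair: "cmod (Complex (fst z) (snd z)) = norm z"
  by (simp add: norm_prod_def cmod_def)

lemma ang_bounds: "0 \<le> ang z" "ang z < 2*pi"
  using Arg2pi[of "Complex (fst z) (snd z)"] by (auto simp: ang_def)

lemma polar_fst: "fst z = norm z * cos (ang z)" and polar_snd: "snd z = norm z * sin (ang z)"
  using cos_Arg2pi[of "Complex (fst z) (snd z)"] sin_Arg2pi[of "Complex (fst z) (snd z)"]
  by (auto simp: ang_def norm_Complex_pair)

lemma norm_sq: "(norm z)\<^sup>2 = (fst z)\<^sup>2 + (snd z)\<^sup>2" for z :: "real \<times> real"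
  by (simp add: norm_prod_def)

lemma ang_unique:
  assumes "r > 0" "0 \<le> t" "t < 2*pi"
  shows "ang (r * cos t, r * sin t) = t"
  unfolding ang_def
  by (rule Arg2pi_unique[of r]) (use assms in \<open>auto simp: complex_eq_iff Re_exp Im_exp\<close>)

lemma ang_pos_iff: "0 < ang z \<longleftrightarrow> \<not> (snd z = 0 \<and> fst z \<ge> 0)"
  using Arg2pi_eq_0[of "Complex (fst z) (snd z)"] ang_bounds[of z]
  by (auto simp: ang_def complex_is_Real_iff)

lemma ang_pos_nz: "0 < ang z \<Longrightarrow> z \<noteq> 0" "0 < ang z \<Longrightarrow> norm z > 0"
  using ang_pos_iff[of z] by auto

lemma ang_lt_pi: "0 < ang z \<and> ang z < pi \<longleftrightarrow> 0 < snd z"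
  using Arg2pi_lt_pi[of "Complex (fst z) (snd z)"] by (auto simp: ang_def)

text \<open>\<open>(rad_x, rad_y)\<close> is the gradient of \<open>ln (norm z)\<close>; turned by a
  right angle, \<open>(- rad_y, rad_x)\<close> is the gradient of the polar angle.\<close>

definition rad_x :: "real \<times> real \<Rightarrow> real" where "rad_x z = fst z / (norm z)\<^sup>2"
definition rad_y :: "real \<times> real \<Rightarrow> real" where "rad_y z = snd z / (norm z)\<^sup>2"

text \<open>Off the cut, \<open>ang\<close> is the imaginary part of \<open>Ln (- w)\<close> plus
  \<pi>, and \<open>Ln\<close> is holomorphic away from the nonpositive axis.\<close>

lemma C1_on_ang: "C1_on {z. 0 < ang z} ang (\<lambda>z. - rad_y z) rad_x"
proof -
  let ?C = "\<lambda>z::real\<times>real. Complex (fst z) (snd z)"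
  have "(ang has_derivative (\<lambda>h. fst h * (- rad_y z) + snd h * rad_x z)) (at z)"
    if z: "0 < ang z" for z
  proof -
    have nr: "- ?C z \<notin> \<real>\<^sub>\<le>\<^sub>0" using z by (auto simp: ang_pos_iff complex_nonpos_Reals_iff)
    have l: "linear ?C" by (auto intro!: linearI simp: complex_eq_iff)
    then have C: "(?C has_derivative ?C) (at z)"
      by (simp add: linear_conv_bounded_linear bounded_linear_imp_has_derivative)
    have "((\<lambda>w. Ln (-w)) has_field_derivative (inverse (- ?C z) * (-1))) (at (?C z))"
      using nr by (auto intro!: derivative_eq_intros simp: divide_inverse)
    from has_derivative_compose[OF C this[unfolded has_field_derivative_def]]
    have "((\<lambda>w. Ln (- ?C w)) has_derivative (\<lambda>h. ?C h / ?C z)) (at z)"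
      by (simp add: field_simps)
    then have "((\<lambda>w. Im (Ln (- ?C w)) + pi) has_derivative (\<lambda>h. Im (?C h / ?C z) + 0)) (at z)"
      by (intro has_derivative_add bounded_linear.has_derivative[OF bounded_linear_Im]) auto
    moreover have "Im (?C h / ?C z) + 0 = fst h * (- rad_y z) + snd h * rad_x z" for h
      by (simp add: Im_divide rad_x_def rad_y_def norm_sq power2_eq_square[symmetric] diff_divide_distrib)
    ultimately have d: "((\<lambda>w. Im (Ln (- ?C w)) + pi) has_derivative (\<lambda>h. fst h * (- rad_y z) + snd h * rad_x z)) (at z)"
      by simp
    have o: "open {z. 0 < ang z}"
    proof -
      have "{z. 0 < ang z} = ?C -` {w. 0 < Arg2pi w}" by (auto simp: ang_def)
      moreover have "continuous_on UNIV ?C"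
        using l by (simp add: linear_continuous_on linear_conv_bounded_linear)
      ultimately show ?thesis using open_Arg2pi2pi_gt[of 0] open_vimage by metis
    qed
    show ?thesis
      by (rule has_derivative_transform_within_open[OF d o]) (use z in \<open>auto simp: ang_def Arg2pi_Ln[symmetric]\<close>)
  qed
  then show ?thesis unfolding C1_on_def
    by (auto simp: rad_x_def[abs_def] rad_y_def[abs_def] dest: ang_pos_nz intro!: continuous_intros)
qed

lemma open_ang: "open {z. 0 < ang z \<and> ang z \<in> U}" if "open U"
proof -
  have o: "open {z. 0 < ang z}"
  proof -
    have "{z. 0 < ang z} = - {z. snd z = 0 \<and> fst z \<ge> 0}" using ang_pos_iff by auto
    moreover have "closed {z::real\<times>real. snd z = 0 \<and> fst z \<ge> 0}"
      by (intro closed_Collect_conj closed_Collect_eq closed_Collect_le continuous_intros)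
    ultimately show ?thesis by (simp add: open_Compl)
  qed
  have "{z. 0 < ang z \<and> ang z \<in> U} = {z. 0 < ang z} \<inter> ang -` U" by auto
  then show ?thesis
    using continuous_open_preimage[OF C1_on_cont[OF C1_on_ang] o that] by simp
qed

lemma C1_on_lnr: "C1_on (-{0}) (\<lambda>z. ln (norm z)) rad_x rad_y"
proof -
  have "C1_on (-{0}) (\<lambda>z. fst z * fst z + snd z * snd z)
     (\<lambda>z. 1 * fst z + fst z * 1 + (0 * snd z + snd z * 0)) (\<lambda>z. 0 * fst z + fst z * 0 + (1 * snd z + snd z * 1))"
    by (intro C1_on_add C1_on_mult C1_on_fst C1_on_snd)
  then have "C1_on (-{0}) (\<lambda>z. (norm z)\<^sup>2) (\<lambda>z. 2 * fst z) (\<lambda>z. 2 * snd z)"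
    by (simp add: norm_sq power2_eq_square[symmetric])
  then have c: "C1_on (-{0}) (\<lambda>z::real\<times>real. ln ((norm z)\<^sup>2) / 2) (\<lambda>z. 1 / (norm z)\<^sup>2 / 2 * (2 * fst z)) (\<lambda>z. 1 / (norm z)\<^sup>2 / 2 * (2 * snd z))"
  proof (rule C1_on_comp[where \<phi>="\<lambda>x. ln x / 2" and \<phi>'="\<lambda>x. 1 / x / 2"])
    fix z :: "real \<times> real" assume "z \<in> -{0}"
    then have "(norm z)\<^sup>2 > 0" by simp
    then show "((\<lambda>x. ln x / 2) has_real_derivative 1 / (norm z)\<^sup>2 / 2) (at ((norm z)\<^sup>2))"
      by (rule DERIV_cdivide[OF DERIV_ln_divide])
  next
    show "continuous_on ((\<lambda>z::real\<times>real. (norm z)\<^sup>2) ` (- {0})) (\<lambda>x. 1 / x / 2)"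
      by (intro continuous_intros) simp_all
  qed
  have o: "open (-{0::real\<times>real})" by (simp add: open_Compl)
  show ?thesis
  proof (rule C1_on_cong[OF c o])
    fix z :: "real \<times> real"
    show "ln (norm z) = ln ((norm z)\<^sup>2) / 2" unfolding ln_realpow by simp
    show "rad_x z = 1 / (norm z)\<^sup>2 / 2 * (2 * fst z)" "rad_y z = 1 / (norm z)\<^sup>2 / 2 * (2 * snd z)"
      by (simp_all add: rad_x_def rad_y_def)
  qed
qed

lemma rad_sq: "(rad_x z)\<^sup>2 + (rad_y z)\<^sup>2 = 1 / (norm z)\<^sup>2" if "z \<noteq> 0"
proof -
  have "(rad_x z)\<^sup>2 + (rad_y z)\<^sup>2 = (norm z)\<^sup>2 / ((norm z)\<^sup>2)\<^sup>2"
    by (simp add: rad_x_def rad_y_def power_divide add_divide_distrib[symmetric] norm_sq[symmetric] del: power2_eq_square)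
  then show ?thesis using that by (simp add: power2_eq_square)
qed

text \<open>The entries show that \<open>(rad_x, rad_y)\<close> and \<open>(- rad_y, rad_x)\<close>
  are both divergence free: ln r and the polar angle are harmonic. The factor 1/r^2 is
  differentiated as exp (- 2 ln r), which reuses the gradient of ln r.\<close>

lemma C1_on_rad:
  "C1_on (-{0}) rad_x (\<lambda>z. (rad_y z)\<^sup>2 - (rad_x z)\<^sup>2) (\<lambda>z. - 2 * rad_x z * rad_y z)"
  "C1_on (-{0}) rad_y (\<lambda>z. - 2 * rad_x z * rad_y z) (\<lambda>z. (rad_x z)\<^sup>2 - (rad_y z)\<^sup>2)"
proof -
  have "C1_on (-{0}) (\<lambda>z. exp (- 2 * ln (norm z))) (\<lambda>z. - 2 * exp (- 2 * ln (norm z)) * rad_x z) (\<lambda>z. - 2 * exp (-2 * ln (norm z)) * rad_y z)"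
    by (rule C1_on_comp[OF C1_on_lnr, where \<phi>="\<lambda>x. exp (-2 * x)" and \<phi>'="\<lambda>x. -2 * exp (-2 * x)"])
      (auto intro!: derivative_eq_intros continuous_intros)
  note c = this
  have e: "exp (- 2 * ln (norm z)) = 1 / (norm z)\<^sup>2" if "z \<noteq> 0" for z :: "real \<times> real"
    using that by (simp add: exp_minus exp_double power2_eq_square[symmetric] divide_inverse)
  have o: "open (-{0::real\<times>real})" by (simp add: open_Compl)
  have n: "C1_on (-{0}) (\<lambda>z. 1 / (norm z)\<^sup>2) (\<lambda>z. - 2 * (1 / (norm z)\<^sup>2) * rad_x z) (\<lambda>z. - 2 * (1 / (norm z)\<^sup>2) * rad_y z)"
    by (rule C1_on_cong[OF c o]) (simp_all only: e Compl_iff singleton_iff not_False_eq_True)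
  note r = rad_sq
  show "C1_on (-{0}) rad_x (\<lambda>z. (rad_y z)\<^sup>2 - (rad_x z)\<^sup>2) (\<lambda>z. - 2 * rad_x z * rad_y z)"
  proof (rule C1_on_cong[OF C1_on_mult[OF C1_on_fst n] o])
    fix z :: "real \<times> real" assume "z \<in> -{0}"
    then have z: "z \<noteq> 0" by simp
    have f: "fst z * (1 / (norm z)\<^sup>2) = rad_x z" by (simp add: rad_x_def)
    have "1 * (1 / (norm z)\<^sup>2) + fst z * (- 2 * (1 / (norm z)\<^sup>2) * rad_x z) =
       (rad_x z)\<^sup>2 + (rad_y z)\<^sup>2 - 2 * (fst z * (1 / (norm z)\<^sup>2)) * rad_x z"
      unfolding r[OF z] by (simp add: algebra_simps)
    then show "(rad_y z)\<^sup>2 - (rad_x z)\<^sup>2 = 1 * (1 / (norm z)\<^sup>2) + fst z * (- 2 * (1 / (norm z)\<^sup>2) * rad_x z)"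
      unfolding f by (simp add: power2_eq_square)
  qed (simp_all add: rad_x_def)
  show "C1_on (-{0}) rad_y (\<lambda>z. - 2 * rad_x z * rad_y z) (\<lambda>z. (rad_x z)\<^sup>2 - (rad_y z)\<^sup>2)"
  proof (rule C1_on_cong[OF C1_on_mult[OF C1_on_snd n] o])
    fix z :: "real \<times> real" assume "z \<in> -{0}"
    then have z: "z \<noteq> 0" by simp
    have f: "snd z * (1 / (norm z)\<^sup>2) = rad_y z" by (simp add: rad_y_def)
    have "1 * (1 / (norm z)\<^sup>2) + snd z * (- 2 * (1 / (norm z)\<^sup>2) * rad_y z) =
       (rad_x z)\<^sup>2 + (rad_y z)\<^sup>2 - 2 * (snd z * (1 / (norm z)\<^sup>2)) * rad_y z"
      unfolding r[OF z] by (simp add: algebra_simps)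
    then show "(rad_x z)\<^sup>2 - (rad_y z)\<^sup>2 = 1 * (1 / (norm z)\<^sup>2) + snd z * (- 2 * (1 / (norm z)\<^sup>2) * rad_y z)"
      unfolding f by (simp add: power2_eq_square)
  qed (simp_all add: rad_y_def)
qed

section \<open>Linear second-order equations on the line\<close>

lemma abs_le_exp_integral_nonneg:
  fixes F f :: "real \<Rightarrow> real"
  assumes F: "\<And>x. (F has_real_derivative f x) (at x)" and F0: "F 0 = 0" and l: "l > 0" "K \<ge> 0"
    and b: "\<And>x. x \<ge> 0 \<Longrightarrow> \<bar>f x\<bar> \<le> K * exp (l * x)" and x: "x \<ge> 0"
  shows "\<bar>F x\<bar> \<le> K / l * exp (l * x)"
proof -
  have "K / l * exp (l * 0) - s * F 0 \<le> K / l * exp (l * x) - s * F x" if s: "\<bar>s\<bar> = 1" for s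
  proof (rule DERIV_nonneg_imp_nondecreasing[OF x])
    fix t assume t: "0 \<le> t" "t \<le> x"
    have "((\<lambda>x. K / l * exp (l * x) - s * F x) has_real_derivative (K * exp (l * t) - s * f t)) (at t)"
      using l by (auto intro!: derivative_eq_intros F)
    moreover have "s * f t \<le> \<bar>f t\<bar>" using s by (auto simp: abs_if split: if_splits)
    ultimately show "\<exists>y. ((\<lambda>x. K / l * exp (l * x) - s * F x) has_real_derivative y) (at t) \<and> 0 \<le> y"
      using b[OF t(1)] by fastforce
  qed
  from this[of 1] this[of "-1"] F0 l show ?thesis by (auto simp: abs_le_iff field_simps)
qed

text \<open>In the supremum norm weighted by \<open>exp (- l * \<bar>x\<bar>)\<close>, integration
  from 0 gains the factor \<open>1 / l\<close>. A large \<open>l\<close> thus makes Picard iteration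
  contract on the whole line at once.\<close>

lemma abs_le_exp_integral:
  fixes F f :: "real \<Rightarrow> real"
  assumes F: "\<And>x. (F has_real_derivative f x) (at x)" and F0: "F 0 = 0" and l: "l > 0" "K \<ge> 0"
    and b: "\<And>x. \<bar>f x\<bar> \<le> K * exp (l * \<bar>x\<bar>)"
  shows "\<bar>F x\<bar> \<le> K / l * exp (l * \<bar>x\<bar>)"
proof (cases "x \<ge> 0")
  case True
  then show ?thesis using abs_le_exp_integral_nonneg[OF F F0 l _ True] b by (metis abs_of_nonneg)
next
  case False
  have d: "((\<lambda>x. F (- x)) has_real_derivative - f (- x)) (at x)" for x
    using DERIV_chain2[where f=F and g="\<lambda>x. - x", OF F DERIV_minus[OF DERIV_ident]] by simp
  have "\<bar>F (- (-x))\<bar> \<le> K / l * exp (l * (- x))"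
    by (rule abs_le_exp_integral_nonneg[OF d _ l]) (use F0 False b in \<open>auto, metis abs_minus_cancel abs_of_nonneg\<close>)
  then show ?thesis using False by simp
qed

lemma antiderivative_exists:
  fixes f :: "real \<Rightarrow> real"
  assumes "continuous_on UNIV f"
  shows "\<exists>F. (\<forall>x. (F has_real_derivative f x) (at x)) \<and> F 0 = 0"
proof -
  have "\<exists>F. \<forall>x::real. -\<infinity> < ereal x \<longrightarrow> ereal x < \<infinity> \<longrightarrow> (F has_vector_derivative f x) (at x)"
    by (rule einterval_antiderivative) (use assms in \<open>auto simp: continuous_on_eq_continuous_at\<close>)
  then obtain F where "\<And>x. (F has_real_derivative f x) (at x)"
    by (auto simp: has_real_derivative_iff_has_vector_derivative)
  then have "(\<forall>x. ((\<lambda>t. F t - F 0) has_real_derivative f x) (at x)) \<and> F 0 - F 0 = 0"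
    by (auto intro!: derivative_eq_intros)
  then show ?thesis by (intro exI[of _ "\<lambda>t. F t - F 0"])
qed

text \<open>The Picard series is summed: \<open>u (Suc n)\<close> is the double integral of
  \<open>q * u n\<close>, and \<open>v\<close>, \<open>w\<close> are the first and second
  derivatives of \<open>u\<close>. Geometric bounds on all three series, uniform on bounded
  intervals, permit differentiation term by term.\<close>

lemma linear_ode_exists:
  fixes q :: "real \<Rightarrow> real"
  assumes q: "continuous_on UNIV q" and M: "\<And>x. \<bar>q x\<bar> \<le> M"
  obtains y y1 where "\<And>x. (y has_real_derivative y1 x) (at x)"
    "\<And>x. (y1 has_real_derivative q x * y x) (at x)" "y 0 = 1" "y1 0 = 0"
proof -
  \<comment> \<open>A fixed choice of antiderivative vanishing at 0 turns the iteration into a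
    recursion on functions.\<close>
  define J where "J f = (SOME F. (\<forall>x::real. (F has_real_derivative f x) (at x)) \<and> F 0 = (0::real))" for f
  have J: "(J f has_real_derivative f x) (at x)" "J f 0 = 0" if "continuous_on UNIV f" for f x
    using someI_ex[OF antiderivative_exists[OF that]] by (auto simp: J_def)
  have Jc: "continuous_on UNIV (J f)" if "continuous_on UNIV f" for f
    using J(1)[OF that] by (meson DERIV_continuous_on has_field_derivative_at_within)
  define u where "u = rec_nat (\<lambda>_. 1) (\<lambda>n f. J (J (\<lambda>x. q x * f x)))"
  have u0: "u 0 = (\<lambda>_. 1)" and uS: "u (Suc n) = J (J (\<lambda>x. q x * u n x))" for n
    by (auto simp: u_def)
  define v where "v n = (case n of 0 \<Rightarrow> (\<lambda>_. 0) | Suc k \<Rightarrow> J (\<lambda>x. q x * u k x))" for n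
  define w where "w n = (case n of 0 \<Rightarrow> (\<lambda>_. 0) | Suc k \<Rightarrow> (\<lambda>x. q x * u k x))" for n
  have uc: "continuous_on UNIV (u n)" for n
    by (induction n) (auto simp: u0 uS intro!: Jc continuous_intros q)
  have wc: "continuous_on UNIV (w n)" for n
    by (cases n) (auto simp: w_def intro!: continuous_intros q uc)
  have dv: "(v n has_real_derivative w n x) (at x)" for n x
    using J(1)[OF wc, of "n"] by (cases n) (auto simp: v_def w_def)
  have vc: "continuous_on UNIV (v n)" for n
    using dv by (meson DERIV_continuous_on has_field_derivative_at_within)
  have du: "(u n has_real_derivative v n x) (at x)" for n x
    using J(1)[OF vc, of "n"] by (cases n) (auto simp: v_def u0 uS)
  have v0: "v n 0 = 0" for n using J(2)[OF wc, of n] by (cases n) (auto simp: v_def w_def)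
  have u00: "u (Suc n) 0 = 0" for n using J(2)[OF vc, of "Suc n"] by (auto simp: v_def uS)
  have M0: "M \<ge> 0" using M[of 0] by linarith
  \<comment> \<open>Two integrations gain \<open>(M + 1) / l\<^sup>2\<close>, and this
    \<open>l\<close> makes the gain 1/2. The summand 1 keeps \<open>l\<close> positive when
    \<open>M = 0\<close>.\<close>
  define l where "l = sqrt (2 * (M + 1))"
  have l: "l > 0" "l\<^sup>2 = 2 * (M + 1)" using M0 by (auto simp: l_def)
  have bd: "\<bar>u n x\<bar> \<le> (1/2)^n * exp (l * \<bar>x\<bar>)" for n x
  proof (induction n arbitrary: x)
    case 0 then show ?case using l by (simp add: u0)
  next
    case (Suc n)
    have "\<bar>w (Suc n) x\<bar> \<le> ((M+1) * (1/2)^n) * exp (l * \<bar>x\<bar>)" for x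
    proof -
      have "\<bar>q x\<bar> * \<bar>u n x\<bar> \<le> (M+1) * ((1/2)^n * exp (l * \<bar>x\<bar>))"
        using Suc[of x] M[of x] M0 by (intro mult_mono) auto
      then show ?thesis by (simp add: w_def abs_mult algebra_simps)
    qed
    from abs_le_exp_integral[OF dv v0 l(1) _ this] M0
    have "\<bar>v (Suc n) x\<bar> \<le> ((M+1) * (1/2)^n / l) * exp (l * \<bar>x\<bar>)" for x by simp
    from abs_le_exp_integral[OF du u00 l(1) _ this] M0 l
    have "\<bar>u (Suc n) x\<bar> \<le> ((M+1) * (1/2)^n / l / l) * exp (l * \<bar>x\<bar>)" by simp
    also have "(M+1) * (1/2)^n / l / l = (M+1) / l\<^sup>2 * (1/2)^n" by (simp add: power2_eq_square)
    also have "(M+1) / l\<^sup>2 = 1/2" using M0 unfolding l(2) by simp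
    also have "1/2 * (1/2)^n = (1/2::real)^Suc n" by simp
    finally show ?case .
  qed
  have bdw: "\<bar>w n x\<bar> \<le> (2 * (M+1) * (1/2)^n) * exp (l * \<bar>x\<bar>)" for n x
  proof (cases n)
    case 0 then show ?thesis using M0 by (simp add: w_def)
  next
    case (Suc k)
    have "\<bar>q x\<bar> * \<bar>u k x\<bar> \<le> (M+1) * ((1/2)^k * exp (l * \<bar>x\<bar>))"
      using bd[of k x] M[of x] M0 by (intro mult_mono) auto
    then show ?thesis by (simp add: w_def Suc abs_mult algebra_simps)
  qed
  have bdv: "\<bar>v n x\<bar> \<le> (2 * (M+1) / l * (1/2)^n) * exp (l * \<bar>x\<bar>)" for n x
    using abs_le_exp_integral[OF dv v0 l(1) _ bdw, of n x] M0 by simp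
  have uc: "uniformly_convergent_on {-R..R} (\<lambda>n x. \<Sum>i<n. f i x)"
    if b: "\<And>n x. \<bar>f n x\<bar> \<le> (C * (1/2)^n) * exp (l * \<bar>x\<bar>)" and C: "C \<ge> 0" for f :: "nat \<Rightarrow> real \<Rightarrow> real" and C R
  proof (rule Weierstrass_m_test'[where M="\<lambda>n. (C * (1/2)^n) * exp (l * R)"])
    show "norm (f n x) \<le> (C * (1/2)^n) * exp (l * R)" if "x \<in> {-R..R}" for n x
    proof -
      have "l * \<bar>x\<bar> \<le> l * R" using l that by (intro mult_left_mono) auto
      then have "(C * (1/2)^n) * exp (l * \<bar>x\<bar>) \<le> (C * (1/2)^n) * exp (l * R)"
        using C by (intro mult_left_mono) auto
      with b[of n x] show ?thesis by simp
    qed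
    show "summable (\<lambda>n. (C * (1/2)^n) * exp (l * R))"
      by (intro summable_mult summable_mult2 summable_geometric) simp
  qed
  define y where "y x = (\<Sum>n. u n x)" for x
  define y1 where "y1 x = (\<Sum>n. v n x)" for x
  have s0: "summable (\<lambda>n. u n 0)" using bd[of _ 0]
    by (intro summable_comparison_test'[OF summable_geometric[of "1/2::real"], of 0]) auto
  have "summable (\<lambda>n. u n x)" and dy: "(y has_real_derivative y1 x) (at x)" for x
  proof -
    have x: "x \<in> interior {-(\<bar>x\<bar>+1)..\<bar>x\<bar>+1}" by auto
    have "uniformly_convergent_on {-(\<bar>x\<bar>+1)..\<bar>x\<bar>+1} (\<lambda>n x. \<Sum>i<n. v i x)"
      by (rule uc[OF bdv]) (use M0 l in auto)
    note * = has_field_derivative_series'[where f=u and f'=v, OF convex_real_interval(5) _ this _ s0 x]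
    show "summable (\<lambda>n. u n x)"
      by (rule *) (auto intro: has_field_derivative_at_within du)
    show "(y has_real_derivative y1 x) (at x)" unfolding y_def[abs_def] y1_def
      by (rule *) (auto intro: has_field_derivative_at_within du)
  qed
  note su = this(1)
  have dy1: "(y1 has_real_derivative q x * y x) (at x)" for x
  proof -
    have x: "x \<in> interior {-(\<bar>x\<bar>+1)..\<bar>x\<bar>+1}" by auto
    have s: "summable (\<lambda>n. v n 0)" by (simp add: v0)
    have "((\<lambda>x. \<Sum>n. v n x) has_real_derivative (\<Sum>n. w n x)) (at x)"
    proof (rule has_field_derivative_series'[where f=v and f'=w, OF convex_real_interval(5) _ _ _ s x])
      show "uniformly_convergent_on {-(\<bar>x\<bar>+1)..\<bar>x\<bar>+1} (\<lambda>n x. \<Sum>i<n. w i x)"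
        by (rule uc[OF bdw]) (use M0 in auto)
    qed (auto intro: has_field_derivative_at_within dv)
    \<comment> \<open>\<open>w 0\<close> is 0 because \<open>u 0\<close> is constant, so the series
      of \<open>w\<close> is \<open>q\<close> times the series of \<open>u\<close> shifted by one
      index.\<close>
    moreover have "(\<lambda>n. w (Suc n) x) sums (q x * y x)"
      using su[of x] unfolding y_def by (auto simp: w_def intro: sums_mult summable_sums)
    then have "(\<Sum>n. w n x) = q x * y x" using sums_Suc_iff[of "\<lambda>n. w n x"] by (auto simp: w_def sums_iff)
    ultimately show ?thesis by (simp add: y1_def[abs_def])
  qed
  have "y 0 = 1" unfolding y_def using suminf_split_head[OF s0] u00 by (simp add: u0)
  moreover have "y1 0 = 0" by (simp add: y1_def v0)
  ultimately show ?thesis using that dy dy1 by blast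
qed

text \<open>The equation is invariant under reflection about \<open>m\<close>; averaging a solution
  with its mirror image enforces the symmetry directly, instead of deriving it from
  uniqueness.\<close>

lemma even_linear_ode_exists:
  fixes q :: "real \<Rightarrow> real"
  assumes q: "continuous_on UNIV q" and M: "\<And>x. \<bar>q x\<bar> \<le> M" and sym: "\<And>x. q (2 * m - x) = q x"
  obtains y y1 where "\<And>x. (y has_real_derivative y1 x) (at x)"
    "\<And>x. (y1 has_real_derivative q x * y x) (at x)" "y m = 1" "y1 m = 0"
    "\<And>x. y (2 * m - x) = y x" "\<And>x. y1 (2 * m - x) = - y1 x"
proof -
  have "continuous_on UNIV (\<lambda>x. q (x + m))"
    by (rule continuous_on_compose2[OF q]) (auto intro!: continuous_intros)
  from linear_ode_exists[OF this M] obtain y y1 where y: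
    "\<And>x. (y has_real_derivative y1 x) (at x)"
    "\<And>x. (y1 has_real_derivative q (x + m) * y x) (at x)" "y 0 = 1" "y1 0 = 0" by blast
  define Y where "Y x = (y (x - m) + y (m - x)) / 2" for x
  define Y1 where "Y1 x = (y1 (x - m) - y1 (m - x)) / 2" for x
  have d: "((\<lambda>x. f (x - m)) has_real_derivative f' (x - m)) (at x)"
    "((\<lambda>x. f (m - x)) has_real_derivative - f' (m - x)) (at x)"
    if f: "\<And>x. (f has_real_derivative f' x) (at x)" for f f' :: "real \<Rightarrow> real" and x
  proof -
    have "((\<lambda>x. x - m) has_real_derivative 1) (at x)" "((\<lambda>x. m - x) has_real_derivative - 1) (at x)"
      by (auto intro!: derivative_eq_intros)
    from DERIV_chain2[OF f this(1)] DERIV_chain2[OF f this(2)]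
    show "((\<lambda>x. f (x - m)) has_real_derivative f' (x - m)) (at x)"
      "((\<lambda>x. f (m - x)) has_real_derivative - f' (m - x)) (at x)" by simp_all
  qed
  have "(Y has_real_derivative Y1 x) (at x)" for x
    using DERIV_cdivide[OF DERIV_add[OF d(1)[of y y1 x, OF y(1)] d(2)[of y y1 x, OF y(1)]], of 2] unfolding Y_def Y1_def by simp
  moreover have "(Y1 has_real_derivative q x * Y x) (at x)" for x
  proof -
    have "q (m - x + m) = q x" using sym[of x] by (simp add: algebra_simps)
    then show ?thesis
      using DERIV_cdivide[OF DERIV_diff[OF d(1)[of y1 _ x, OF y(2)] d(2)[of y1 _ x, OF y(2)]], of 2] unfolding Y_def Y1_def
      by (simp add: algebra_simps)
  qed
  ultimately show ?thesis
    by (rule that) (simp_all add: Y_def Y1_def y algebra_simps minus_divide_left)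
qed

section \<open>The domains\<close>

lemma Lambda_eq: "Lambda \<beta> = {z. 0 < ang z \<and> ang z < \<beta>}" if "\<beta> \<le> 2 * pi"
proof (intro equalityI subsetI)
  fix z assume "z \<in> Lambda \<beta>"
  then obtain r t where "z = (r * cos t, r * sin t)" "r > 0" "0 < t" "t < \<beta>"
    unfolding Lambda_def by auto
  then show "z \<in> {z. 0 < ang z \<and> ang z < \<beta>}" using ang_unique[of r t] that by simp
next
  fix z assume "z \<in> {z. 0 < ang z \<and> ang z < \<beta>}"
  then have "0 < ang z" "ang z < \<beta>" by auto
  moreover have "z = (norm z * cos (ang z), norm z * sin (ang z))"
    using polar_fst[of z] polar_snd[of z] by (metis prod.collapse)
  ultimately show "z \<in> Lambda \<beta>" unfolding Lambda_def using ang_pos_nz by blast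
qed

text \<open>With \<open>edge_Y\<close>, orthonormal coordinates at \<open>P\<close>:
  \<open>edge_p\<close> runs along \<open>L1\<close>, and \<open>edge_Y\<close> is the signed
  distance from the line of \<open>L1\<close>, positive at \<open>O\<close> when \<gamma> <
  \<pi>.\<close>

definition edge_p :: "real \<Rightarrow> real \<times> real \<Rightarrow> real" where
  "edge_p \<gamma> z = (1 - fst z) * cos \<gamma> + snd z * sin \<gamma>"

definition edge_Y :: "real \<Rightarrow> real \<times> real \<Rightarrow> real" where
  "edge_Y \<gamma> z = (1 - fst z) * sin \<gamma> - snd z * cos \<gamma>"

lemma edge_coords:
  "1 - fst z = edge_p \<gamma> z * cos \<gamma> + edge_Y \<gamma> z * sin \<gamma>"
  "snd z = edge_p \<gamma> z * sin \<gamma> - edge_Y \<gamma> z * cos \<gamma>"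
proof -
  have "edge_p \<gamma> z * cos \<gamma> + edge_Y \<gamma> z * sin \<gamma> = (1 - fst z) * ((sin \<gamma>)\<^sup>2 + (cos \<gamma>)\<^sup>2)"
    "edge_p \<gamma> z * sin \<gamma> - edge_Y \<gamma> z * cos \<gamma> = snd z * ((sin \<gamma>)\<^sup>2 + (cos \<gamma>)\<^sup>2)"
    by (simp_all only: edge_p_def edge_Y_def power2_eq_square algebra_simps)
  then show "1 - fst z = edge_p \<gamma> z * cos \<gamma> + edge_Y \<gamma> z * sin \<gamma>"
    "snd z = edge_p \<gamma> z * sin \<gamma> - edge_Y \<gamma> z * cos \<gamma>" by simp_all
qed

lemma edge_dist: "(dist z w)\<^sup>2 = (edge_p \<gamma> z - edge_p \<gamma> w)\<^sup>2 + (edge_Y \<gamma> z - edge_Y \<gamma> w)\<^sup>2"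
proof -
  have "(dist z w)\<^sup>2 = (fst z - fst w)\<^sup>2 + (snd z - snd w)\<^sup>2"
    by (simp add: dist_prod_def dist_real_def)
  also have "\<dots> = ((fst z - fst w)\<^sup>2 + (snd z - snd w)\<^sup>2) * ((sin \<gamma>)\<^sup>2 + (cos \<gamma>)\<^sup>2)" by simp
  also have "\<dots> = (edge_p \<gamma> z - edge_p \<gamma> w)\<^sup>2 + (edge_Y \<gamma> z - edge_Y \<gamma> w)\<^sup>2"
    unfolding edge_p_def edge_Y_def power2_eq_square by (simp only: algebra_simps)
  finally show ?thesis .
qed

text \<open>In the frame of \<open>L1\<close> the vertex \<open>O\<close> has coordinates (cos
  \<gamma>, sin \<gamma>), and the direction from \<open>O\<close> to \<open>z\<close> makes the
  angle \<open>ang z - pi + \<gamma>\<close> with the first axis.\<close>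

lemma edge_Y_polar: "edge_Y \<gamma> z = norm z * sin (ang z - pi + \<gamma>) + sin \<gamma>"
  and edge_p_polar: "edge_p \<gamma> z = norm z * cos (ang z - pi + \<gamma>) + cos \<gamma>"
proof -
  have sc: "sin (ang z - pi + \<gamma>) = - (sin (ang z) * cos \<gamma> + cos (ang z) * sin \<gamma>)"
    "cos (ang z - pi + \<gamma>) = - (cos (ang z) * cos \<gamma> - sin (ang z) * sin \<gamma>)"
    using sin_add[of "ang z" \<gamma>] cos_add[of "ang z" \<gamma>] sin_minus_pi[of "ang z + \<gamma>"] cos_minus_pi[of "ang z + \<gamma>"]
    by (simp_all add: algebra_simps)
  show "edge_Y \<gamma> z = norm z * sin (ang z - pi + \<gamma>) + sin \<gamma>"
    "edge_p \<gamma> z = norm z * cos (ang z - pi + \<gamma>) + cos \<gamma>"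
    unfolding edge_Y_def edge_p_def sc
    by (subst polar_fst[of z], subst polar_snd[of z], simp add: algebra_simps)+
qed

text \<open>The condition on \<open>edge_Y\<close> is imposed only above the axis: below it the
  domain is that of the sector, and the prolongation of \<open>L1\<close> beyond \<open>P\<close>
  must not cut it.\<close>

definition E_polar :: "real \<Rightarrow> real \<Rightarrow> (real \<times> real) set" where
  "E_polar \<beta> \<gamma> = {z. 0 < snd z \<and> 0 < edge_Y \<gamma> z} \<union> {z. pi \<le> ang z \<and> ang z < \<beta>}"

lemma L1_iff: "z \<in> L1 \<gamma> \<longleftrightarrow> edge_Y \<gamma> z = 0 \<and> edge_p \<gamma> z \<ge> 0"
proof
  assume "z \<in> L1 \<gamma>"
  then obtain t where t: "t \<ge> 0" "z = (1 - t * cos \<gamma>, t * sin \<gamma>)" unfolding L1_def by auto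
  have s: "(sin \<gamma>)\<^sup>2 = 1 - (cos \<gamma>)\<^sup>2" by (simp add: sin_squared_eq)
  have "edge_Y \<gamma> z = 0" "edge_p \<gamma> z = t"
    unfolding t(2) edge_Y_def edge_p_def fst_conv snd_conv
    using s by (simp_all add: right_diff_distrib power2_eq_square[symmetric] mult.assoc)
  then show "edge_Y \<gamma> z = 0 \<and> edge_p \<gamma> z \<ge> 0" using t by simp
next
  assume "edge_Y \<gamma> z = 0 \<and> edge_p \<gamma> z \<ge> 0"
  then show "z \<in> L1 \<gamma>"
    using edge_coords[of z \<gamma>] unfolding L1_def by (cases z) (auto intro!: exI[of _ "edge_p \<gamma> z"])
qed

lemma ang_ge_pi: "pi \<le> ang z \<Longrightarrow> snd z \<le> 0"
  using ang_lt_pi[of z] pi_gt_zero by (metis linorder_not_less)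

lemma ang_L3:
  assumes "pi \<le> \<beta>" "\<beta> \<le> 2 * pi" "z \<in> L3 \<beta>"
  shows "ang z = 0 \<or> ang z = \<beta>"
proof -
  obtain t where t: "t \<ge> 0" "z = (t * cos \<beta>, t * sin \<beta>)" using assms(3) unfolding L3_def by auto
  consider "t = 0" | "t > 0" "\<beta> < 2 * pi" | "t > 0" "\<beta> = 2 * pi" using t assms by linarith
  then show ?thesis
  proof cases
    case 1 then show ?thesis using t ang_pos_iff[of z] ang_bounds[of z] by auto
  next
    case 2 then show ?thesis using ang_unique[of t \<beta>] t assms pi_gt_zero by (simp add: less_imp_le)
  next
    case 3 then show ?thesis using t ang_pos_iff[of z] ang_bounds[of z] by auto
  qed
qed

lemma snd_zero_not_Lambda: "snd w = 0 \<Longrightarrow> fst w \<ge> 0 \<Longrightarrow> ang w = 0"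
  using ang_pos_iff[of w] ang_bounds[of w] by auto

lemma L2_iff: "z \<in> L2 \<longleftrightarrow> snd z = 0 \<and> 0 \<le> fst z \<and> fst z \<le> 1"
  unfolding L2_def by (cases z) (auto simp: closed_segment_def)

lemma L3_I: "ang z = \<beta> \<Longrightarrow> z \<in> L3 \<beta>"
  using polar_fst[of z] polar_snd[of z] unfolding L3_def by (cases z) (auto intro!: exI[of _ "norm z"])

lemma continuous_edge [continuous_intros]:
  "continuous_on S (edge_Y \<gamma>)" "continuous_on S (edge_p \<gamma>)"
  unfolding edge_Y_def[abs_def] edge_p_def[abs_def] by (intro continuous_intros)+

context
  fixes \<beta> \<gamma> :: real
  assumes bg: "0 < \<gamma>" "\<gamma> \<le> pi" "pi \<le> \<beta>" "\<beta> \<le> 2 * pi"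
begin

lemma E_polar_sub_Lambda: "E_polar \<beta> \<gamma> \<subseteq> Lambda \<beta>"
  unfolding Lambda_eq[OF bg(4)] E_polar_def using bg ang_lt_pi pi_gt_zero
  by (auto intro: less_le_trans)

lemma E_polar_sector:
  assumes "pi - \<gamma> < ang z" "0 < ang z" "ang z < \<beta>"
  shows "z \<in> E_polar \<beta> \<gamma>"
proof (cases "ang z < pi")
  case True
  then have "snd z > 0" using ang_lt_pi[of z] assms by auto
  moreover have "sin (ang z - pi + \<gamma>) > 0" using assms True bg by (intro sin_gt_zero) auto
  then have "norm z * sin (ang z - pi + \<gamma>) > 0" using ang_pos_nz[OF assms(2)] by simp
  moreover have "sin \<gamma> \<ge> 0" using bg by (intro sin_ge_zero) auto
  ultimately show ?thesis unfolding E_polar_def edge_Y_polar by auto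
next
  case False
  then show ?thesis using assms unfolding E_polar_def by auto
qed

text \<open>The second piece is enlarged to an open sector that overlaps the first. Openness across
  the negative axis and connectedness become visible in this form.\<close>

lemma E_polar_alt: "E_polar \<beta> \<gamma> = {z. 0 < snd z \<and> 0 < edge_Y \<gamma> z} \<union> {z. 0 < ang z \<and> ang z \<in> {pi - \<gamma><..<\<beta>}}"
proof -
  have "z \<in> {z. 0 < ang z \<and> ang z \<in> {pi - \<gamma><..<\<beta>}}" if "pi \<le> ang z \<and> ang z < \<beta>" for z
    using that bg pi_gt_zero by auto
  then show ?thesis using E_polar_sector unfolding E_polar_def by auto
qed

lemma open_E_polar: "open (E_polar \<beta> \<gamma>)"
  unfolding E_polar_alt
  by (intro open_Un open_ang open_greaterThanLessThan open_Collect_conj open_Collect_less continuous_intros)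

lemma connected_E_polar: "connected (E_polar \<beta> \<gamma>)"
proof -
  let ?A = "{z. 0 < snd z \<and> 0 < edge_Y \<gamma> z}" and ?B = "{z. 0 < ang z \<and> ang z \<in> {pi - \<gamma><..<\<beta>}}"
  have "?A = {z. (0,1) \<bullet> z > 0} \<inter> {z. (- sin \<gamma>, - cos \<gamma>) \<bullet> z > - sin \<gamma>}"
    by (auto simp: edge_Y_def inner_prod_def algebra_simps)
  then have cA: "convex ?A" by (simp add: convex_Int convex_halfspace_gt)
  have "?B = (\<lambda>(r,t). (r * cos t, r * sin t)) ` ({0<..} \<times> {pi - \<gamma><..<\<beta>})"
  proof (intro equalityI subsetI)
    fix z assume "z \<in> ?B"
    moreover have "z = (norm z * cos (ang z), norm z * sin (ang z))"
      using polar_fst[of z] polar_snd[of z] by (metis prod.collapse)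
    ultimately show "z \<in> (\<lambda>(r,t). (r * cos t, r * sin t)) ` ({0<..} \<times> {pi - \<gamma><..<\<beta>})"
      using ang_pos_nz[of z] by (intro image_eqI[of _ _ "(norm z, ang z)"]) auto
  next
    fix z assume "z \<in> (\<lambda>(r,t). (r * cos t, r * sin t)) ` ({0<..} \<times> {pi - \<gamma><..<\<beta>})"
    then obtain r t where "r > 0" "pi - \<gamma> < t" "t < \<beta>" "z = (r * cos t, r * sin t)" by auto
    then show "z \<in> ?B" using ang_unique[of r t] bg by auto
  qed
  moreover have "connected ({(0::real)<..} \<times> {pi - \<gamma><..<\<beta>})"
    using convex_connected[OF convex_real_interval(3)] convex_connected[OF convex_real_interval(8)]
    by (intro connected_Times) fastforce+
  ultimately have cB: "connected ?B"
    by (auto intro!: connected_continuous_image continuous_intros simp: case_prod_unfold)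
  \<comment> \<open>The point of the unit circle at an angle slightly below \<pi> lies in both
    pieces, so their union is connected.\<close>
  obtain t where t: "max (pi - \<gamma>) (pi/2) < t" "t < pi" using dense[of "max (pi - \<gamma>) (pi/2)" pi] bg by auto
  have "ang (1 * cos t, 1 * sin t) = t" using t bg by (intro ang_unique) (auto simp: pi_gt_zero)
  then have B: "(cos t, sin t) \<in> ?B" using t bg pi_gt_zero by (auto intro: less_trans[of 0 "pi/2"])
  have "edge_Y \<gamma> (cos t, sin t) > 0"
  proof -
    have "edge_Y \<gamma> (cos t, sin t) = 1 * sin (t - pi + \<gamma>) + sin \<gamma>"
      using edge_Y_polar[of \<gamma> "(cos t, sin t)"] \<open>ang (1 * cos t, 1 * sin t) = t\<close> by (simp add: norm_prod_def)
    moreover have "sin (t - pi + \<gamma>) > 0" using t bg by (intro sin_gt_zero) auto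
    moreover have "sin \<gamma> \<ge> 0" using bg by (intro sin_ge_zero) auto
    ultimately show ?thesis by simp
  qed
  moreover have "sin t > 0" using t by (intro sin_gt_zero) (auto intro: less_trans[of 0 "pi/2"])
  ultimately have "(cos t, sin t) \<in> ?A" by simp
  then have "?A \<inter> ?B \<noteq> {}" using B by blast
  then show ?thesis unfolding E_polar_alt by (intro connected_Un convex_connected cA cB)
qed

lemma E_polar_disjoint: "E_polar \<beta> \<gamma> \<inter> (L3 \<beta> \<union> L2 \<union> L1 \<gamma>) = {}"
proof -
  have "z \<notin> L3 \<beta>" "z \<notin> L2" "z \<notin> L1 \<gamma>" if z: "z \<in> E_polar \<beta> \<gamma>" for z
  proof -
    have l: "0 < ang z" "ang z < \<beta>" using E_polar_sub_Lambda z Lambda_eq bg by auto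
    then show "z \<notin> L3 \<beta>" using ang_L3[OF bg(3,4), of z] by auto
    show "z \<notin> L2" using l ang_pos_iff[of z] L2_iff by auto
    show "z \<notin> L1 \<gamma>"
    proof
      assume "z \<in> L1 \<gamma>"
      then obtain t where t: "t \<ge> 0" "z = (1 - t * cos \<gamma>, t * sin \<gamma>)" and Y: "edge_Y \<gamma> z = 0"
        using L1_iff[of z \<gamma>] unfolding L1_def by blast
      then have "pi \<le> ang z" using z unfolding E_polar_def by auto
      then have "snd z = 0" using ang_ge_pi[of z] t bg sin_ge_zero[of \<gamma>] by (auto simp: mult_le_0_iff antisym)
      then have "t = 0 \<or> \<gamma> = pi" using t bg sin_gt_zero[of \<gamma>] by force
      then have "fst z \<ge> 0" using t by auto
      then show False using \<open>snd z = 0\<close> l ang_pos_iff by auto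
    qed
  qed
  then show ?thesis by auto
qed

text \<open>This makes \<open>E_polar\<close> relatively closed in the complement of the three
  lines. Being also open and connected, it is then one of the components of that complement.\<close>

lemma closed_E_polar_Un: "closed (E_polar \<beta> \<gamma> \<union> (L3 \<beta> \<union> L2 \<union> L1 \<gamma>))"
proof -
  let ?L = "L3 \<beta> \<union> L2 \<union> L1 \<gamma>"
  have cl: "closed ?L"
  proof -
    have "closed (L1 \<gamma>)"
    proof -
      have "L1 \<gamma> = {z. edge_Y \<gamma> z = 0 \<and> edge_p \<gamma> z \<ge> 0}" using L1_iff by auto
      then show ?thesis by (simp add: closed_Collect_conj closed_Collect_eq closed_Collect_le continuous_intros)
    qed
    moreover have "closed (L3 \<beta>)"
    proof -
      have "L3 \<beta> = (\<lambda>t. t *\<^sub>R (cos \<beta>, sin \<beta>)) ` {0..}" unfolding L3_def by auto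
      also have "\<dots> = {z. fst z = (fst z * cos \<beta> + snd z * sin \<beta>) * cos \<beta> \<and> snd z = (fst z * cos \<beta> + snd z * sin \<beta>) * sin \<beta> \<and> fst z * cos \<beta> + snd z * sin \<beta> \<ge> 0}"
        (is "_ = ?R")
      proof (intro equalityI subsetI)
        fix z assume "z \<in> (\<lambda>t. t *\<^sub>R (cos \<beta>, sin \<beta>)) ` {0..}"
        then obtain t where t: "t \<ge> 0" "z = (t * cos \<beta>, t * sin \<beta>)" by auto
        have "t * cos \<beta> * cos \<beta> + t * sin \<beta> * sin \<beta> = t * ((sin \<beta>)\<^sup>2 + (cos \<beta>)\<^sup>2)"
          by (simp only: power2_eq_square algebra_simps)
        then have "t * cos \<beta> * cos \<beta> + t * sin \<beta> * sin \<beta> = t" by simp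
        then show "z \<in> ?R" using t(1) unfolding t(2) mem_Collect_eq fst_conv snd_conv by metis
      next
        fix z assume "z \<in> ?R"
        then show "z \<in> (\<lambda>t. t *\<^sub>R (cos \<beta>, sin \<beta>)) ` {0..}"
          by (cases z) (auto intro!: image_eqI[of _ _ "fst z * cos \<beta> + snd z * sin \<beta>"])
      qed
      finally have "L3 \<beta> = ?R" .
      moreover have "closed ?R" by (intro closed_Collect_conj closed_Collect_eq closed_Collect_le continuous_intros)
      ultimately show ?thesis by simp
    qed
    ultimately show ?thesis unfolding L2_def by (intro closed_Un closed_segment)
  qed
  have nb: "\<exists>N. open N \<and> z \<in> N \<and> N \<inter> E_polar \<beta> \<gamma> = {}" if z: "z \<notin> E_polar \<beta> \<gamma>" "z \<notin> ?L" for z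
  proof -
    consider "snd z > 0" | "snd z < 0" | "snd z = 0" by linarith
    then show ?thesis
    proof cases
      case 1
      have "edge_Y \<gamma> z \<noteq> 0"
      proof
        assume Y: "edge_Y \<gamma> z = 0"
        then have "edge_p \<gamma> z * sin \<gamma> > 0" using edge_coords(2)[of z \<gamma>] 1 by simp
        then have "edge_p \<gamma> z > 0" using sin_ge_zero[of \<gamma>] bg by (auto simp: zero_less_mult_iff)
        then show False using Y z L1_iff by auto
      qed
      then have "edge_Y \<gamma> z < 0" using z 1 unfolding E_polar_def by auto
      moreover have "open {z. 0 < snd z \<and> edge_Y \<gamma> z < 0}"
        by (intro open_Collect_conj open_Collect_less continuous_intros)
      moreover have "{z. 0 < snd z \<and> edge_Y \<gamma> z < 0} \<inter> E_polar \<beta> \<gamma> = {}"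
        using ang_ge_pi unfolding E_polar_def by force
      ultimately show ?thesis using 1 by blast
    next
      case 2
      then have p: "pi \<le> ang z" "0 < ang z"
        using ang_lt_pi[of z] ang_pos_iff[of z] by auto
      then have "\<beta> \<le> ang z" using z(1) unfolding E_polar_def by auto
      moreover have "\<beta> \<noteq> ang z" using z(2) L3_I[of z \<beta>] by blast
      ultimately have "\<beta> < ang z" by simp
      moreover have "{z. 0 < ang z \<and> ang z \<in> {\<beta><..}} \<inter> E_polar \<beta> \<gamma> = {}"
        using E_polar_sub_Lambda Lambda_eq[OF bg(4)] by auto
      ultimately show ?thesis using p open_ang[OF open_greaterThan, of \<beta>] by blast
    next
      case 3
      have x: "fst z > 1"
      proof (rule ccontr)
        assume "\<not> fst z > 1"
        then have "fst z < 0" using 3 z L2_iff by auto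
        then have a: "ang z = pi" using 3 Arg2pi_eq_pi[of "Complex (fst z) (snd z)"]
          by (simp add: ang_def complex_is_Real_iff)
        then have "\<not> pi < \<beta>" using z(1) unfolding E_polar_def by simp
        then have "ang z = \<beta>" using a bg by simp
        then show False using z(2) L3_I[of z \<beta>] by blast
      qed
      have "\<gamma> \<noteq> pi" using z 3 x L1_iff[of z \<gamma>] by (auto simp: edge_Y_def edge_p_def)
      then have sg: "sin \<gamma> > 0" using bg by (intro sin_gt_zero) auto
      have "\<beta> \<noteq> 2 * pi"
      proof
        assume "\<beta> = 2 * pi"
        then have "z = (fst z * cos \<beta>, fst z * sin \<beta>)" using 3 by (simp add: prod_eq_iff)
        moreover have "fst z \<ge> 0" using x by simp
        ultimately show False using z(2) unfolding L3_def by blast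
      qed
      then have b2: "\<beta> < 2 * pi" using bg by auto
      \<comment> \<open>The point lies on the axis to the right of \<open>P\<close>. The first
        condition keeps the neighbourhood off the part of the domain above the axis; the second says
        that the direction is less than 2\<pi> - \<beta> away from the axis and keeps it off the
        part below.\<close>
      let ?N = "{w. edge_Y \<gamma> w < 0 \<and> norm w * cos \<beta> < fst w}"
      have "cos \<beta> < 1"
      proof -
        have "cos \<beta> = cos (2 * pi - \<beta>)" by (simp add: cos_diff)
        also have "\<dots> < cos 0" using bg b2 by (intro cos_monotone_0_pi) auto
        finally show ?thesis by simp
      qed
      then have "fst z * cos \<beta> < fst z" using x by (simp add: mult_less_cancel_left2)
      moreover have "norm z = fst z" using 3 x by (simp add: norm_prod_def)
      ultimately have "z \<in> ?N" using 3 x sg by (simp add: edge_Y_def mult_less_0_iff)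
      moreover have "open ?N" by (intro open_Collect_conj open_Collect_less continuous_intros)
      moreover have "w \<notin> E_polar \<beta> \<gamma>" if w: "w \<in> ?N" for w
      proof
        assume "w \<in> E_polar \<beta> \<gamma>"
        then have a: "pi \<le> ang w" "ang w < \<beta>" using w unfolding E_polar_def by auto
        have "cos (ang w) = cos (2 * pi - ang w)" "cos \<beta> = cos (2 * pi - \<beta>)" by (simp_all add: cos_diff)
        moreover have "cos (2 * pi - ang w) \<le> cos (2 * pi - \<beta>)"
          using a b2 by (intro cos_monotone_0_pi_le) auto
        ultimately have "norm w * cos (ang w) \<le> norm w * cos \<beta>" by (intro mult_left_mono) auto
        then show False using w polar_fst[of w] by auto
      qed
      ultimately show ?thesis by blast
    qed
  qed
  have "\<exists>N. open N \<and> z \<in> N \<and> N \<subseteq> - (E_polar \<beta> \<gamma> \<union> ?L)" if z: "z \<in> - (E_polar \<beta> \<gamma> \<union> ?L)" for z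
  proof -
    obtain N where N: "open N" "z \<in> N" "N \<inter> E_polar \<beta> \<gamma> = {}" using z nb[of z] by auto
    have "open (N - ?L)" using N(1) cl by (rule open_Diff)
    then show ?thesis using N(2,3) z by (intro exI[of _ "N - ?L"]) blast
  qed
  then have "open (- (E_polar \<beta> \<gamma> \<union> ?L))" by (subst open_subopen) blast
  then show ?thesis by (simp only: closed_def)
qed

lemma component_E_polar:
  assumes "x \<in> E_polar \<beta> \<gamma>"
  shows "connected_component_set (- (L3 \<beta> \<union> L2 \<union> L1 \<gamma>)) x = E_polar \<beta> \<gamma>"
proof
  let ?L = "L3 \<beta> \<union> L2 \<union> L1 \<gamma>"
  let ?C = "connected_component_set (- ?L) x"
  show "E_polar \<beta> \<gamma> \<subseteq> ?C"
    using E_polar_disjoint assms connected_E_polar by (intro connected_component_maximal) auto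
  have "x \<in> ?C" using assms E_polar_disjoint by auto
  have sub: "?C \<subseteq> - ?L" by (rule connected_component_subset)
  show "?C \<subseteq> E_polar \<beta> \<gamma>"
  proof (rule ccontr)
    assume "\<not> ?C \<subseteq> E_polar \<beta> \<gamma>"
    then have "- (E_polar \<beta> \<gamma> \<union> ?L) \<inter> ?C \<noteq> {}" using sub by auto
    moreover have "E_polar \<beta> \<gamma> \<inter> ?C \<noteq> {}" using \<open>x \<in> ?C\<close> assms by auto
    moreover have "open (- (E_polar \<beta> \<gamma> \<union> ?L))" using closed_E_polar_Un open_Compl by blast
    moreover have "?C \<subseteq> E_polar \<beta> \<gamma> \<union> - (E_polar \<beta> \<gamma> \<union> ?L)" using sub by auto
    ultimately show False
      using connectedD[OF connected_connected_component open_E_polar, of "- (E_polar \<beta> \<gamma> \<union> ?L)" "- ?L" x] by auto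
  qed
qed

lemma E_eq_E_polar: "E \<beta> \<gamma> = E_polar \<beta> \<gamma>"
proof -
  \<comment> \<open>The points (1/2, t) that select the component lie in \<open>E_polar\<close> once
    \<open>t\<close> is small, so each such component is \<open>E_polar\<close> itself.\<close>
  have ev: "\<forall>\<^sub>F t in at_right 0. (1/2, t) \<in> E_polar \<beta> \<gamma>"
  proof (cases "\<gamma> = pi")
    case True
    then show ?thesis
      by (intro eventually_mono[OF eventually_at_right_less]) (auto simp: E_polar_def edge_Y_def)
  next
    case False
    then have s: "sin \<gamma> > 0" using bg by (intro sin_gt_zero) auto
    have "((\<lambda>t. sin \<gamma> / 2 - t * cos \<gamma>) \<longlongrightarrow> sin \<gamma> / 2 - 0 * cos \<gamma>) (at_right 0)"
      by (intro tendsto_intros)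
    then have "\<forall>\<^sub>F t in at_right 0. 0 < sin \<gamma> / 2 - t * cos \<gamma>"
      by (rule order_tendstoD(1)) (use s in auto)
    then show ?thesis
      using eventually_at_right_less[of "0::real"] by eventually_elim (auto simp: E_polar_def edge_Y_def)
  qed
  have "z \<in> E \<beta> \<gamma> \<longleftrightarrow> (\<forall>\<^sub>F t in at_right (0::real). z \<in> E_polar \<beta> \<gamma>)" for z
    unfolding E_def mem_Collect_eq
    by (rule eventually_subst, rule eventually_mono[OF ev]) (blast dest: component_E_polar)
  then show ?thesis by auto
qed

lemma frontier_E_polar: "frontier (E_polar \<beta> \<gamma>) \<subseteq> L3 \<beta> \<union> L2 \<union> L1 \<gamma>"
proof -
  have "closure (E_polar \<beta> \<gamma>) \<subseteq> E_polar \<beta> \<gamma> \<union> (L3 \<beta> \<union> L2 \<union> L1 \<gamma>)"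
    by (rule closure_minimal[OF _ closed_E_polar_Un]) auto
  then show ?thesis using open_E_polar by (auto simp: frontier_def interior_open)
qed

lemma open_Lambda: "open (Lambda \<beta>)"
proof -
  have "Lambda \<beta> = {z. 0 < ang z \<and> ang z \<in> {..<\<beta>}}" using Lambda_eq bg by auto
  then show ?thesis using open_ang[OF open_lessThan] by metis
qed

end

lemma E_polar_pi:
  assumes "pi \<le> \<beta>" "\<beta> \<le> 2 * pi"
  shows "E_polar \<beta> pi = Lambda \<beta>"
proof -
  have "0 < snd z \<or> pi \<le> ang z \<and> ang z < \<beta> \<longleftrightarrow> 0 < ang z \<and> ang z < \<beta>" for z
  proof (cases "0 < snd z")
    case True
    then show ?thesis using ang_lt_pi[of z] assms by auto
  next
    case False
    then have "\<not> (0 < ang z \<and> ang z < pi)" using ang_lt_pi[of z] by simp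
    then show ?thesis using assms pi_gt_zero False by auto
  qed
  then show ?thesis unfolding E_polar_def edge_Y_def Lambda_eq[OF assms(2)] by auto
qed

section \<open>Distance to the boundary\<close>

text \<open>A segment from inside to outside meets the frontier. Upper bounds for
  \<open>bdist\<close> therefore only require a point of the complement, and frontiers need not be
  computed.\<close>

lemma bdist_le_dist:
  assumes "x \<in> S" "z \<notin> S"
  shows "bdist S x \<le> dist x z"
proof -
  have "closed_segment x z \<inter> frontier S \<noteq> {}"
    by (rule connected_Int_frontier[OF connected_segment(1)]) (use assms in \<open>auto intro: ends_in_segment\<close>)
  then obtain w where w: "w \<in> closed_segment x z" "w \<in> frontier S" by auto
  have "bdist S x \<le> dist x w" unfolding bdist_def by (rule infdist_le[OF w(2)])
  also have "\<dots> \<le> dist x z" using dist_in_closed_segment[OF w(1)] by (simp add: dist_commute)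
  finally show ?thesis .
qed

lemma bdist_ge:
  assumes "x \<in> S" "S \<noteq> UNIV" "\<And>z. z \<in> frontier S \<Longrightarrow> m \<le> dist x z"
  shows "m \<le> bdist S x"
proof -
  have "frontier S \<noteq> {}" using assms(1,2) by (auto simp: frontier_eq_empty)
  then show ?thesis unfolding bdist_def infdist_notempty[OF \<open>frontier S \<noteq> {}\<close>]
    by (intro cINF_greatest assms(3)) auto
qed

lemma bdist_pos: "open S \<Longrightarrow> x \<in> S \<Longrightarrow> S \<noteq> UNIV \<Longrightarrow> 0 < bdist S x"
proof -
  assume S: "open S" "x \<in> S" "S \<noteq> UNIV"
  then obtain e where e: "e > 0" "ball x e \<subseteq> S" by (meson open_contains_ball)
  have "e \<le> bdist S x"
  proof (rule bdist_ge[OF S(2,3)])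
    fix z assume "z \<in> frontier S"
    then have "z \<notin> S" using S(1) by (simp add: frontier_def interior_open)
    then show "e \<le> dist x z" using e(2) by (meson in_mono linorder_not_less mem_ball)
  qed
  then show ?thesis using e by simp
qed

lemma continuous_on_bdist: "continuous_on S (bdist \<Omega>)"
  unfolding bdist_def[abs_def] by (intro continuous_intros)

lemma continuous_If_le:
  fixes f g :: "real \<Rightarrow> real"
  assumes "continuous_on UNIV f" "continuous_on UNIV g" "f c = g c"
  shows "continuous_on UNIV (\<lambda>t. if t \<le> c then f t else g t)"
  using assms by (intro continuous_on_cases_1) (auto intro: continuous_on_subset)

lemma DERIV_If_le:
  fixes f g :: "real \<Rightarrow> real"
  assumes f: "\<And>x. x \<le> c \<Longrightarrow> (f has_real_derivative f' x) (at x)"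
    and g: "\<And>x. c \<le> x \<Longrightarrow> (g has_real_derivative g' x) (at x)" and e: "f c = g c" "f' c = g' c"
  shows "((\<lambda>t. if t \<le> c then f t else g t) has_real_derivative (if x \<le> c then f' x else g' x)) (at x)"
proof -
  consider "x < c" | "x > c" | "x = c" by linarith
  then show ?thesis
  proof cases
    case 1
    have "((\<lambda>t. if t \<le> c then f t else g t) has_real_derivative f' x) (at x)"
      by (rule has_field_derivative_transform_within_open[of f _ _ "{..<c}"]) (use 1 f in auto)
    then show ?thesis using 1 by simp
  next
    case 2
    have "((\<lambda>t. if t \<le> c then f t else g t) has_real_derivative g' x) (at x)"
      by (rule has_field_derivative_transform_within_open[of g _ _ "{c<..}"]) (use 2 g in auto)
    then show ?thesis using 2 by simp
  next
    case 3
    have "((\<lambda>t. if t \<in> {..c} then f t else g t) has_derivative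
        (if x \<in> {..c} then (*) (f' x) else (*) (g' x))) (at x within {..c} \<union> {c..})"
      by (rule has_derivative_If_within_closures)
        (use f[of x] g[of x] e 3 in \<open>auto simp: has_field_derivative_def intro: has_derivative_at_withinI\<close>)
    moreover have "{..c} \<union> {c..} = UNIV" by auto
    ultimately show ?thesis using 3 by (simp add: has_field_derivative_def)
  qed
qed

text \<open>The distance from \<open>(r cos \<theta>, r sin \<theta>)\<close> to the boundary of the sector is \<open>r * wD \<beta> \<theta>\<close>.\<close>

definition wD :: "real \<Rightarrow> real \<Rightarrow> real" where
  "wD \<beta> t = (if t \<le> pi/2 then sin t else if t \<le> \<beta> - pi/2 then 1 else sin (\<beta> - t))"

definition wD' :: "real \<Rightarrow> real \<Rightarrow> real" where
  "wD' \<beta> t = (if t \<le> pi/2 then cos t else if t \<le> \<beta> - pi/2 then 0 else - cos (\<beta> - t))"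

context
  fixes \<beta> :: real
  assumes b: "pi \<le> \<beta>" "\<beta> \<le> 2 * pi"
begin

lemma wD_reflect: "wD \<beta> (\<beta> - t) = wD \<beta> t"
proof -
  consider "t \<le> pi/2" "\<beta> - t \<le> pi/2" | "t > pi/2 \<or> \<beta> - t > pi/2" by linarith
  then show ?thesis
  proof cases
    case 1
    then have "t = pi/2" "\<beta> = pi" using b by auto
    then show ?thesis by (simp add: wD_def)
  next
    case 2
    have e: "sin (\<beta> - t) = 1" if "\<beta> - t = pi/2" by (simp only: that sin_pi_half)
    have e': "sin t = 1" if "t = pi/2" by (simp only: that sin_pi_half)
    consider "t < pi/2" | "t = pi/2" | "t > pi/2" "\<beta> - t > pi/2" | "\<beta> - t = pi/2" "t > pi/2" | "\<beta> - t < pi/2" by linarith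
    then show ?thesis
      by cases (use 2 b e e' in \<open>auto simp: wD_def\<close>)
  qed
qed

lemma continuous_wD': "continuous_on UNIV (wD' \<beta>)"
  unfolding wD'_def[abs_def]
  by (intro continuous_If_le continuous_intros) (use b in auto)

lemma wD_deriv: "(wD \<beta> has_real_derivative wD' \<beta> t) (at t)"
proof -
  have g: "((\<lambda>t. if t \<le> \<beta> - pi/2 then 1 else sin (\<beta> - t)) has_real_derivative
      (if t \<le> \<beta> - pi/2 then 0 else - cos (\<beta> - t))) (at t)" for t
    by (rule DERIV_If_le) (auto intro!: derivative_eq_intros)
  show ?thesis
    unfolding wD_def[abs_def] wD'_def
    by (rule DERIV_If_le) (use g b in \<open>auto intro!: derivative_eq_intros\<close>)
qed

lemma continuous_wD: "continuous_on UNIV (wD \<beta>)"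
  by (rule DERIV_imp_continuous_on[OF wD_deriv])

lemma wD_pos: "0 < t \<Longrightarrow> t < \<beta> \<Longrightarrow> 0 < wD \<beta> t"
  unfolding wD_def using b by (auto intro!: sin_gt_zero)

lemma wD_le_1: "wD \<beta> t \<le> 1"
  unfolding wD_def by auto

text \<open>By the law of cosines, a point at angular distance \<delta> from \<open>z\<close> is at
  least \<open>norm z * sin \<delta>\<close> away, and at least \<open>norm z\<close> away if cos
  \<delta> \<le> 0. What remains is to bound cos \<delta> over the angles of the complement.\<close>

lemma norm_mult_wD_le_dist:
  assumes z: "z \<in> Lambda \<beta>" and w: "w \<notin> Lambda \<beta>"
  shows "norm z * wD \<beta> (ang z) \<le> dist z w"
proof -
  define t where "t = ang z"
  have t: "0 < t" "t < \<beta>" using z Lambda_eq[OF b(2)] by (auto simp: t_def)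
  \<comment> \<open>Points of the nonnegative axis are given the angle 2\<pi> instead of 0, so that
    the angles of the complement fill the single interval from \<beta> to 2\<pi>.\<close>
  obtain p where p: "w = (norm w * cos p, norm w * sin p)" "\<beta> \<le> p" "p \<le> 2 * pi"
  proof (cases "ang w = 0")
    case True
    then show ?thesis using polar_fst[of w] polar_snd[of w] b
      by (intro that[of "2 * pi"]) (auto simp: prod_eq_iff)
  next
    case False
    then show ?thesis using polar_fst[of w] polar_snd[of w] b ang_bounds[of w] w Lambda_eq[OF b(2)]
      by (intro that[of "ang w"]) (auto simp: prod_eq_iff)
  qed
  let ?r = "norm z" and ?s = "norm w"
  have d: "(dist z w)\<^sup>2 = ?r\<^sup>2 + ?s\<^sup>2 - 2 * ?r * ?s * cos (p - t)"
  proof -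
    have "(dist z w)\<^sup>2 = (fst z - fst w)\<^sup>2 + (snd z - snd w)\<^sup>2"
      by (simp add: dist_prod_def dist_real_def)
    also have "\<dots> = (?r * cos t - ?s * cos p)\<^sup>2 + (?r * sin t - ?s * sin p)\<^sup>2"
      using p(1) polar_fst[of z] polar_snd[of z] unfolding t_def by (metis fst_conv snd_conv)
    also have "\<dots> = ?r\<^sup>2 * ((sin t)\<^sup>2 + (cos t)\<^sup>2) + ?s\<^sup>2 * ((sin p)\<^sup>2 + (cos p)\<^sup>2) - 2 * ?r * ?s * cos (p - t)"
      by (simp only: cos_diff power2_eq_square algebra_simps)
    finally show ?thesis by simp
  qed
  \<comment> \<open>Completing the square in \<open>?s\<close>: the least value is attained at
    \<open>?s = ?r * a\<close>.\<close>
  have key: "(?r * sqrt (1 - a\<^sup>2))\<^sup>2 \<le> (dist z w)\<^sup>2" if "cos (p - t) \<le> a" "0 \<le> a" "a \<le> 1" for a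
  proof -
    have "?r * ?s * cos (p - t) \<le> ?r * ?s * a" using that by (intro mult_left_mono) auto
    then have "(dist z w)\<^sup>2 \<ge> ?r\<^sup>2 + ?s\<^sup>2 - 2 * ?r * ?s * a" unfolding d by simp
    also have "?r\<^sup>2 + ?s\<^sup>2 - 2 * ?r * ?s * a = ?r\<^sup>2 * (1 - a\<^sup>2) + (?s - ?r * a)\<^sup>2"
      by (simp add: power2_eq_square algebra_simps)
    finally have "?r\<^sup>2 * (1 - a\<^sup>2) + (?s - ?r * a)\<^sup>2 \<le> (dist z w)\<^sup>2" .
    then have "?r\<^sup>2 * (1 - a\<^sup>2) \<le> (dist z w)\<^sup>2" using zero_le_power2[of "?s - ?r * a"] by linarith
    then show ?thesis using that by (simp add: power_mult_distrib power_le_one)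
  qed
  have cosle: "cos x \<le> 0" if "pi/2 \<le> x" "x \<le> 3 * pi / 2" for x
    using cos_ge_zero[of "x - pi"] cos_minus_pi[of x] that by auto
  have cosinc: "cos x \<le> cos y" if "pi \<le> x" "x \<le> y" "y \<le> 2 * pi" for x y
    using cos_monotone_0_pi_le[of "2 * pi - y" "2 * pi - x"] that by (simp add: cos_diff)
  have sq: "sqrt (1 - (cos x)\<^sup>2) = sin x" if "0 \<le> x" "x \<le> pi" for x :: real
    using that sin_ge_zero[of x] by (simp add: sin_squared_eq[symmetric])
  consider "t \<le> pi/2" | "t > pi/2" "t \<le> \<beta> - pi/2" | "t > pi/2" "t > \<beta> - pi/2" by linarith
  then have "(?r * wD \<beta> t)\<^sup>2 \<le> (dist z w)\<^sup>2"
  proof cases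
    case 1
    have c: "cos (p - t) \<le> cos t"
    proof (cases "p - t \<le> 3 * pi / 2")
      case True
      then have "cos (p - t) \<le> 0" using p 1 b by (intro cosle) auto
      also have "0 \<le> cos t" using 1 t by (intro cos_ge_zero) auto
      finally show ?thesis .
    next
      case False
      then have "cos (p - t) \<le> cos (2 * pi - t)" using p 1 t by (intro cosinc) auto
      then show ?thesis by (simp add: cos_diff)
    qed
    have "0 \<le> cos t" using 1 t by (intro cos_ge_zero) auto
    from key[OF c this] sq[of t] show ?thesis using 1 t by (simp add: wD_def)
  next
    case 2
    then have "cos (p - t) \<le> 0" using p t by (intro cosle) auto
    from key[OF this] show ?thesis using 2 by (simp add: wD_def)
  next
    case 3
    have c: "cos (p - t) \<le> cos (\<beta> - t)"
    proof (cases "p - t \<le> pi")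
      case True
      then show ?thesis using p t 3 by (intro cos_monotone_0_pi_le) auto
    next
      case False
      then have "cos (p - t) \<le> 0" using p 3 b by (intro cosle) auto
      also have "0 \<le> cos (\<beta> - t)" using 3 t by (intro cos_ge_zero) auto
      finally show ?thesis .
    qed
    have "0 \<le> cos (\<beta> - t)" using 3 t by (intro cos_ge_zero) auto
    from key[OF c this] sq[of "\<beta> - t"] show ?thesis using 3 t by (simp add: wD_def)
  qed
  then show ?thesis unfolding t_def by (rule power2_le_imp_le) simp
qed

text \<open>The competitor in the complement is the foot of the perpendicular on the nearer side, or
  the vertex for the angles in the middle.\<close>

lemma bdist_Lambda_le:
  assumes z: "z \<in> Lambda \<beta>"
  shows "bdist (Lambda \<beta>) z \<le> norm z * wD \<beta> (ang z)"
proof -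
  define t where "t = ang z"
  have t: "0 < t" "t < \<beta>" using z Lambda_eq[OF b(2)] by (auto simp: t_def)
  let ?r = "norm z"
  have pos: "?r > 0" using t ang_pos_nz t_def by auto
  have nL: "w \<notin> Lambda \<beta>" if "ang w = 0 \<or> ang w = \<beta>" for w
    using that Lambda_eq[OF b(2)] by auto
  have zz: "fst z = ?r * cos t" "snd z = ?r * sin t" unfolding t_def by (rule polar_fst polar_snd)+
  consider "t \<le> pi/2" | "t > pi/2" "t \<le> \<beta> - pi/2" | "t > pi/2" "t > \<beta> - pi/2" by linarith
  then show ?thesis
  proof cases
    case 1
    then have s: "sin t \<ge> 0" "cos t \<ge> 0" using t b by (auto intro!: sin_ge_zero cos_ge_zero)
    have "ang (fst z, 0) = 0" using s zz pos by (intro snd_zero_not_Lambda) auto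
    from bdist_le_dist[OF z nL] this have "bdist (Lambda \<beta>) z \<le> dist z (fst z, 0)" by auto
    also have "\<dots> = \<bar>snd z\<bar>" by (simp add: dist_prod_def dist_real_def)
    finally show ?thesis using 1 s zz pos unfolding t_def[symmetric] by (simp add: wD_def)
  next
    case 2
    have "ang 0 = 0" by (intro snd_zero_not_Lambda) auto
    then have "bdist (Lambda \<beta>) z \<le> dist z 0" by (intro bdist_le_dist[OF z nL]) simp
    then show ?thesis using 2 unfolding t_def[symmetric] by (simp add: wD_def)
  next
    case 3
    define w where "w = (?r * cos (\<beta> - t) * cos \<beta>, ?r * cos (\<beta> - t) * sin \<beta>)"
    have c: "cos (\<beta> - t) \<ge> 0" "sin (\<beta> - t) \<ge> 0" using 3 t by (auto intro!: cos_ge_zero sin_ge_zero)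
    then have "w \<in> L3 \<beta>" unfolding w_def L3_def using pos by auto
    then have "w \<notin> Lambda \<beta>" using ang_L3[OF b] nL by blast
    from bdist_le_dist[OF z this] have le: "bdist (Lambda \<beta>) z \<le> dist z w" .
    have "(dist z w)\<^sup>2 = (fst z - fst w)\<^sup>2 + (snd z - snd w)\<^sup>2"
      by (simp add: dist_prod_def dist_real_def)
    also have "\<dots> = ?r\<^sup>2 * ((cos t - cos (\<beta> - t) * cos \<beta>)\<^sup>2 + (sin t - cos (\<beta> - t) * sin \<beta>)\<^sup>2)"
      unfolding w_def zz by (simp add: power2_eq_square algebra_simps)
    also have "(cos t - cos (\<beta> - t) * cos \<beta>)\<^sup>2 + (sin t - cos (\<beta> - t) * sin \<beta>)\<^sup>2 =
      ((sin t)\<^sup>2 + (cos t)\<^sup>2) + (cos (\<beta> - t))\<^sup>2 * ((sin \<beta>)\<^sup>2 + (cos \<beta>)\<^sup>2) - 2 * cos (\<beta> - t) * cos (\<beta> - t)"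
      by (simp only: cos_diff power2_eq_square algebra_simps)
    also have "\<dots> = (sin (\<beta> - t))\<^sup>2"
      unfolding sin_cos_squared_add sin_squared_eq[of "\<beta> - t"] by (simp add: power2_eq_square)
    finally have "(dist z w)\<^sup>2 = (?r * sin (\<beta> - t))\<^sup>2" by (simp add: power_mult_distrib)
    then have "dist z w = ?r * sin (\<beta> - t)" by (rule power2_eq_imp_eq) (use c in simp_all)
    then show ?thesis using le 3 unfolding t_def[symmetric] by (simp add: wD_def)
  qed
qed

end

section \<open>Distance to the boundary of the full domain\<close>

context
  fixes \<beta> \<gamma> :: real
  assumes bg: "0 < \<gamma>" "\<gamma> < pi" "pi \<le> \<beta>" "\<beta> \<le> 2 * pi"
begin

lemma sin_gamma_pos: "0 < sin \<gamma>" using bg by (intro sin_gt_zero) auto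

lemma not_Lambda_P: "(1, 0) \<notin> Lambda \<beta>"
  using snd_zero_not_Lambda[of "(1,0)"] Lambda_eq[OF bg(4)] by auto

text \<open>\<open>L1\<close> matters only for points that project onto it from the inner side. For
  the others either \<open>P\<close> is the nearest point of \<open>L1\<close>, or the point is not
  above the axis and every segment to \<open>L1\<close> crosses the axis at or beyond
  \<open>P\<close>; in both cases a point outside the sector is at least as close.\<close>

lemma norm_mult_wD_le_bdist_E:
  assumes x: "x \<in> E_polar \<beta> \<gamma>"
  shows "edge_p \<gamma> x > 0 \<and> edge_Y \<gamma> x > 0 \<Longrightarrow> min (edge_Y \<gamma> x) (norm x * wD \<beta> (ang x)) \<le> bdist (E_polar \<beta> \<gamma>) x" (is "?U \<Longrightarrow> _")
    and "\<not> (edge_p \<gamma> x > 0 \<and> edge_Y \<gamma> x > 0) \<Longrightarrow> norm x * wD \<beta> (ang x) \<le> bdist (E_polar \<beta> \<gamma>) x"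
proof -
  let ?d = "norm x * wD \<beta> (ang x)"
  have le: "\<gamma> \<le> pi" using bg by simp
  note bg' = bg(1) le bg(3,4)
  have xL: "x \<in> Lambda \<beta>" using E_polar_sub_Lambda[OF bg'] x by auto
  have nU: "E_polar \<beta> \<gamma> \<noteq> UNIV" using E_polar_sub_Lambda[OF bg'] not_Lambda_P by auto
  have L: "?d \<le> dist x z" if "z \<notin> Lambda \<beta>" for z
    using norm_mult_wD_le_dist[OF bg(3,4) xL that] .
  have L23: "z \<notin> Lambda \<beta>" if "z \<in> L3 \<beta> \<union> L2" for z
  proof -
    have "ang z = 0 \<or> ang z = \<beta>"
      using that ang_L3[OF bg(3,4), of z] L2_iff[of z] snd_zero_not_Lambda[of z] by auto
    then show ?thesis using Lambda_eq[OF bg(4)] by auto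
  qed
  {
    assume U: ?U
    show "min (edge_Y \<gamma> x) ?d \<le> bdist (E_polar \<beta> \<gamma>) x"
    proof (rule bdist_ge[OF x nU])
      fix z assume z: "z \<in> frontier (E_polar \<beta> \<gamma>)"
      show "min (edge_Y \<gamma> x) ?d \<le> dist x z"
      proof (cases "z \<in> L1 \<gamma>")
        case True
        then have "edge_Y \<gamma> z = 0" using L1_iff by auto
        then have "(edge_Y \<gamma> x)\<^sup>2 \<le> (dist x z)\<^sup>2" unfolding edge_dist[of x z \<gamma>] by simp
        then have "edge_Y \<gamma> x \<le> dist x z" by (rule power2_le_imp_le) simp
        then show ?thesis by simp
      next
        case False
        then have "z \<notin> Lambda \<beta>" using frontier_E_polar[OF bg'] z L23[of z] by blast
        then show ?thesis using L by (simp add: min.coboundedI2)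
      qed
    qed
  }
  {
    assume U: "\<not> ?U"
    show "?d \<le> bdist (E_polar \<beta> \<gamma>) x"
    proof (rule bdist_ge[OF x nU])
      fix z assume z: "z \<in> frontier (E_polar \<beta> \<gamma>)"
      show "?d \<le> dist x z"
      proof (cases "z \<in> L1 \<gamma>")
        case True
        then have zY: "edge_Y \<gamma> z = 0" "edge_p \<gamma> z \<ge> 0" using L1_iff by auto
        show ?thesis
        proof (cases "edge_p \<gamma> x \<le> 0")
          case True
          have "edge_Y \<gamma> (1,0) = 0" "edge_p \<gamma> (1,0) = 0" by (auto simp: edge_Y_def edge_p_def)
          then have "(dist x (1,0))\<^sup>2 \<le> (dist x z)\<^sup>2"
            unfolding edge_dist[of _ _ \<gamma>] using zY True abs_le_square_iff[of "edge_p \<gamma> x" "edge_p \<gamma> x - edge_p \<gamma> z"] by simp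
          then have "dist x (1,0) \<le> dist x z" by (rule power2_le_imp_le) simp
          then show ?thesis using L[OF not_Lambda_P] by simp
        next
          case False
          then have p: "edge_p \<gamma> x > 0" "edge_Y \<gamma> x \<le> 0" using U by auto
          then have sx: "snd x \<le> 0" using x ang_ge_pi[of x] unfolding E_polar_def by auto
          have "0 < edge_p \<gamma> x * sin \<gamma>" using p sin_gamma_pos by simp
          then have "edge_Y \<gamma> x * cos \<gamma> > 0" using edge_coords(2)[of x \<gamma>] sx by linarith
          then have c: "cos \<gamma> < 0" "edge_Y \<gamma> x < 0" using p by (auto simp: zero_less_mult_iff)
          have "edge_p \<gamma> x * cos \<gamma> < 0" "edge_Y \<gamma> x * sin \<gamma> < 0"
            using p c sin_gamma_pos by (auto simp: mult_less_0_iff)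
          then have fx: "fst x \<ge> 1" using edge_coords(1)[of x \<gamma>] by linarith
          have "edge_p \<gamma> z * cos \<gamma> \<le> 0" using zY c by (simp add: mult_nonneg_nonpos)
          then have fz: "fst z \<ge> 1" using edge_coords(1)[of z \<gamma>] zY by simp
          have sz: "snd z \<ge> 0" using edge_coords(2)[of z \<gamma>] zY sin_gamma_pos by simp
          \<comment> \<open>The parameter at which the segment from \<open>x\<close> to
            \<open>z\<close> crosses the axis. If the two heights agree, both are 0 and
            \<open>s = 0\<close> serves.\<close>
          define s where "s = (if snd z = snd x then 0 else - snd x / (snd z - snd x))"
          have s: "0 \<le> s" "s \<le> 1" "snd x + s * (snd z - snd x) = 0"
            using sx sz by (auto simp: s_def divide_simps)
          define w where "w = (1 - s) *\<^sub>R x + s *\<^sub>R z"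
          have w: "w \<in> closed_segment x z" unfolding w_def closed_segment_def using s by auto
          have "snd w = 0" using s(3) by (simp add: w_def algebra_simps)
          moreover have "fst w \<ge> (1 - s) * 1 + s * 1"
            unfolding w_def using s fx fz by (simp only: fst_add fst_scaleR real_scaleR_def) (intro add_mono mult_left_mono, auto)
          ultimately have "ang w = 0" by (intro snd_zero_not_Lambda) auto
          then have "?d \<le> dist x w" using L[of w] Lambda_eq[OF bg(4)] by auto
          also have "\<dots> \<le> dist x z" using dist_in_closed_segment[OF w] by (simp add: dist_commute)
          finally show ?thesis .
        qed
      next
        case False
        then have "z \<notin> Lambda \<beta>" using frontier_E_polar[OF bg'] z L23[of z] by blast
        then show ?thesis using L by simp
      qed
    qed
  }
qed

text \<open>On the border \<open>edge_p = 0\<close> the foot on \<open>L1\<close> is the corner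
  \<open>P\<close>, and the boundary of the sector is strictly closer. Strictness matters: each
  alternative persists in a neighbourhood, on which the interpolated field is just
  \<open>F\<^sub>B\<close>.\<close>

lemma edge_gap:
  assumes x: "x \<in> E_polar \<beta> \<gamma>" and n: "\<not> (edge_p \<gamma> x > 0 \<and> edge_Y \<gamma> x > 0)"
  shows "edge_p \<gamma> x < 0 \<or> edge_Y \<gamma> x < 0 \<or> norm x * wD \<beta> (ang x) < edge_Y \<gamma> x"
proof (rule ccontr)
  assume "\<not> ?thesis"
  then have a: "edge_p \<gamma> x \<ge> 0" "edge_Y \<gamma> x \<ge> 0" "norm x * wD \<beta> (ang x) \<ge> edge_Y \<gamma> x" by auto
  have le: "\<gamma> \<le> pi" using bg by simp
  note bg' = bg(1) le bg(3,4)
  have xL: "x \<in> Lambda \<beta>" using E_polar_sub_Lambda[OF bg'] x by auto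
  have "x \<notin> L1 \<gamma>" using E_polar_disjoint[OF bg'] x by auto
  then have Y: "edge_Y \<gamma> x > 0" using a L1_iff[of x \<gamma>] by auto
  then have p: "edge_p \<gamma> x = 0" using a n by auto
  have f: "1 - fst x = edge_Y \<gamma> x * sin \<gamma>" "snd x = - edge_Y \<gamma> x * cos \<gamma>"
    using edge_coords[of x \<gamma>] p by simp_all
  have c: "\<bar>cos \<gamma>\<bar> < 1"
  proof -
    have "(sin \<gamma>)\<^sup>2 > 0" using sin_gamma_pos by simp
    then have "(cos \<gamma>)\<^sup>2 < 1" using sin_cos_squared_add[of \<gamma>] by linarith
    then show ?thesis by (simp add: abs_square_less_1)
  qed
  show False
  proof (cases "fst x > 0")
    case True
    then have "ang (fst x, 0) = 0" by (intro snd_zero_not_Lambda) auto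
    then have "norm x * wD \<beta> (ang x) \<le> dist x (fst x, 0)"
      using norm_mult_wD_le_dist[OF bg(3,4) xL] Lambda_eq[OF bg(4)] by auto
    also have "\<dots> = \<bar>snd x\<bar>" by (simp add: dist_prod_def dist_real_def)
    also have "\<dots> = edge_Y \<gamma> x * \<bar>cos \<gamma>\<bar>" using f Y by (simp add: abs_mult)
    also have "\<dots> < edge_Y \<gamma> x" using c Y by simp
    finally show False using a by simp
  next
    case False
    have "ang 0 = 0" by (intro snd_zero_not_Lambda) auto
    then have "norm x * wD \<beta> (ang x) \<le> dist x 0"
      using norm_mult_wD_le_dist[OF bg(3,4) xL, of 0] Lambda_eq[OF bg(4)] by auto
    moreover have "edge_Y \<gamma> x = dist x (1,0)"
    proof -
      have "(edge_Y \<gamma> x)\<^sup>2 = (dist x (1,0))\<^sup>2"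
        unfolding edge_dist[of _ _ \<gamma>] using p by (simp add: edge_p_def edge_Y_def)
      then show ?thesis by (rule power2_eq_imp_eq) (use Y in simp_all)
    qed
    moreover have "(dist x (1,0))\<^sup>2 = (norm x)\<^sup>2 + 1 - 2 * fst x"
    proof -
      have "(dist x (1,0))\<^sup>2 = (fst x - 1)\<^sup>2 + (snd x)\<^sup>2" by (simp add: dist_prod_def dist_real_def)
      then show ?thesis unfolding norm_sq by (simp add: power2_eq_square algebra_simps)
    qed
    then have "(norm x)\<^sup>2 < (dist x (1,0))\<^sup>2" using False by simp
    then have "norm x < dist x (1,0)" by (rule power2_less_imp_less) simp
    ultimately show False using a by simp
  qed
qed

end

section \<open>Test functions and integrals\<close>

definition hardy_ineq :: "(real \<times> real) set \<Rightarrow> real \<Rightarrow> bool" where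
  "hardy_ineq \<Omega> c \<longleftrightarrow> (\<forall>u. test_fun \<Omega> u \<longrightarrow>
      integral \<Omega> (grad_sq u) \<ge> c * integral \<Omega> (\<lambda>x. (u x)\<^sup>2 / (bdist \<Omega> x)\<^sup>2))"

lemma hardy_constant_eq: "hardy_constant \<Omega> = Sup {c. c \<ge> 0 \<and> hardy_ineq \<Omega> c}"
  unfolding hardy_constant_def hardy_ineq_def ..

lemma smooth_coinduct_pred:
  assumes "P f" and "\<And>f. P f \<Longrightarrow> f differentiable_on UNIV \<and> (\<forall>i\<in>Basis. P (\<lambda>x. frechet_derivative f (at x) i))"
  shows "smooth f"
proof (rule smooth.coinduct[of P, OF assms(1)])
  fix f assume "P f"
  then have "f differentiable_on UNIV" "\<forall>i\<in>Basis. P (\<lambda>x. frechet_derivative f (at x) i)"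
    using assms(2) by simp_all
  then show "\<exists>fa. f = fa \<and> fa differentiable_on UNIV \<and>
      (\<forall>i\<in>Basis. P (\<lambda>x. frechet_derivative fa (at x) i) \<or> smooth (\<lambda>x. frechet_derivative fa (at x) i))"
    by (intro exI[of _ f]) simp
qed

lemma Basis_real_prod: "(Basis :: (real \<times> real) set) = {(1,0), (0,1)}"
  by (auto simp: Basis_prod_def)

lemma grad_sq_eq: "grad_sq u z = (frechet_derivative u (at z) (1,0))\<^sup>2 + (frechet_derivative u (at z) (0,1))\<^sup>2"
  unfolding grad_sq_def Basis_real_prod by simp

lemma grad_sq_C1: "C1_on N u ux uy \<Longrightarrow> z \<in> N \<Longrightarrow> grad_sq u z = (ux z)\<^sup>2 + (uy z)\<^sup>2"
  using C1_on_frechet[of N u ux uy z] by (simp add: grad_sq_eq)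

lemma smooth_imp_continuous: "smooth f \<Longrightarrow> continuous_on S f"
  by (erule smooth.cases) (meson continuous_on_subset differentiable_imp_continuous_on subset_UNIV)

lemma smooth_imp_C1_on:
  fixes u :: "real \<times> real \<Rightarrow> real"
  assumes "smooth u"
  shows "C1_on N u (\<lambda>z. frechet_derivative u (at z) (1,0)) (\<lambda>z. frechet_derivative u (at z) (0,1))"
proof -
  have d: "u differentiable_on UNIV" and
    p: "\<And>i. i \<in> Basis \<Longrightarrow> smooth (\<lambda>x. frechet_derivative u (at x) i)"
    using assms by (auto elim: smooth.cases)
  have "(u has_derivative (\<lambda>h. fst h * frechet_derivative u (at z) (1,0) + snd h * frechet_derivative u (at z) (0,1))) (at z)" for z
  proof -
    have "u differentiable (at z)" using d unfolding differentiable_on_def by blast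
    then have D: "(u has_derivative frechet_derivative u (at z)) (at z)" by (simp add: frechet_derivative_works)
    then interpret bounded_linear "frechet_derivative u (at z)" by (rule has_derivative_bounded_linear)
    have "frechet_derivative u (at z) h = fst h * frechet_derivative u (at z) (1,0) + snd h * frechet_derivative u (at z) (0,1)" for h
    proof -
      have "h = fst h *\<^sub>R (1,0) + snd h *\<^sub>R (0,1)" by (simp add: prod_eq_iff)
      then have "frechet_derivative u (at z) h = frechet_derivative u (at z) (fst h *\<^sub>R (1,0) + snd h *\<^sub>R (0,1))" by simp
      then show ?thesis by (simp only: add scaleR real_scaleR_def)
    qed
    then show ?thesis using D by (metis (no_types, lifting) ext)
  qed
  then show ?thesis unfolding C1_on_def
    using smooth_imp_continuous[OF p[of "(1,0)"]] smooth_imp_continuous[OF p[of "(0,1)"]]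
    by (auto simp: Basis_real_prod)
qed

text \<open>The weights are continuous only inside the domain. The support condition extends the
  integrand continuously by 0, so that all integrals can be taken over the plane.\<close>

lemma integrable_compact_support:
  fixes f :: "real \<times> real \<Rightarrow> real"
  assumes "open \<Omega>" "compact K" "K \<subseteq> \<Omega>" "continuous_on \<Omega> f" "\<And>z. z \<notin> K \<Longrightarrow> f z = 0"
  shows "f integrable_on UNIV" "integral \<Omega> f = integral UNIV f"
    and "\<exists>R>0. (\<forall>z. z \<notin> cbox (-R,-R) (R,R) \<longrightarrow> z \<notin> K)" "continuous_on UNIV f"
proof -
  have "continuous_on (-K) f"
    by (rule continuous_on_eq[of _ "\<lambda>_. 0"]) (use assms(5) in auto)
  then have "continuous_on (\<Omega> \<union> -K) f"
    using assms by (intro continuous_on_open_Un) (auto simp: open_Compl compact_imp_closed)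
  moreover have "\<Omega> \<union> -K = UNIV" using assms by auto
  ultimately show c: "continuous_on UNIV f" by simp
  obtain R where R: "K \<subseteq> ball 0 R" "R > 0"
    using bounded_subset_ballD[OF compact_imp_bounded[OF assms(2)]] by blast
  have out: "z \<notin> K" if "z \<notin> cbox (-R,-R) (R,R)" for z
  proof
    assume "z \<in> K"
    then have n: "norm z < R" using R by auto
    have "\<bar>fst z\<bar> \<le> norm z" "\<bar>snd z\<bar> \<le> norm z"
      using norm_fst_le[of "fst z" "snd z"] norm_snd_le[of "snd z" "fst z"] by auto
    then show False using that n by (cases z) (auto simp: cbox_Pair_eq)
  qed
  then show "\<exists>R>0. (\<forall>z. z \<notin> cbox (-R,-R) (R,R) \<longrightarrow> z \<notin> K)" using R by blast
  have "f integrable_on cbox (-R,-R) (R,R)"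
    by (rule integrable_continuous) (rule continuous_on_subset[OF c], simp)
  then have "(f has_integral integral (cbox (-R,-R) (R,R)) f) UNIV"
    by (intro has_integral_cbox_UNIV[of _ _ "(-R,-R)" "(R,R)"] integrable_integral) (use out assms(5) in auto)
  then show "f integrable_on UNIV" by blast
  have "(\<lambda>x. if x \<in> \<Omega> then f x else 0) = f" using assms(3,5) by (auto simp: fun_eq_iff)
  then show "integral \<Omega> f = integral UNIV f" using integral_restrict_UNIV[of \<Omega> f] by simp
qed

lemma integral_rescale:
  fixes f :: "real \<times> real \<Rightarrow> real"
  assumes "continuous_on UNIV f" "compact K" "\<And>z. z \<notin> K \<Longrightarrow> f z = 0" "k > 0"
  shows "((\<lambda>z. f (k *\<^sub>R z)) has_integral (integral UNIV f / k\<^sup>2)) UNIV"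
proof -
  obtain R where R: "R > 0" "\<And>z. z \<notin> cbox (-R,-R) (R,R) \<Longrightarrow> z \<notin> K"
    using integrable_compact_support(3)[of UNIV K f] assms by auto
  let ?B = "cbox (-R,-R) (R,R)"
  have i: "f integrable_on ?B"
    by (rule integrable_continuous) (rule continuous_on_subset[OF assms(1)], simp)
  have "(f has_integral integral ?B f) UNIV"
    by (rule has_integral_cbox_UNIV[of _ _ "(-R,-R)" "(R,R)"]) (use i R assms in \<open>auto simp: integrable_integral\<close>)
  then have e: "integral UNIV f = integral ?B f" by (simp add: integral_unique)
  have "((\<lambda>x. f (k *\<^sub>R x + 0)) has_integral (integral ?B f /\<^sub>R k ^ DIM(real \<times> real)))
           (cbox (((-R,-R) - 0) /\<^sub>R k) (((R,R) - 0) /\<^sub>R k))"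
    by (rule has_integral_affinity'[OF integrable_integral[OF i] assms(4)])
  then have "((\<lambda>x. f (k *\<^sub>R x)) has_integral (integral UNIV f / k\<^sup>2)) (cbox ((-R,-R) /\<^sub>R k) ((R,R) /\<^sub>R k))"
    by (simp add: e divide_inverse mult.commute power2_eq_square)
  then show ?thesis
  proof (rule has_integral_cbox_UNIV)
    fix z assume z: "z \<notin> cbox ((-R,-R) /\<^sub>R k) ((R,R) /\<^sub>R k)"
    have "k *\<^sub>R z \<notin> ?B"
    proof
      assume "k *\<^sub>R z \<in> ?B"
      then have "z \<in> cbox ((-R,-R) /\<^sub>R k) ((R,R) /\<^sub>R k)" using assms(4)
        by (cases z) (auto simp: cbox_Pair_eq field_simps)
      then show False using z by simp
    qed
    then show "f (k *\<^sub>R z) = 0" using R assms(3) by auto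
  qed
qed

lemma frechet_derivative_zero_outside:
  assumes "closed K" "\<And>z. z \<notin> K \<Longrightarrow> u z = 0" "z \<notin> K"
  shows "frechet_derivative u (at z) = (\<lambda>h. 0 :: real)"
proof -
  have "((\<lambda>_. 0) has_derivative (\<lambda>h. 0 :: real)) (at z)" by simp
  then have "(u has_derivative (\<lambda>h. 0)) (at z)"
    by (rule has_derivative_transform_within_open[of _ _ _ _ "-K"]) (use assms in auto)
  then show ?thesis using frechet_derivative_at by metis
qed

lemma test_funD:
  assumes "test_fun \<Omega> u"
  obtains K ux uy where "compact K" "K \<subseteq> \<Omega>" "C1_on UNIV u ux uy" "grad_sq u = (\<lambda>z. (ux z)\<^sup>2 + (uy z)\<^sup>2)"
    "\<And>z. z \<notin> K \<Longrightarrow> u z = 0 \<and> ux z = 0 \<and> uy z = 0"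
proof
  let ?K = "closure {x. u x \<noteq> 0}"
  let ?ux = "\<lambda>z. frechet_derivative u (at z) (1,0)" and ?uy = "\<lambda>z. frechet_derivative u (at z) (0,1)"
  show "compact ?K" "?K \<subseteq> \<Omega>" using assms unfolding test_fun_def by auto
  show "C1_on UNIV u ?ux ?uy" using smooth_imp_C1_on assms unfolding test_fun_def by auto
  show "grad_sq u = (\<lambda>z. (?ux z)\<^sup>2 + (?uy z)\<^sup>2)" by (simp add: grad_sq_eq fun_eq_iff)
  have z: "u z = 0" if "z \<notin> ?K" for z using that closure_subset[of "{x. u x \<noteq> 0}"] by auto
  show "u z = 0 \<and> ?ux z = 0 \<and> ?uy z = 0" if "z \<notin> ?K" for z
    using frechet_derivative_zero_outside[OF closed_closure z that] z[OF that] by simp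
qed

lemma smooth_rescale:
  fixes u :: "'a::euclidean_space \<Rightarrow> real"
  assumes "smooth u"
  shows "smooth (\<lambda>z. u (k *\<^sub>R z))"
proof -
  \<comment> \<open>Each partial derivative brings out a factor \<open>k\<close>, so the coinduction
    has to run over all constant multiples of rescaled smooth functions.\<close>
  have "smooth f" if "\<exists>a g. smooth g \<and> f = (\<lambda>z::'a. a * g (k *\<^sub>R z))" for f
    using that
  proof (coinduction arbitrary: f)
    case smooth
    then obtain a g where g: "smooth g" "f = (\<lambda>z. a * g (k *\<^sub>R z))" by auto
    have d: "g differentiable_on UNIV" and
      p: "\<And>i. i \<in> Basis \<Longrightarrow> smooth (\<lambda>x. frechet_derivative g (at x) i)"
      using g(1) by (auto elim: smooth.cases)
    have D: "(f has_derivative (\<lambda>h. a * (k * frechet_derivative g (at (k *\<^sub>R z)) h))) (at z)" for z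
    proof -
      have G: "(g has_derivative frechet_derivative g (at (k *\<^sub>R z))) (at (k *\<^sub>R z))"
        using d by (simp add: differentiable_on_def frechet_derivative_works[symmetric])
      have "((\<lambda>z. k *\<^sub>R z) has_derivative (\<lambda>h. k *\<^sub>R h)) (at z)" by (auto intro!: derivative_eq_intros)
      from has_derivative_compose[OF this G]
      have "((\<lambda>z. g (k *\<^sub>R z)) has_derivative (\<lambda>h. frechet_derivative g (at (k *\<^sub>R z)) (k *\<^sub>R h))) (at z)" .
      then have "((\<lambda>z. g (k *\<^sub>R z)) has_derivative (\<lambda>h. k * frechet_derivative g (at (k *\<^sub>R z)) h)) (at z)"
        using has_derivative_linear[OF G] by (simp add: linear_cmul)
      then show ?thesis unfolding g(2) by (rule has_derivative_mult_right)
    qed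
    have "f differentiable_on UNIV" using D by (auto simp: differentiable_on_def differentiable_def)
    moreover have "(\<lambda>x. frechet_derivative f (at x) i) = (\<lambda>z. (a * k) * frechet_derivative g (at (k *\<^sub>R z)) i)" for i
      using frechet_derivative_at[OF D, symmetric] by (simp add: fun_eq_iff)
    ultimately show ?case using p by (intro exI[of _ f]) blast
  qed
  then show ?thesis using assms by (metis mult_1)
qed

section \<open>Scaling to the vertex\<close>

lemma Lambda_scale: "k > 0 \<Longrightarrow> k *\<^sub>R z \<in> Lambda \<beta> \<longleftrightarrow> z \<in> Lambda \<beta>"
proof -
  have "k *\<^sub>R z \<in> Lambda \<beta>" if k: "k > 0" and z: "z \<in> Lambda \<beta>" for k z
  proof -
    obtain r t where "z = (r * cos t, r * sin t)" "r > 0" "0 < t" "t < \<beta>"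
      using z unfolding Lambda_def by blast
    then have "k *\<^sub>R z = ((k * r) * cos t, (k * r) * sin t) \<and> k * r > 0 \<and> 0 < t \<and> t < \<beta>"
      using k by simp
    then show ?thesis unfolding Lambda_def by blast
  qed
  from this[of k z] this[of "inverse k" "k *\<^sub>R z"] show "k > 0 \<Longrightarrow> k *\<^sub>R z \<in> Lambda \<beta> \<longleftrightarrow> z \<in> Lambda \<beta>"
    by auto
qed

text \<open>sin \<gamma> is the distance from \<open>O\<close> to the line of \<open>L1\<close>;
  half of it leaves room for bounding each coordinate crudely by the norm.\<close>

lemma E_polar_near_vertex:
  assumes bg: "0 < \<gamma>" "\<gamma> < pi" "pi \<le> \<beta>" "\<beta> \<le> 2 * pi"
  assumes "z \<in> Lambda \<beta>" "norm z < sin \<gamma> / 2"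
  shows "z \<in> E_polar \<beta> \<gamma>"
proof (cases "snd z > 0")
  case True
  have n: "\<bar>fst z\<bar> \<le> norm z" "\<bar>snd z\<bar> \<le> norm z"
    using norm_fst_le[of "fst z" "snd z"] norm_snd_le[of "snd z" "fst z"] by auto
  have "\<bar>fst z * sin \<gamma>\<bar> \<le> norm z * 1" "\<bar>snd z * cos \<gamma>\<bar> \<le> norm z * 1"
    unfolding abs_mult using n by (intro mult_mono; simp)+
  then have "edge_Y \<gamma> z > 0" using assms(6) unfolding edge_Y_def by (simp add: left_diff_distrib)
  then show ?thesis using True unfolding E_polar_def by auto
next
  case False
  then have "pi \<le> ang z" using ang_lt_pi[of z] assms Lambda_eq[OF bg(4)] by auto
  then show ?thesis using assms Lambda_eq[OF bg(4)] unfolding E_polar_def by auto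
qed

text \<open>In the plane both integrals are invariant under dilation, so a test function of the
  sector can be shrunk into the disc where the two domains coincide. The boundary distances need
  only be compared: \<open>E\<close> is contained in the sector, hence its boundary distance is the
  smaller one and its weight the larger, which is the right direction.\<close>

lemma hardy_E_imp_Lambda:
  assumes bg: "0 < \<gamma>" "\<gamma> < pi" "pi \<le> \<beta>" "\<beta> \<le> 2 * pi"
    and c: "c \<ge> 0" and H: "hardy_ineq (E_polar \<beta> \<gamma>) c"
  shows "hardy_ineq (Lambda \<beta>) c"
  unfolding hardy_ineq_def
proof (intro allI impI)
  let ?E = "E_polar \<beta> \<gamma>" and ?L = "Lambda \<beta>"
  fix u assume u: "test_fun ?L u"
  have le: "\<gamma> \<le> pi" using bg by simp
  note bg' = bg(1) le bg(3,4)
  obtain K ux uy where K: "compact K" "K \<subseteq> ?L" and C: "C1_on UNIV u ux uy"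
    and g: "grad_sq u = (\<lambda>z. (ux z)\<^sup>2 + (uy z)\<^sup>2)" and z0: "\<And>z. z \<notin> K \<Longrightarrow> u z = 0 \<and> ux z = 0 \<and> uy z = 0"
    using test_funD[OF u] by blast
  obtain R where R: "K \<subseteq> ball 0 R" "R > 0"
    using bounded_subset_ballD[OF compact_imp_bounded[OF K(1)]] by blast
  define k where "k = R / (sin \<gamma> / 2)"
  have sg: "sin \<gamma> > 0" using bg by (intro sin_gt_zero) auto
  have k: "k > 0" "R / k = sin \<gamma> / 2" using R sg by (auto simp: k_def field_simps)
  define v where "v z = u (k *\<^sub>R z)" for z
  define K' where "K' = (\<lambda>z. (1/k) *\<^sub>R z) ` K"
  have K'iff: "z \<in> K' \<longleftrightarrow> k *\<^sub>R z \<in> K" for z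
    unfolding K'_def using k by (auto intro!: image_eqI[of _ _ "k *\<^sub>R z"])
  have cK': "compact K'" unfolding K'_def using K(1) by (intro compact_continuous_image continuous_intros)
  have K'E: "K' \<subseteq> ?E"
  proof
    fix z assume "z \<in> K'"
    then have kz: "k *\<^sub>R z \<in> K" by (simp add: K'iff)
    then have "norm (k *\<^sub>R z) < R" using R by auto
    then have "norm z < R / k" using k by (simp add: field_simps)
    moreover have "z \<in> ?L" using kz K(2) Lambda_scale[OF k(1), of z] by blast
    ultimately show "z \<in> ?E" using E_polar_near_vertex[OF bg] k(2) by simp
  qed
  have v0: "v z = 0" if "z \<notin> K'" for z using that z0 K'iff unfolding v_def by auto
  then have sup: "{x. v x \<noteq> 0} \<subseteq> K'" by auto
  have cl: "closure {x. v x \<noteq> 0} \<subseteq> K'" by (rule closure_minimal[OF sup]) (simp add: cK' compact_imp_closed)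
  have "smooth v" unfolding v_def[abs_def] using u smooth_rescale unfolding test_fun_def by blast
  then have tv: "test_fun ?E v" unfolding test_fun_def
    using cl K'E bounded_subset[OF compact_imp_bounded[OF cK'] sup] by (simp add: compact_closure)
  have oE: "open ?E" and oL: "open ?L" by (rule open_E_polar[OF bg'] open_Lambda[OF bg'])+
  have EL: "?E \<subseteq> ?L" by (rule E_polar_sub_Lambda[OF bg'])
  have nL: "?L \<noteq> UNIV" using not_Lambda_P[OF bg] by auto
  have nE: "?E \<noteq> UNIV" using nL EL by auto
  have Cv: "C1_on UNIV v (\<lambda>z. k * ux (k *\<^sub>R z)) (\<lambda>z. k * uy (k *\<^sub>R z))"
  proof -
    have "(v has_derivative (\<lambda>h. fst h * (k * ux (k *\<^sub>R z)) + snd h * (k * uy (k *\<^sub>R z)))) (at z)" for z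
    proof -
      have "((\<lambda>z. k *\<^sub>R z) has_derivative (\<lambda>h. k *\<^sub>R h)) (at z)" by (auto intro!: derivative_eq_intros)
      moreover have "(u has_derivative (\<lambda>h. fst h * ux (k *\<^sub>R z) + snd h * uy (k *\<^sub>R z))) (at (k *\<^sub>R z))"
        using C unfolding C1_on_def by blast
      ultimately have "((\<lambda>z. u (k *\<^sub>R z)) has_derivative (\<lambda>h. fst (k *\<^sub>R h) * ux (k *\<^sub>R z) + snd (k *\<^sub>R h) * uy (k *\<^sub>R z))) (at z)"
        by (rule has_derivative_compose)
      then show ?thesis unfolding v_def[abs_def] by (simp add: algebra_simps)
    qed
    moreover have "continuous_on UNIV (\<lambda>z. k * ux (k *\<^sub>R z))" "continuous_on UNIV (\<lambda>z. k * uy (k *\<^sub>R z))"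
      using C unfolding C1_on_def by (auto intro!: continuous_intros elim: continuous_on_compose2)
    ultimately show ?thesis unfolding C1_on_def by auto
  qed
  have cu: "continuous_on S u" "continuous_on S ux" "continuous_on S uy" "continuous_on S v" for S
    using C C1_on_cont[OF C] C1_on_cont[OF Cv] unfolding C1_on_def by (auto intro: continuous_on_subset)
  have cg: "continuous_on UNIV (grad_sq u)" unfolding g by (intro continuous_intros cu)
  let ?wL = "\<lambda>x. (u x)\<^sup>2 / (bdist ?L x)\<^sup>2" and ?wE = "\<lambda>x. (v x)\<^sup>2 / (bdist ?E x)\<^sup>2"
  have cwL: "continuous_on ?L ?wL"
    by (intro continuous_intros cu continuous_on_bdist) (use bdist_pos[OF oL _ nL] in force)
  have cwE: "continuous_on ?E ?wE"
    by (intro continuous_intros cu continuous_on_bdist) (use bdist_pos[OF oE _ nE] in force)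
  have wL0: "?wL z = 0" if "z \<notin> K" for z using z0[OF that] by simp
  have wE0: "?wE z = 0" if "z \<notin> K'" for z using v0[OF that] by simp
  note IL = integrable_compact_support[OF oL K cwL wL0]
  note IE = integrable_compact_support[OF oE cK' K'E cwE wE0]
  have g0: "grad_sq u z = 0" if "z \<notin> K" for z using z0[OF that] by (simp add: g)
  have gv: "grad_sq v = (\<lambda>z. k\<^sup>2 * grad_sq u (k *\<^sub>R z))"
    using grad_sq_C1[OF Cv] unfolding g by (auto simp: fun_eq_iff power_mult_distrib algebra_simps)
  have gv0: "grad_sq v z = 0" if "z \<notin> K'" for z using that g0 K'iff gv by simp
  have cgv: "continuous_on ?E (grad_sq v)" unfolding gv
    by (intro continuous_intros continuous_on_compose2[OF cg]) auto
  have G: "integral ?E (grad_sq v) = integral UNIV (grad_sq u)"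
  proof -
    have "((\<lambda>z. k\<^sup>2 * grad_sq u (k *\<^sub>R z)) has_integral k\<^sup>2 * (integral UNIV (grad_sq u) / k\<^sup>2)) UNIV"
      by (intro has_integral_mult_right integral_rescale[OF cg K(1) g0 k(1)])
    then have "((\<lambda>z. k\<^sup>2 * grad_sq u (k *\<^sub>R z)) has_integral integral UNIV (grad_sq u)) UNIV" using k by simp
    then have "integral UNIV (grad_sq v) = integral UNIV (grad_sq u)" unfolding gv by (rule integral_unique)
    then show ?thesis using integrable_compact_support(2)[OF oE cK' K'E cgv gv0] by simp
  qed
  have "((\<lambda>z. k\<^sup>2 * ?wL (k *\<^sub>R z)) has_integral k\<^sup>2 * (integral UNIV ?wL / k\<^sup>2)) UNIV"
    by (intro has_integral_mult_right integral_rescale[OF IL(4) K(1) wL0 k(1)])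
  then have "((\<lambda>z. k\<^sup>2 * ?wL (k *\<^sub>R z)) has_integral integral UNIV ?wL) UNIV" using k by simp
  then have "integral UNIV ?wL \<le> integral UNIV ?wE"
  proof (rule has_integral_le[OF _ integrable_integral[OF IE(1)]])
    fix z
    show "k\<^sup>2 * ?wL (k *\<^sub>R z) \<le> ?wE z"
    proof (cases "z \<in> K'")
      case False
      then have "?wL (k *\<^sub>R z) = 0" "?wE z = 0" using K'iff[of z] wL0[of "k *\<^sub>R z"] wE0[of z] by simp_all
      then show ?thesis by (simp only: mult_zero_right order_refl)
    next
      case True
      then have zE: "z \<in> ?E" using K'E by auto
      then have kzL: "k *\<^sub>R z \<in> ?L" using EL Lambda_scale[OF k(1)] by auto
      have "k * bdist ?E z \<le> bdist ?L (k *\<^sub>R z)"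
      proof (rule bdist_ge[OF kzL nL])
        fix w assume "w \<in> frontier ?L"
        then have "w \<notin> ?L" using oL by (simp add: frontier_def interior_open)
        then have "(1/k) *\<^sub>R w \<notin> ?E" using EL Lambda_scale[of "1/k" w] k(1) by auto
        then have "bdist ?E z \<le> dist z ((1/k) *\<^sub>R w)" by (rule bdist_le_dist[OF zE])
        then have "k * bdist ?E z \<le> k * dist z ((1/k) *\<^sub>R w)" using k by simp
        also have "\<dots> = dist (k *\<^sub>R z) (k *\<^sub>R (1/k) *\<^sub>R w)"
          unfolding dist_norm scaleR_diff_right[symmetric] norm_scaleR using k(1) by simp
        also have "\<dots> = dist (k *\<^sub>R z) w" using k(1) by simp
        finally show "k * bdist ?E z \<le> dist (k *\<^sub>R z) w" .
      qed
      then have "(k * bdist ?E z)\<^sup>2 \<le> (bdist ?L (k *\<^sub>R z))\<^sup>2"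
        using k bdist_pos[OF oE zE nE] by (intro power_mono) auto
      moreover have "0 < (k * bdist ?E z)\<^sup>2" using k bdist_pos[OF oE zE nE] by simp
      ultimately have "(u (k *\<^sub>R z))\<^sup>2 / (bdist ?L (k *\<^sub>R z))\<^sup>2 \<le> (u (k *\<^sub>R z))\<^sup>2 / (k * bdist ?E z)\<^sup>2"
        by (intro divide_left_mono mult_pos_pos) auto
      then have "k\<^sup>2 * ((u (k *\<^sub>R z))\<^sup>2 / (bdist ?L (k *\<^sub>R z))\<^sup>2) \<le> k\<^sup>2 * ((u (k *\<^sub>R z))\<^sup>2 / (k * bdist ?E z)\<^sup>2)"
        by (intro mult_left_mono) auto
      then show ?thesis using k by (simp add: v_def power_mult_distrib)
    qed
  qed
  then have "c * integral UNIV ?wL \<le> c * integral UNIV ?wE" using c by (rule mult_left_mono)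
  also have "\<dots> \<le> integral ?E (grad_sq v)" using H tv IE(2) unfolding hardy_ineq_def by metis
  also have "\<dots> = integral ?L (grad_sq u)"
    using G integrable_compact_support(2)[OF oL K continuous_on_subset[OF cg] g0] by simp
  finally show "integral ?L (grad_sq u) \<ge> c * integral ?L ?wL" using IL(2) by simp
qed

section \<open>Smooth functions of one variable\<close>

coinductive smooth1 :: "(real \<Rightarrow> real) \<Rightarrow> bool" where
  "(\<forall>x. (f has_real_derivative f' x) (at x)) \<Longrightarrow> smooth1 f' \<Longrightarrow> smooth1 f"

lemma smooth1_coinduct_pred:
  assumes "P f" and step: "\<And>f. P f \<Longrightarrow> \<exists>f'. (\<forall>x. (f has_real_derivative f' x) (at x)) \<and> P f'"
  shows "smooth1 f"
  using assms(1)
proof (coinduction arbitrary: f)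
  case smooth1
  obtain f' where f': "\<forall>x. (f has_real_derivative f' x) (at x)" "P f'" using step[OF smooth1] by (elim exE conjE)
  show ?case
    by (rule exI[of _ f], rule exI[of _ f'], rule conjI[OF refl], rule conjI[OF f'(1)], rule disjI1,
        rule exI[of _ f'], rule conjI[OF refl f'(2)])
qed

text \<open>The product rule leads from products to sums of products, so the coinduction for
  products needs an invariant closed under both operations.\<close>

inductive alg1 :: "(real \<Rightarrow> real) \<Rightarrow> bool" where
  "smooth1 f \<Longrightarrow> alg1 f"
| "alg1 f \<Longrightarrow> alg1 g \<Longrightarrow> alg1 (\<lambda>x. f x + g x)"
| "alg1 f \<Longrightarrow> alg1 g \<Longrightarrow> alg1 (\<lambda>x. f x * g x)"

lemma alg1_deriv: "alg1 f \<Longrightarrow> \<exists>f'. (\<forall>x. (f has_real_derivative f' x) (at x)) \<and> alg1 f'"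
proof (induction rule: alg1.induct)
  case (1 f)
  then obtain f' where "\<forall>x. (f has_real_derivative f' x) (at x)" "smooth1 f'"
    by (auto elim: smooth1.cases)
  then show ?case by (intro exI[of _ f']) (simp add: alg1.intros(1))
next
  case (2 f g)
  then obtain f' g' where *: "\<forall>x. (f has_real_derivative f' x) (at x)" "\<forall>x. (g has_real_derivative g' x) (at x)" "alg1 f'" "alg1 g'"
    by (elim exE conjE)
  have "\<forall>x. ((\<lambda>x. f x + g x) has_real_derivative f' x + g' x) (at x)"
    using *(1,2) DERIV_add by fast
  then show ?case using alg1.intros(2)[OF *(3,4)] by (intro exI[of _ "\<lambda>x. f' x + g' x"] conjI)
next
  case (3 f g)
  then obtain f' g' where *: "\<forall>x. (f has_real_derivative f' x) (at x)" "\<forall>x. (g has_real_derivative g' x) (at x)" "alg1 f'" "alg1 g'"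
    by (elim exE conjE)
  then have "\<forall>x. ((\<lambda>x. f x * g x) has_real_derivative (f' x * g x + g' x * f x)) (at x)"
    using DERIV_mult by fast
  moreover have "alg1 (\<lambda>x. f' x * g x + g' x * f x)"
    by (rule alg1.intros(2)[OF alg1.intros(3)[OF *(3) 3(2)] alg1.intros(3)[OF *(4) 3(1)]])
  ultimately show ?case by (intro exI[of _ "\<lambda>x. f' x * g x + g' x * f x"] conjI)
qed

lemma alg1_imp_smooth1: "alg1 f \<Longrightarrow> smooth1 f"
  by (erule smooth1_coinduct_pred[where P=alg1]) (rule alg1_deriv)

lemma smooth1_mult: "smooth1 f \<Longrightarrow> smooth1 g \<Longrightarrow> smooth1 (\<lambda>x. f x * g x)"
  by (rule alg1_imp_smooth1[OF alg1.intros(3)[OF alg1.intros(1) alg1.intros(1)]])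

lemma smooth1_D: "smooth1 f \<Longrightarrow> \<exists>f'. (\<forall>x. (f has_real_derivative f' x) (at x)) \<and> smooth1 f'"
  by (erule smooth1.cases) blast

lemma smooth1_cont: "smooth1 f \<Longrightarrow> continuous_on S f"
  using smooth1_D[of f] DERIV_imp_continuous_on[of f] by blast

lemma smooth1_sin_cos: "smooth1 (\<lambda>x. p * sin x + q * cos x)"
proof (rule smooth1_coinduct_pred[where P="\<lambda>f. \<exists>p q. \<forall>x. f x = p * sin x + q * cos x"])
  fix f :: "real \<Rightarrow> real" assume "\<exists>p q. \<forall>x. f x = p * sin x + q * cos x"
  then obtain p q where "\<forall>x. f x = p * sin x + q * cos x" by (elim exE)
  then have f: "f = (\<lambda>x. p * sin x + q * cos x)" by (simp add: fun_eq_iff)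
  have "\<forall>x. (f has_real_derivative (- q * sin x + p * cos x)) (at x)"
    unfolding f by (auto intro!: derivative_eq_intros)
  then show "\<exists>f'. (\<forall>x. (f has_real_derivative f' x) (at x)) \<and> (\<exists>p q. \<forall>x. f' x = p * sin x + q * cos x)"
    by (intro exI[of _ "\<lambda>x. - q * sin x + p * cos x"] conjI exI[of _ "- q"] exI[of _ p]) simp_all
qed (intro exI[of _ p] exI[of _ q], simp)

lemma smooth1_exp_uminus: "smooth1 (\<lambda>x. exp (- x))"
proof (rule smooth1_coinduct_pred[where P="\<lambda>f. \<exists>p. \<forall>x. f x = p * exp (- x)"])
  fix f :: "real \<Rightarrow> real" assume "\<exists>p. \<forall>x. f x = p * exp (- x)"
  then obtain p where "\<forall>x. f x = p * exp (- x)" by (elim exE)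
  then have f: "f = (\<lambda>x. p * exp (- x))" by (simp add: fun_eq_iff)
  have "\<forall>x. (f has_real_derivative (- p * exp (- x))) (at x)"
    unfolding f by (auto intro!: derivative_eq_intros)
  then show "\<exists>f'. (\<forall>x. (f has_real_derivative f' x) (at x)) \<and> (\<exists>p. \<forall>x. f' x = p * exp (- x))"
    by (intro exI[of _ "\<lambda>x. - p * exp (- x)"] conjI exI[of _ "- p"]) simp_all
qed (intro exI[of _ 1], simp)

section \<open>Flat functions and smooth approximation on the line\<close>

definition flat :: "nat \<Rightarrow> real \<Rightarrow> real" where
  "flat k w = (if w > 0 then (1/w)^k * exp (- (1/w)) else 0)"

text \<open>The shift trades a lower index for a factor \<open>w\<close>. It brings all terms in the
  derivative of a polynomial times \<open>flat\<close> to one index.\<close>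

lemma flat_shift: "flat k w = w * flat (Suc k) w"
  by (auto simp: flat_def)

lemma flat_nonneg: "0 \<le> flat k w"
  by (auto simp: flat_def)

text \<open>With n = k + 1 and x = 1/w, the inequality x/n \<le> exp (x/n) is raised to the power n.
  Applied to the next index, the linear bound gives the derivative 0 at the origin.\<close>

lemma flat_le: "flat k w \<le> (real (Suc k))^(Suc k) * \<bar>w\<bar>"
proof (cases "w > 0")
  case True
  have "1 / w / real (Suc k) \<le> exp (1 / w / real (Suc k))"
    using exp_ge_add_one_self[of "1 / w / real (Suc k)"] by linarith
  then have "(1 / w / real (Suc k))^Suc k \<le> exp (1 / w / real (Suc k)) ^ Suc k"
    using True by (intro power_mono) auto
  also have "\<dots> = exp (1/w)" by (rule exp_divide_power_eq) simp
  finally have "(1/w)^Suc k / real (Suc k)^Suc k \<le> exp (1/w)"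
    by (simp only: power_divide)
  then have "(1/w)^Suc k \<le> exp (1/w) * real (Suc k)^Suc k"
    by (subst (asm) pos_divide_le_eq) (auto simp del: of_nat_Suc power_Suc)
  then have "(1/w)^Suc k * exp (-(1/w)) \<le> (exp (1/w) * real (Suc k)^Suc k) * exp (-(1/w))"
    by (rule mult_right_mono) simp
  also have "\<dots> = real (Suc k)^Suc k * (exp (1/w) * exp (-(1/w)))" by (simp only: ac_simps)
  also have "exp (1/w) * exp (-(1/w)) = 1" by (simp only: exp_minus_inverse)
  finally have "(1/w)^Suc k * exp (-(1/w)) \<le> real (Suc k)^Suc k" by (simp only: mult_1_right)
  then have "w * ((1/w)^Suc k * exp (-(1/w))) \<le> w * real (Suc k)^Suc k" using True by (intro mult_left_mono) auto
  moreover have "w * ((1/w)^Suc k * exp (-(1/w))) = flat k w" using True by (simp add: flat_def)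
  ultimately show ?thesis using True by (simp only: mult.commute abs_of_pos)
next
  case False
  then show ?thesis by (simp only: flat_def if_False) (intro mult_nonneg_nonneg, auto)
qed

lemma flat_deriv: "(flat k has_real_derivative (flat (k+2) w - real k * flat (k+1) w)) (at w)"
proof -
  consider "w > 0" | "w < 0" | "w = 0" by linarith
  then show ?thesis
  proof cases
    case 1
    have d1: "((\<lambda>x. exp (- (1/x))) has_real_derivative (exp (- (1/w)) * (1/w)^2)) (at w)"
    proof -
      have "((\<lambda>x. - (1/x)) has_real_derivative (1/w)^2) (at w)"
        using 1 DERIV_minus[OF DERIV_inverse[of w UNIV]] by (simp add: divide_inverse power2_eq_square)
      from DERIV_fun_exp[OF this] show ?thesis .
    qed
    have d2: "((\<lambda>x. (1/x)^k) has_real_derivative (- (real k * (1/w)^(k+1)))) (at w)"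
    proof (cases k)
      case (Suc m)
      have "((\<lambda>x. 1/x) has_real_derivative - ((1/w)^2)) (at w)"
        using 1 DERIV_inverse[of w UNIV] by (simp add: divide_inverse power2_eq_square)
      from DERIV_power[OF this, of k]
      have "((\<lambda>x. (1/x)^k) has_real_derivative (real k * (- ((1/w)^2) * (1/w)^(k - Suc 0)))) (at w)" .
      moreover have "(1/w)^2 * (1/w)^(k - Suc 0) = (1/w)^(k+1)"
        unfolding Suc power_add[symmetric] by simp
      ultimately show ?thesis by (simp only: mult_minus_left mult_minus_right)
    qed simp
    have "((\<lambda>x. (1/x)^k * exp (- (1/x))) has_real_derivative
       (- (real k * (1/w)^(k+1)) * exp (- (1/w)) + (exp (- (1/w)) * (1/w)^2) * (1/w)^k)) (at w)"
      by (rule DERIV_mult[OF d2 d1])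
    then have "((\<lambda>x. (1/x)^k * exp (- (1/x))) has_real_derivative (flat (k+2) w - real k * flat (k+1) w)) (at w)"
    proof (rule DERIV_cong)
      show "- (real k * (1/w)^(k+1)) * exp (- (1/w)) + (exp (- (1/w)) * (1/w)^2) * (1/w)^k = flat (k+2) w - real k * flat (k+1) w"
      proof -
        have "- (K * (P * a)) * e + (e * a^2) * P = P * a^2 * e - K * (P * a * e)" for K P a e :: real
          by (simp add: algebra_simps)
        then show ?thesis using 1 by (simp only: flat_def if_True power_add power_one_right)
      qed
    qed
    then show ?thesis
      by (rule has_field_derivative_transform_within_open[of _ _ _ "{0<..}"]) (use 1 in \<open>auto simp: flat_def\<close>)
  next
    case 2
    have "((\<lambda>x. 0) has_real_derivative 0) (at w)" by simp
    then have "(flat k has_real_derivative 0) (at w)"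
      by (rule has_field_derivative_transform_within_open[of _ _ _ "{..<0}"]) (use 2 in \<open>auto simp: flat_def\<close>)
    then show ?thesis using 2 by (simp add: flat_def)
  next
    case 3
    have "((\<lambda>h. flat (Suc k) h) \<longlongrightarrow> 0) (at 0)"
    proof (rule Lim_null_comparison)
      show "\<forall>\<^sub>F h in at 0. norm (flat (Suc k) h) \<le> (real (Suc (Suc k)))^(Suc (Suc k)) * \<bar>h\<bar>"
        using flat_le[of "Suc k"] flat_nonneg[of "Suc k"] by (intro always_eventually allI) (simp only: real_norm_def abs_of_nonneg)
      have "((\<lambda>h. (real (Suc (Suc k)))^(Suc (Suc k)) * \<bar>h\<bar>) \<longlongrightarrow> (real (Suc (Suc k)))^(Suc (Suc k)) * \<bar>0\<bar>) (at 0)"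
        by (intro tendsto_intros)
      then show "((\<lambda>h. (real (Suc (Suc k)))^(Suc (Suc k)) * \<bar>h\<bar>) \<longlongrightarrow> 0) (at 0)" by simp
    qed
    moreover have "\<forall>\<^sub>F h in at 0. flat (Suc k) h = (flat k (0 + h) - flat k 0) / h"
      by (subst flat_shift) (auto simp: eventually_at_filter flat_def)
    ultimately have "((\<lambda>h. (flat k (0 + h) - flat k 0) / h) \<longlongrightarrow> 0) (at 0)"
      by (rule Lim_transform_eventually)
    then show ?thesis using 3 by (simp add: DERIV_def flat_def)
  qed
qed

text \<open>Polynomials times \<open>flat k (poly W x)\<close>, for arbitrary \<open>k\<close>, are
  closed under differentiation; this family is the coinduction invariant.\<close>

lemma smooth1_poly_flat: "smooth1 (\<lambda>x. poly p x * flat k (poly W x))"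
proof (rule smooth1_coinduct_pred[where P="\<lambda>f. \<exists>p k. \<forall>x. f x = poly p x * flat k (poly W x)"])
  fix f :: "real \<Rightarrow> real" assume "\<exists>p k. \<forall>x. f x = poly p x * flat k (poly W x)"
  then obtain p k where "\<forall>x. f x = poly p x * flat k (poly W x)" by (elim exE)
  then have f: "f = (\<lambda>x. poly p x * flat k (poly W x))" by (simp add: fun_eq_iff)
  define q where "q = pderiv p * W^2 - smult (real k) (p * pderiv W * W) + p * pderiv W"
  have "\<forall>x. (f has_real_derivative (poly q x * flat (k+2) (poly W x))) (at x)"
  proof
    fix x
    have "((\<lambda>x. flat k (poly W x)) has_real_derivative (flat (k+2) (poly W x) - real k * flat (k+1) (poly W x)) * poly (pderiv W) x) (at x)"
      by (rule DERIV_chain2[OF flat_deriv poly_DERIV])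
    from DERIV_mult[OF poly_DERIV this]
    have d: "(f has_real_derivative (poly (pderiv p) x * flat k (poly W x) +
        (flat (k+2) (poly W x) - real k * flat (k+1) (poly W x)) * poly (pderiv W) x * poly p x)) (at x)" unfolding f .
    have e1: "flat (k+1) (poly W x) = poly W x * flat (k+2) (poly W x)"
      using flat_shift[of "k+1"] by simp
    have e2: "flat k (poly W x) = poly W x * (poly W x * flat (k+2) (poly W x))"
      using flat_shift[of k "poly W x"] e1 by simp
    have "poly (pderiv p) x * flat k (poly W x) +
        (flat (k+2) (poly W x) - real k * flat (k+1) (poly W x)) * poly (pderiv W) x * poly p x = poly q x * flat (k+2) (poly W x)"
      unfolding e1 e2 q_def by (simp add: algebra_simps power2_eq_square)
    with d show "(f has_real_derivative (poly q x * flat (k+2) (poly W x))) (at x)" by simp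
  qed
  then show "\<exists>f'. (\<forall>x. (f has_real_derivative f' x) (at x)) \<and> (\<exists>p k. \<forall>x. f' x = poly p x * flat k (poly W x))"
    by (intro exI[of _ "\<lambda>x. poly q x * flat (k+2) (poly W x)"] conjI exI[of _ q] exI[of _ "k+2"]) simp_all
qed (intro exI[of _ p] exI[of _ k], simp)

lemma C1_bounded_support:
  fixes W W' :: "real \<Rightarrow> real"
  assumes "\<And>x. (W has_real_derivative W' x) (at x)" "\<And>x. x \<notin> {a..b} \<Longrightarrow> W x = 0" "x \<notin> {a..b}"
  shows "W' x = 0"
proof -
  have "((\<lambda>_. 0) has_real_derivative 0) (at x)" by simp
  then have "(W has_real_derivative 0) (at x)"
    by (rule has_field_derivative_transform_within_open[of _ _ _ "-{a..b}"]) (use assms(2,3) in auto)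
  then show ?thesis using assms(1) DERIV_unique by blast
qed

text \<open>\<open>W\<close> is divided by a smooth bump that is positive on its support, and the quotient is approximated
  through polynomials.\<close>

lemma C1_smooth_approximation:
  fixes W W' :: "real \<Rightarrow> real"
  assumes W: "\<And>x. (W has_real_derivative W' x) (at x)" "continuous_on UNIV W'" "\<And>x. x \<notin> {a..b} \<Longrightarrow> W x = 0"
    and ab: "a' < a" "a \<le> b" "b < b'" and e: "0 < e"
  obtains f f' where "smooth1 f" "\<And>x. (f has_real_derivative f' x) (at x)" "\<And>x. x \<notin> {a'..b'} \<Longrightarrow> f x = 0"
    "\<And>x. \<bar>f x - W x\<bar> \<le> e" "\<And>x. \<bar>f' x - W' x\<bar> \<le> e"
proof -
  \<comment> \<open>A polynomial that is positive exactly on the open interval from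
    \<open>a'\<close> to \<open>b'\<close>; \<open>flat 0\<close> turns it into the bump
    \<open>B\<close>.\<close>
  define w where "w = [:- a' * b', a' + b', - 1:]"
  have w: "poly w x = (x - a') * (b' - x)" for x by (simp add: w_def algebra_simps)
  define B where "B x = flat 0 (poly w x)" for x
  define B' where "B' x = flat 2 (poly w x) * poly (pderiv w) x" for x
  have dB: "(B has_real_derivative B' x) (at x)" for x
    using DERIV_chain2[OF flat_deriv[of 0] poly_DERIV[of w x]] unfolding B_def[abs_def] B'_def by (simp add: numeral_2_eq_2)
  have cf: "continuous_on UNIV (flat k)" for k
    by (rule DERIV_imp_continuous_on[OF flat_deriv])
  have cB': "continuous_on UNIV B'" unfolding B'_def[abs_def]
    by (intro continuous_intros continuous_on_compose2[OF cf]) auto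
  have Bpos: "B x > 0" if "x \<in> {a'<..<b'}" for x
    using that by (simp add: B_def flat_def w)
  have B0: "B x = 0" if "x \<notin> {a'<..<b'}" for x
  proof -
    have "x \<le> a' \<or> b' \<le> x" using that by auto
    then have "(x - a') * (b' - x) \<le> 0" using ab by (auto intro: mult_nonpos_nonneg mult_nonneg_nonpos)
    then show ?thesis by (simp add: B_def flat_def w)
  qed
  have Ble: "0 \<le> B x" "B x \<le> 1" for x by (auto simp: B_def flat_def)
  define G where "G x = W x / B x" for x
  define G' where "G' x = (if x \<in> {a..b} then (W' x * B x - W x * B' x) / (B x * B x) else 0)" for x
  have W'0: "W' x = 0" if "x \<notin> {a..b}" for x by (rule C1_bounded_support[OF W(1,3) that])
  have G'alt: "G' x = (W' x * B x - W x * B' x) / (B x * B x)" if "x \<in> {a'<..<b'}" for x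
    using W'0[of x] W(3)[of x] by (auto simp: G'_def)
  have dG: "(G has_real_derivative G' x) (at x)" for x
  proof (cases "x \<in> {a'<..<b'}")
    case True
    then show ?thesis unfolding G_def[abs_def] G'alt[OF True]
      using DERIV_quotient[OF W(1) dB, of x] Bpos[OF True] by (simp add: power2_eq_square mult.commute)
  next
    case False
    then have x: "x \<notin> {a..b}" using ab by auto
    have "((\<lambda>_. 0) has_real_derivative 0) (at x)" by simp
    then have "(G has_real_derivative 0) (at x)"
      by (rule has_field_derivative_transform_within_open[of _ _ _ "-{a..b}"]) (use x W(3) in \<open>auto simp: G_def\<close>)
    then show ?thesis using x by (auto simp: G'_def)
  qed
  have cG': "continuous_on UNIV G'"
  proof -
    have nz: "B x * B x \<noteq> 0" if "x \<in> {a'<..<b'}" for x using Bpos[OF that] by simp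
    have c1: "continuous_on {a'<..<b'} G'"
    proof (rule continuous_on_eq[of _ "\<lambda>x. (W' x * B x - W x * B' x) / (B x * B x)"])
      have c: "continuous_on S W" "continuous_on S B" "continuous_on S W'" "continuous_on S B'" for S
        by (rule DERIV_imp_continuous_on[OF W(1)] DERIV_imp_continuous_on[OF dB]
            continuous_on_subset[OF W(2) subset_UNIV] continuous_on_subset[OF cB' subset_UNIV])+
      show "continuous_on {a'<..<b'} (\<lambda>x. (W' x * B x - W x * B' x) / (B x * B x))"
        by (intro continuous_on_divide continuous_on_diff continuous_on_mult c) (use nz in blast)
    qed (use G'alt in auto)
    have c2: "continuous_on (-{a..b}) G'"
      by (rule continuous_on_eq[of _ "\<lambda>_. 0"]) (auto simp: G'_def)
    have "continuous_on ({a'<..<b'} \<union> -{a..b}) G'"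
      by (intro continuous_on_open_Un c1 c2) auto
    moreover have "{a'<..<b'} \<union> -{a..b} = UNIV" using ab by auto
    ultimately show ?thesis by simp
  qed
  obtain M where M: "M > 0" "\<And>x. x \<in> {a'..b'} \<Longrightarrow> \<bar>B' x\<bar> \<le> M"
  proof -
    have "compact (B' ` {a'..b'})" by (intro compact_continuous_image continuous_on_subset[OF cB']) auto
    then obtain M where "\<forall>y\<in>B' ` {a'..b'}. norm y \<le> M" using compact_imp_bounded bounded_iff by blast
    then show ?thesis by (intro that[of "max M 1"]) (auto simp: le_max_iff_disj)
  qed
  define l where "l = b' - a'"
  have l: "l > 0" using ab by (simp add: l_def)
  \<comment> \<open>\<open>d\<close> is the error allowed for \<open>G'\<close>. It enters
    \<open>f - W\<close> through an integration over length \<open>l\<close>, and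
    \<open>f' - W'\<close> both directly and through \<open>B'\<close> times the integrated error;
    the denominator adds up the three contributions.\<close>
  define d where "d = e / (1 + l + M * l)"
  have dpos: "d > 0" using e l M by (simp add: d_def add_pos_pos)
  have de: "d * (1 + l + M * l) = e"
  proof -
    have "1 + l + M * l > 0" using l M by (simp add: add_pos_pos)
    then show ?thesis by (simp add: d_def)
  qed
  have "continuous_on {a'..b'} G'" by (rule continuous_on_subset[OF cG']) simp
  then obtain g where g: "real_polynomial_function g" "\<And>x. x \<in> {a'..b'} \<Longrightarrow> \<bar>G' x - g x\<bar> < d"
    using Stone_Weierstrass_real_polynomial_function[OF compact_Icc _ dpos, of a' b' G'] by blast
  obtain cs n where cs: "g = (\<lambda>x. \<Sum>i\<le>n. cs i * x ^ i)"
    using real_polynomial_function_imp_sum[OF g(1)] by (elim exE)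
  \<comment> \<open>The polynomial approximates the derivative \<open>G'\<close> and is then
    integrated: closeness of the values alone would not control the derivatives.\<close>
  define p0 where "p0 = (\<Sum>i\<le>n. monom (cs i / real (Suc i)) (Suc i))"
  have "pderiv p0 = (\<Sum>i\<le>n. monom (cs i) i)"
    unfolding p0_def higher_pderiv_sum[of 1, simplified] by (intro sum.cong) (auto simp: pderiv_monom simp del: of_nat_Suc)
  then have pd: "poly (pderiv p0) x = g x" for x unfolding cs by (simp add: poly_sum poly_monom)
  define p where "p = p0 - [:poly p0 a':]"
  have dp: "(poly p has_real_derivative g x) (at x)" for x
  proof -
    have "pderiv p = pderiv p0" by (simp add: p_def pderiv_diff pderiv_pCons)
    then show ?thesis using poly_DERIV[of p x] pd[of x] by simp
  qed
  have pG: "\<bar>poly p x - G x\<bar> \<le> d * l" if x: "x \<in> {a'..b'}" for x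
  proof -
    have "norm ((poly p x - G x) - (poly p a' - G a')) \<le> d * norm (x - a')"
    proof (rule field_differentiable_bound[of "{a'..b'}" "\<lambda>x. poly p x - G x" "\<lambda>x. g x - G' x"])
      show "((\<lambda>x. poly p x - G x) has_field_derivative g z - G' z) (at z within {a'..b'})" for z
        by (rule has_field_derivative_at_within[OF DERIV_diff[OF dp dG]])
      show "norm (g z - G' z) \<le> d" if "z \<in> {a'..b'}" for z using g(2)[OF that] by simp
    qed (use x ab in auto)
    moreover have "G a' = 0" "poly p a' = 0" using W(3)[of a'] ab by (auto simp: G_def p_def)
    moreover have "d * \<bar>x - a'\<bar> \<le> d * l" using x dpos by (intro mult_left_mono) (auto simp: l_def)
    ultimately show ?thesis by simp
  qed
  define f where "f x = poly p x * B x" for x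
  define f' where "f' x = g x * B x + B' x * poly p x" for x
  have df: "(f has_real_derivative f' x) (at x)" for x unfolding f_def[abs_def] f'_def by (rule DERIV_mult[OF dp dB])
  have f0: "f x = 0" if "x \<notin> {a'..b'}" for x using B0[of x] that by (auto simp: f_def)
  have W0: "W x = 0" "W' x = 0" if "x \<notin> {a'..b'}" for x using W(3)[of x] W'0[of x] that ab by auto
  have WG: "W x = G x * B x" for x
    using Bpos[of x] W(3)[of x] ab by (cases "x \<in> {a'<..<b'}") (auto simp: G_def)
  have WG': "W' x = G' x * B x + B' x * G x" for x
  proof -
    have "(W has_real_derivative (G' x * B x + B' x * G x)) (at x)"
    proof -
      have "W = (\<lambda>x. G x * B x)" using WG by blast
      then show ?thesis using DERIV_mult[OF dG dB, of x] by simp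
    qed
    then show ?thesis using W(1) DERIV_unique by blast
  qed
  have r1: "\<bar>f x - W x\<bar> \<le> e" for x
  proof (cases "x \<in> {a'..b'}")
    case True
    have "\<bar>f x - W x\<bar> = \<bar>poly p x - G x\<bar> * B x"
      using Ble[of x] by (simp add: f_def WG left_diff_distrib[symmetric] abs_mult)
    also have "\<dots> \<le> (d * l) * 1" by (intro mult_mono pG True Ble) (use dpos l in auto)
    also have "\<dots> \<le> e" unfolding de[symmetric] using dpos l M by (simp add: algebra_simps)
    finally show ?thesis .
  qed (use f0 W0 e in auto)
  have r2: "\<bar>f' x - W' x\<bar> \<le> e" for x
  proof (cases "x \<in> {a'..b'}")
    case True
    have "f' x - W' x = (g x - G' x) * B x + B' x * (poly p x - G x)"
      by (simp add: f'_def WG' algebra_simps)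
    also have "\<bar>\<dots>\<bar> \<le> \<bar>g x - G' x\<bar> * B x + \<bar>B' x\<bar> * \<bar>poly p x - G x\<bar>"
      using abs_triangle_ineq[of "(g x - G' x) * B x" "B' x * (poly p x - G x)"] Ble[of x] by (simp add: abs_mult)
    also have "\<dots> \<le> d * 1 + M * (d * l)"
      using g(2)[OF True] by (intro add_mono mult_mono pG True Ble M) (use dpos l M in auto)
    also have "\<dots> \<le> e" unfolding de[symmetric] using dpos l M by (simp add: algebra_simps)
    finally show ?thesis .
  next
    case False
    have "f' x = 0" by (rule C1_bounded_support[where W=f and W'=f' and a=a' and b=b', OF df _ False]) (rule f0)
    then show ?thesis using W0[OF False] e by simp
  qed
  have "smooth1 f" unfolding f_def[abs_def] B_def by (rule smooth1_poly_flat)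
  from that[OF this df f0 r1 r2] show ?thesis .
qed

text \<open>Function and derivative are packed into one pair so that a whole sequence of
  approximants can be picked by \<open>choice\<close>.\<close>

definition smooth_approx ::
    "real \<Rightarrow> real \<Rightarrow> (real \<Rightarrow> real) \<Rightarrow> (real \<Rightarrow> real) \<Rightarrow> real \<Rightarrow> (real \<Rightarrow> real) \<times> (real \<Rightarrow> real) \<Rightarrow> bool" where
  "smooth_approx a b W W' e p \<longleftrightarrow> smooth1 (fst p) \<and> (\<forall>x. (fst p has_real_derivative snd p x) (at x)) \<and>
    (\<forall>x. x \<notin> {a..b} \<longrightarrow> fst p x = 0) \<and> (\<forall>x. \<bar>fst p x - W x\<bar> \<le> e) \<and> (\<forall>x. \<bar>snd p x - W' x\<bar> \<le> e)"

lemma smooth_approx_exists: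
  assumes W: "\<And>x. (W has_real_derivative W' x) (at x)" "continuous_on UNIV W'" "\<And>x. x \<notin> {a..b} \<Longrightarrow> W x = 0"
    and ab: "a' < a" "a \<le> b" "b < b'" and e: "0 < e"
  shows "\<exists>p. smooth_approx a' b' W W' e p"
proof (rule C1_smooth_approximation[OF W ab e])
  fix f f' assume "smooth1 f" "\<And>x. (f has_real_derivative f' x) (at x)" "\<And>x. x \<notin> {a'..b'} \<Longrightarrow> f x = 0"
    "\<And>x. \<bar>f x - W x\<bar> \<le> e" "\<And>x. \<bar>f' x - W' x\<bar> \<le> e"
  then show ?thesis unfolding smooth_approx_def by (intro exI[of _ "(f, f')"]) simp
qed

section \<open>Test functions in polar coordinates\<close>

text \<open>The radius enters through its logarithm because, in the coordinates angle and ln r, the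
  plane Laplacian is 1/r^2 times the flat one, so that products of one-variable functions
  separate.\<close>

definition polar_rect :: "real \<Rightarrow> real \<Rightarrow> real \<Rightarrow> real \<Rightarrow> (real \<times> real) set" where
  "polar_rect a b c d = {z. ang z \<in> {a..b} \<and> ln (norm z) \<in> {c..d}}"

lemma compact_polar_rect:
  assumes "0 < a" "b < 2 * pi"
  shows "compact (polar_rect a b c d)"
proof -
  have "polar_rect a b c d = (\<lambda>(r,t). (r * cos t, r * sin t)) ` ({exp c..exp d} \<times> {a..b})"
  proof (intro equalityI subsetI)
    fix z assume z: "z \<in> polar_rect a b c d"
    then have p: "norm z > 0" using assms ang_pos_nz[of z] by (auto simp: polar_rect_def)
    have "z = (norm z * cos (ang z), norm z * sin (ang z))"
      using polar_fst[of z] polar_snd[of z] by (simp add: prod_eq_iff)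
    moreover have "exp c \<le> norm z" "norm z \<le> exp d"
    proof -
      have "c \<le> ln (norm z)" "ln (norm z) \<le> d" using z by (auto simp: polar_rect_def)
      then have "exp c \<le> exp (ln (norm z))" "exp (ln (norm z)) \<le> exp d" by simp_all
      then show "exp c \<le> norm z" "norm z \<le> exp d" unfolding exp_ln[OF p] .
    qed
    ultimately show "z \<in> (\<lambda>(r,t). (r * cos t, r * sin t)) ` ({exp c..exp d} \<times> {a..b})"
      using z by (intro image_eqI[of _ _ "(norm z, ang z)"]) (auto simp: polar_rect_def)
  next
    fix z assume "z \<in> (\<lambda>(r,t). (r * cos t, r * sin t)) ` ({exp c..exp d} \<times> {a..b})"
    then obtain r t where rt: "z = (r * cos t, r * sin t)" "exp c \<le> r" "r \<le> exp d" "a \<le> t" "t \<le> b" by auto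
    have r: "r > 0" using rt(2) by (rule less_le_trans[OF exp_gt_zero])
    have "ang z = t" unfolding rt(1) by (rule ang_unique) (use rt r assms in auto)
    moreover have "norm z = r"
    proof -
      have "(norm z)\<^sup>2 = r\<^sup>2 * ((sin t)\<^sup>2 + (cos t)\<^sup>2)"
        unfolding norm_sq rt(1) fst_conv snd_conv by (simp only: power_mult_distrib algebra_simps)
      then have "(norm z)\<^sup>2 = r\<^sup>2" by simp
      then show ?thesis by (rule power2_eq_imp_eq) (use r in simp_all)
    qed
    moreover have "c \<le> ln r" using rt(2) r by (simp add: ln_ge_iff)
    moreover have "ln r \<le> d" using rt(3) r by (metis exp_gt_zero ln_exp ln_le_cancel_iff)
    ultimately show "z \<in> polar_rect a b c d" using rt by (auto simp: polar_rect_def)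
  qed
  moreover have "compact ({exp c..exp d} \<times> {a..b})" by (intro compact_Times compact_Icc)
  ultimately show ?thesis
    by (auto intro!: compact_continuous_image continuous_intros simp: case_prod_unfold)
qed

context
  fixes a b c d :: real
  assumes ab: "0 < a" "b < 2 * pi"
begin

lemma polar_rect_ang_pos: "z \<in> polar_rect a b c d \<Longrightarrow> 0 < ang z"
  using ab by (auto simp: polar_rect_def)

text \<open>The coordinates are differentiable off the cut, and the product vanishes off the compact
  rectangle; these two open sets cover the plane.\<close>

lemma C1_on_polar_product:
  fixes f f' g g' :: "real \<Rightarrow> real"
  assumes f: "\<And>x. (f has_real_derivative f' x) (at x)" "continuous_on UNIV f'" "\<And>x. x \<notin> {a..b} \<Longrightarrow> f x = 0"
    and g: "\<And>x. (g has_real_derivative g' x) (at x)" "continuous_on UNIV g'" "\<And>x. x \<notin> {c..d} \<Longrightarrow> g x = 0"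
  shows "C1_on UNIV (\<lambda>z. f (ang z) * g (ln (norm z)))
     (\<lambda>z. f' (ang z) * (- rad_y z) * g (ln (norm z)) + f (ang z) * (g' (ln (norm z)) * rad_x z))
     (\<lambda>z. f' (ang z) * rad_x z * g (ln (norm z)) + f (ang z) * (g' (ln (norm z)) * rad_y z))" (is "C1_on UNIV ?u ?ux ?uy")
proof (rule C1_on_locally)
  have f'0: "f' x = 0" if "x \<notin> {a..b}" for x by (rule C1_bounded_support[OF f(1,3) that])
  have g'0: "g' x = 0" if "x \<notin> {c..d}" for x by (rule C1_bounded_support[OF g(1,3) that])
  fix z :: "real \<times> real"
  have o: "open {z. 0 < ang z}" using open_ang[of UNIV] by simp
  have ok: "open (- polar_rect a b c d)" using compact_polar_rect[OF ab] by (simp add: compact_imp_closed open_Compl)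
  have p: "C1_on {z. 0 < ang z} ?u ?ux ?uy"
  proof (rule C1_on_mult)
    show "C1_on {z. 0 < ang z} (\<lambda>z. f (ang z)) (\<lambda>z. f' (ang z) * (- rad_y z)) (\<lambda>z. f' (ang z) * rad_x z)"
      by (rule C1_on_comp[OF C1_on_ang f(1)]) (rule continuous_on_subset[OF f(2)], simp)
    have "C1_on (-{0}) (\<lambda>z. g (ln (norm z))) (\<lambda>z. g' (ln (norm z)) * rad_x z) (\<lambda>z. g' (ln (norm z)) * rad_y z)"
      by (rule C1_on_comp[OF C1_on_lnr g(1)]) (rule continuous_on_subset[OF g(2)], simp)
    then show "C1_on {z. 0 < ang z} (\<lambda>z. g (ln (norm z))) (\<lambda>z. g' (ln (norm z)) * rad_x z) (\<lambda>z. g' (ln (norm z)) * rad_y z)"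
    proof (rule C1_on_subset)
      show "{z. 0 < ang z} \<subseteq> -{0}" using ang_pos_nz(1) by blast
    qed
  qed
  have q: "C1_on (- polar_rect a b c d) ?u ?ux ?uy"
  proof (rule C1_on_cong[OF C1_on_const[of _ 0] ok])
    fix w assume "w \<in> - polar_rect a b c d"
    then have "ang w \<notin> {a..b} \<or> ln (norm w) \<notin> {c..d}" by (auto simp: polar_rect_def)
    then show "?u w = 0" "?ux w = 0" "?uy w = 0"
      using f(3)[of "ang w"] f'0[of "ang w"] g(3)[of "ln (norm w)"] g'0[of "ln (norm w)"] by auto
  qed
  show "\<exists>N. open N \<and> z \<in> N \<and> C1_on N ?u ?ux ?uy"
  proof (cases "z \<in> polar_rect a b c d")
    case True
    then show ?thesis using p o polar_rect_ang_pos by (intro exI[of _ "{z. 0 < ang z}"]) simp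
  next
    case False
    then show ?thesis using q ok by (intro exI[of _ "- polar_rect a b c d"]) simp
  qed
qed

lemma grad_polar_product:
  "0 < ang z \<Longrightarrow> (F' * (- rad_y z) * G + F * (G' * rad_x z))\<^sup>2 + (F' * rad_x z * G + F * (G' * rad_y z))\<^sup>2
     = (F'\<^sup>2 * G\<^sup>2 + F\<^sup>2 * G'\<^sup>2) / (norm z)\<^sup>2"
proof -
  assume "0 < ang z"
  then have "z \<noteq> 0" by (rule ang_pos_nz)
  have "(F' * (- rad_y z) * G + F * (G' * rad_x z))\<^sup>2 + (F' * rad_x z * G + F * (G' * rad_y z))\<^sup>2
      = (F'\<^sup>2 * G\<^sup>2 + F\<^sup>2 * G'\<^sup>2) * ((rad_x z)\<^sup>2 + (rad_y z)\<^sup>2)"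
    by (simp only: power2_eq_square) (simp add: algebra_simps)
  then show ?thesis using rad_sq[OF \<open>z \<noteq> 0\<close>] by simp
qed

text \<open>The invariant behind smoothness in the plane: a partial derivative multiplies the
  angular factor by sin or cos and the radial factor by exp (- ln r), so finite sums of supported
  products are closed under differentiation.\<close>

inductive polar_sum :: "(real \<times> real \<Rightarrow> real) \<Rightarrow> bool" where
  "smooth1 f \<Longrightarrow> smooth1 g \<Longrightarrow> (\<And>x. x \<notin> {a..b} \<Longrightarrow> f x = 0) \<Longrightarrow> (\<And>x. x \<notin> {c..d} \<Longrightarrow> g x = 0)
    \<Longrightarrow> polar_sum (\<lambda>z. f (ang z) * g (ln (norm z)))"
| "polar_sum u \<Longrightarrow> polar_sum v \<Longrightarrow> polar_sum (\<lambda>z. u z + v z)"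

lemma polar_sum_C1:
  "polar_sum u \<Longrightarrow> \<exists>ux uy. C1_on UNIV u ux uy \<and> polar_sum ux \<and> polar_sum uy"
proof (induction rule: polar_sum.induct)
  case (1 f g)
  obtain f' where f': "\<And>x. (f has_real_derivative f' x) (at x)" "smooth1 f'" using smooth1_D[OF 1(1)] by blast
  obtain g' where g': "\<And>x. (g has_real_derivative g' x) (at x)" "smooth1 g'" using smooth1_D[OF 1(2)] by blast
  have f'0: "f' x = 0" if "x \<notin> {a..b}" for x by (rule C1_bounded_support[OF f'(1) 1(3) that])
  have g'0: "g' x = 0" if "x \<notin> {c..d}" for x by (rule C1_bounded_support[OF g'(1) 1(4) that])
  have s: "smooth1 (\<lambda>x. sin x)" "smooth1 (\<lambda>x. - sin x)" "smooth1 (\<lambda>x. cos x)"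
    using smooth1_sin_cos[of 1 0] smooth1_sin_cos[of "-1" 0] smooth1_sin_cos[of 0 1] by simp_all
  let ?ux = "\<lambda>z. (f' (ang z) * - sin (ang z)) * (g (ln (norm z)) * exp (- ln (norm z)))
      + (f (ang z) * cos (ang z)) * (g' (ln (norm z)) * exp (- ln (norm z)))"
  let ?uy = "\<lambda>z. (f' (ang z) * cos (ang z)) * (g (ln (norm z)) * exp (- ln (norm z)))
      + (f (ang z) * sin (ang z)) * (g' (ln (norm z)) * exp (- ln (norm z)))"
  have P: "polar_sum (\<lambda>z. (F (ang z) * S (ang z)) * (G (ln (norm z)) * exp (- ln (norm z))))"
    if "smooth1 F" "smooth1 S" "smooth1 G" "\<And>x. x \<notin> {a..b} \<Longrightarrow> F x = 0" "\<And>x. x \<notin> {c..d} \<Longrightarrow> G x = 0" for F S G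
    using polar_sum.intros(1)[OF smooth1_mult[OF that(1,2)] smooth1_mult[OF that(3) smooth1_exp_uminus]] that(4,5) by simp
  have "polar_sum ?ux" "polar_sum ?uy"
    by (intro polar_sum.intros(2) P f'(2) g'(2) s 1 f'0 g'0; assumption)+
  moreover have "C1_on UNIV (\<lambda>z. f (ang z) * g (ln (norm z))) ?ux ?uy"
  proof (rule C1_on_cong[OF C1_on_polar_product[OF f'(1) smooth1_cont[OF f'(2)] 1(3) g'(1) smooth1_cont[OF g'(2)] 1(4)]])
    fix z :: "real \<times> real"
    show "?ux z = f' (ang z) * (- rad_y z) * g (ln (norm z)) + f (ang z) * (g' (ln (norm z)) * rad_x z)"
      "?uy z = f' (ang z) * rad_x z * g (ln (norm z)) + f (ang z) * (g' (ln (norm z)) * rad_y z)"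
    proof (atomize (full), cases "0 < ang z")
      case True
      then have "norm z > 0" by (rule ang_pos_nz)
      then have "exp (- ln (norm z)) = 1 / norm z" by (simp add: exp_minus divide_inverse)
      moreover have "rad_x z = cos (ang z) * (1 / norm z)" "rad_y z = sin (ang z) * (1 / norm z)"
        unfolding rad_x_def rad_y_def polar_fst[of z] polar_snd[of z] using \<open>norm z > 0\<close> by (simp_all add: power2_eq_square)
      ultimately show "?ux z = f' (ang z) * (- rad_y z) * g (ln (norm z)) + f (ang z) * (g' (ln (norm z)) * rad_x z) \<and>
        ?uy z = f' (ang z) * rad_x z * g (ln (norm z)) + f (ang z) * (g' (ln (norm z)) * rad_y z)"
        by (simp only:) (simp add: algebra_simps)
    next
      case False
      then have "ang z \<notin> {a..b}" using ab by auto
      then have "f (ang z) = 0" "f' (ang z) = 0" using 1(3) f'0 by auto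
      then show "?ux z = f' (ang z) * (- rad_y z) * g (ln (norm z)) + f (ang z) * (g' (ln (norm z)) * rad_x z) \<and>
        ?uy z = f' (ang z) * rad_x z * g (ln (norm z)) + f (ang z) * (g' (ln (norm z)) * rad_y z)"
        by simp
    qed
  qed auto
  ultimately show ?case by blast
next
  case (2 u v)
  then obtain ux uy vx vy where "C1_on UNIV u ux uy" "polar_sum ux" "polar_sum uy"
    "C1_on UNIV v vx vy" "polar_sum vx" "polar_sum vy" by blast
  then show ?case
    using C1_on_add polar_sum.intros(2)
    by (intro exI[of _ "\<lambda>z. ux z + vx z"] exI[of _ "\<lambda>z. uy z + vy z"]) simp
qed

lemma polar_sum_smooth: "polar_sum u \<Longrightarrow> smooth u"
proof (erule smooth_coinduct_pred)
  fix u assume "polar_sum u"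
  from polar_sum_C1[OF this] obtain ux uy where u: "C1_on UNIV u ux uy" "polar_sum ux" "polar_sum uy"
    by (elim exE conjE)
  have "u differentiable_on UNIV"
    using u(1) unfolding C1_on_def differentiable_on_def differentiable_def by blast
  moreover have "(\<lambda>z. frechet_derivative u (at z) (1,0)) = ux" "(\<lambda>z. frechet_derivative u (at z) (0,1)) = uy"
    using C1_on_frechet[OF u(1)] by (simp_all add: fun_eq_iff)
  then have "\<forall>i\<in>Basis. polar_sum (\<lambda>z. frechet_derivative u (at z) i)"
    using u(2,3) by (simp add: Basis_real_prod)
  ultimately show "u differentiable_on UNIV \<and> (\<forall>i\<in>Basis. polar_sum (\<lambda>z. frechet_derivative u (at z) i))" ..
qed

end

lemma compact_support_bounded:
  fixes f :: "real \<Rightarrow> real"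
  assumes "continuous_on UNIV f" "\<And>x. x \<notin> {a..b} \<Longrightarrow> f x = 0"
  obtains M where "M > 0" "\<And>x. \<bar>f x\<bar> \<le> M"
proof -
  have "compact (f ` {a..b})" by (intro compact_continuous_image continuous_on_subset[OF assms(1)]) auto
  then have "bounded (f ` {a..b})" by (rule compact_imp_bounded)
  then obtain B where B: "\<And>y. y \<in> f ` {a..b} \<Longrightarrow> norm y \<le> B"
    unfolding bounded_iff by blast
  have "\<bar>f x\<bar> \<le> max B 1" for x
    using B[of "f x"] assms(2)[of x] by (cases "x \<in> {a..b}") (simp_all add: le_max_iff_disj)
  then show ?thesis using that[of "max B 1"] by simp
qed

lemma integrable_box_const:
  "(\<lambda>z. if z \<in> cbox (-R,-R) (R,R) then C else 0 :: real) integrable_on (UNIV :: (real \<times> real) set)"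
  using integrable_restrict_UNIV[of "cbox (-R,-R) (R,R)" "\<lambda>_. C"] integrable_continuous[OF continuous_on_const] by blast

lemma tendsto_of_le_inverse_Suc:
  fixes f :: "nat \<Rightarrow> real"
  assumes "\<And>n. \<bar>f n - l\<bar> \<le> 1 / real (Suc n)"
  shows "f \<longlonglongrightarrow> l"
proof -
  have "(\<lambda>n. f n - l) \<longlonglongrightarrow> 0"
    by (rule Lim_null_comparison[OF _ lim_1_over_n[THEN LIMSEQ_Suc]])
      (use assms in \<open>simp add: always_eventually\<close>)
  then show ?thesis by (simp add: LIM_zero_iff)
qed

section \<open>The Hardy inequality for products in polar coordinates\<close>

definition polar_energy where
  "polar_energy f f' g g' z = ((f' (ang z))\<^sup>2 * (g (ln (norm z)))\<^sup>2 + (f (ang z))\<^sup>2 * (g' (ln (norm z)))\<^sup>2) / (norm z)\<^sup>2"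

definition polar_weight where
  "polar_weight \<beta> f g z = (f (ang z) * g (ln (norm z)))\<^sup>2 / (norm z * wD \<beta> (ang z))\<^sup>2"

context
  fixes \<beta> k a b c d :: real
  assumes be: "pi \<le> \<beta>" "\<beta> \<le> 2 * pi" and k: "0 \<le> k" and H: "hardy_ineq (Lambda \<beta>) k"
    and ab: "0 < a" "b < \<beta>"
begin

lemma polar_rect_sub_Lambda: "polar_rect a b c d \<subseteq> Lambda \<beta>"
  unfolding Lambda_eq[OF be(2)] polar_rect_def using ab by auto

lemma compact_rect: "compact (polar_rect a b c d)"
  by (rule compact_polar_rect) (use ab be in auto)

lemma open_Lam: "open (Lambda \<beta>)"
  by (rule open_Lambda[of "pi"]) (use be pi_gt_zero in auto)

lemma Lam_proper: "Lambda \<beta> \<noteq> UNIV"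
proof -
  have "0 \<notin> Lambda \<beta>" using Lambda_eq[OF be(2)] snd_zero_not_Lambda[of 0] by simp
  then show ?thesis by blast
qed

lemma continuous_on_polar_comp:
  assumes "continuous_on UNIV f"
  shows "continuous_on (Lambda \<beta>) (\<lambda>z. f (ang z))" "continuous_on (Lambda \<beta>) (\<lambda>z. f (ln (norm z)))"
proof -
  have "continuous_on (Lambda \<beta>) ang"
    by (rule continuous_on_subset[OF C1_on_cont[OF C1_on_ang]]) (use Lambda_eq[OF be(2)] in auto)
  then show "continuous_on (Lambda \<beta>) (\<lambda>z. f (ang z))"
    by (rule continuous_on_compose2[OF assms]) simp
  have "Lambda \<beta> \<subseteq> -{0}" using Lambda_eq[OF be(2)] ang_pos_nz(1) by blast
  then have "continuous_on (Lambda \<beta>) (\<lambda>z. ln (norm z))"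
    by (rule continuous_on_subset[OF C1_on_cont[OF C1_on_lnr]])
  then show "continuous_on (Lambda \<beta>) (\<lambda>z. f (ln (norm z)))"
    by (rule continuous_on_compose2[OF assms]) simp
qed

lemma norm_pos_Lam: "z \<in> Lambda \<beta> \<Longrightarrow> 0 < norm z"
  using Lambda_eq[OF be(2)] ang_pos_nz(2) by blast

lemma norm_wD_pos: "z \<in> Lambda \<beta> \<Longrightarrow> 0 < norm z * wD \<beta> (ang z)"
  using norm_pos_Lam wD_pos[OF be] Lambda_eq[OF be(2)] by simp

lemma polar_integrable:
  assumes c: "continuous_on UNIV f" "continuous_on UNIV f'" "continuous_on UNIV g" "continuous_on UNIV g'"
    and z: "\<And>x. x \<notin> {a..b} \<Longrightarrow> f x = 0" "\<And>x. x \<notin> {a..b} \<Longrightarrow> f' x = 0"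
      "\<And>x. x \<notin> {c..d} \<Longrightarrow> g x = 0" "\<And>x. x \<notin> {c..d} \<Longrightarrow> g' x = 0"
  shows "polar_energy f f' g g' integrable_on UNIV" "integral (Lambda \<beta>) (polar_energy f f' g g') = integral UNIV (polar_energy f f' g g')"
    "polar_weight \<beta> f g integrable_on UNIV"
    "z \<notin> polar_rect a b c d \<Longrightarrow> polar_energy f f' g g' z = 0"
    "z \<notin> polar_rect a b c d \<Longrightarrow> polar_weight \<beta> f g z = 0"
proof -
  have z1: "polar_energy f f' g g' z = 0" "polar_weight \<beta> f g z = 0" if "z \<notin> polar_rect a b c d" for z
  proof -
    have "ang z \<notin> {a..b} \<or> ln (norm z) \<notin> {c..d}" using that unfolding polar_rect_def by blast
    then show "polar_energy f f' g g' z = 0" "polar_weight \<beta> f g z = 0"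
      using z(1,2)[of "ang z"] z(3,4)[of "ln (norm z)"] unfolding polar_energy_def polar_weight_def by auto
  qed
  show "z \<notin> polar_rect a b c d \<Longrightarrow> polar_energy f f' g g' z = 0"
    "z \<notin> polar_rect a b c d \<Longrightarrow> polar_weight \<beta> f g z = 0" using z1 by blast+
  have nz: "\<forall>z\<in>Lambda \<beta>. (norm z)\<^sup>2 \<noteq> 0" "\<forall>z\<in>Lambda \<beta>. (norm z * wD \<beta> (ang z))\<^sup>2 \<noteq> 0"
    using norm_pos_Lam norm_wD_pos by force+
  have c1: "continuous_on (Lambda \<beta>) (polar_energy f f' g g')" unfolding polar_energy_def[abs_def]
    by (intro continuous_on_divide continuous_on_add continuous_on_mult continuous_on_power continuous_on_norm continuous_on_id
        continuous_on_polar_comp c nz)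
  have c2: "continuous_on (Lambda \<beta>) (polar_weight \<beta> f g)" unfolding polar_weight_def[abs_def]
    by (intro continuous_on_divide continuous_on_mult continuous_on_power continuous_on_norm continuous_on_id
        continuous_on_polar_comp c continuous_wD[OF be] nz)
  note e = integrable_compact_support[OF open_Lam compact_rect polar_rect_sub_Lambda c1 z1(1)]
  show "polar_energy f f' g g' integrable_on UNIV" "integral (Lambda \<beta>) (polar_energy f f' g g') = integral UNIV (polar_energy f f' g g')"
    using e(1,2) by blast+
  show "polar_weight \<beta> f g integrable_on UNIV"
    using integrable_compact_support(1)[OF open_Lam compact_rect polar_rect_sub_Lambda c2 z1(2)] by blast
qed

text \<open>The product is a test function of the sector, and only an upper bound for the boundary
  distance enters: replacing \<open>bdist\<close> by \<open>norm z * wD\<close> can only lower the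
  weight.\<close>

lemma hardy_smooth_polar:
  assumes s: "smooth1 f" "smooth1 g" and f: "\<And>x. (f has_real_derivative f' x) (at x)" "continuous_on UNIV f'"
    and g: "\<And>x. (g has_real_derivative g' x) (at x)" "continuous_on UNIV g'"
    and z: "\<And>x. x \<notin> {a..b} \<Longrightarrow> f x = 0" "\<And>x. x \<notin> {c..d} \<Longrightarrow> g x = 0"
  shows "k * integral UNIV (polar_weight \<beta> f g) \<le> integral UNIV (polar_energy f f' g g')"
proof -
  let ?L = "Lambda \<beta>" and ?K = "polar_rect a b c d"
  define u where "u z = f (ang z) * g (ln (norm z))" for z
  have b2: "b < 2 * pi" using ab be by simp
  have f'0: "f' x = 0" if "x \<notin> {a..b}" for x by (rule C1_bounded_support[OF f(1) z(1) that])
  have g'0: "g' x = 0" if "x \<notin> {c..d}" for x by (rule C1_bounded_support[OF g(1) z(2) that])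
  note cs = DERIV_imp_continuous_on[OF f(1)] f(2) DERIV_imp_continuous_on[OF g(1)] g(2)
  note int = polar_integrable[OF cs z(1) f'0 z(2) g'0]
  have "polar_sum a b c d u" unfolding u_def[abs_def]
    by (rule polar_sum.intros(1)[OF ab(1) b2 s z])
  then have "smooth u" by (rule polar_sum_smooth[OF ab(1) b2])
  have u0: "u z = 0" if "z \<notin> ?K" for z
  proof -
    have "ang z \<notin> {a..b} \<or> ln (norm z) \<notin> {c..d}" using that unfolding polar_rect_def by blast
    then show ?thesis using z unfolding u_def by auto
  qed
  then have sup: "{x. u x \<noteq> 0} \<subseteq> ?K" by auto
  have cl: "closure {x. u x \<noteq> 0} \<subseteq> ?K"
    by (rule closure_minimal[OF sup]) (simp add: compact_rect compact_imp_closed)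
  have tu: "test_fun ?L u" unfolding test_fun_def
    using \<open>smooth u\<close> cl polar_rect_sub_Lambda bounded_subset[OF compact_imp_bounded[OF compact_rect] sup]
    by (simp add: compact_closure)
  have C: "C1_on UNIV u
     (\<lambda>z. f' (ang z) * (- rad_y z) * g (ln (norm z)) + f (ang z) * (g' (ln (norm z)) * rad_x z))
     (\<lambda>z. f' (ang z) * rad_x z * g (ln (norm z)) + f (ang z) * (g' (ln (norm z)) * rad_y z))"
    unfolding u_def[abs_def] by (rule C1_on_polar_product[OF ab(1) b2 f z(1) g z(2)])
  have gr: "grad_sq u = polar_energy f f' g g'"
  proof
    fix z
    have gz: "grad_sq u z = (f' (ang z) * (- rad_y z) * g (ln (norm z)) + f (ang z) * (g' (ln (norm z)) * rad_x z))\<^sup>2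
       + (f' (ang z) * rad_x z * g (ln (norm z)) + f (ang z) * (g' (ln (norm z)) * rad_y z))\<^sup>2"
      by (rule grad_sq_C1[OF C]) simp
    show "grad_sq u z = polar_energy f f' g g' z"
    proof (cases "0 < ang z")
      case True
      show ?thesis unfolding gz polar_energy_def by (rule grad_polar_product[OF ab(1) b2 True])
    next
      case False
      then have "ang z \<notin> {a..b}" using ab by auto
      then show ?thesis unfolding gz polar_energy_def using z(1) f'0 by simp
    qed
  qed
  let ?w = "\<lambda>z. (u z)\<^sup>2 / (bdist ?L z)\<^sup>2"
  have nz: "\<forall>z\<in>?L. (bdist ?L z)\<^sup>2 \<noteq> 0"
    using bdist_pos[OF open_Lam _ Lam_proper] by force
  have cw: "continuous_on ?L ?w"
    by (intro continuous_on_divide continuous_on_power continuous_on_bdist nz continuous_on_subset[OF C1_on_cont[OF C]] subset_UNIV)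
  have w0: "?w z = 0" if "z \<notin> ?K" for z using u0[OF that] by simp
  note iw = integrable_compact_support[OF open_Lam compact_rect polar_rect_sub_Lambda cw w0]
  have "integral UNIV (polar_weight \<beta> f g) \<le> integral UNIV ?w"
  proof (rule integral_le[OF int(3) iw(1)])
    fix z
    show "polar_weight \<beta> f g z \<le> ?w z"
    proof (cases "z \<in> ?K")
      case True
      then have zL: "z \<in> ?L" using polar_rect_sub_Lambda by blast
      have "0 < bdist ?L z" by (rule bdist_pos[OF open_Lam zL Lam_proper])
      moreover have "bdist ?L z \<le> norm z * wD \<beta> (ang z)" by (rule bdist_Lambda_le[OF be zL])
      ultimately have "0 < (bdist ?L z)\<^sup>2" "(bdist ?L z)\<^sup>2 \<le> (norm z * wD \<beta> (ang z))\<^sup>2"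
        by (simp, intro power_mono, simp_all)
      then show ?thesis unfolding polar_weight_def u_def by (intro divide_left_mono mult_pos_pos) auto
    next
      case False
      then show ?thesis using int(5) w0 by (metis order_refl)
    qed
  qed
  then have "k * integral UNIV (polar_weight \<beta> f g) \<le> k * integral UNIV ?w" using k by (rule mult_left_mono)
  also have "\<dots> = k * integral ?L ?w" using iw(2) by simp
  also have "\<dots> \<le> integral ?L (grad_sq u)" using H tu unfolding hardy_ineq_def by blast
  also have "\<dots> = integral UNIV (polar_energy f f' g g')" unfolding gr by (rule int(2))
  finally show ?thesis .
qed

end

text \<open>The truncated powers to be inserted are merely \<open>C^1\<close>. Their smooth
  approximants live on a slightly larger rectangle, still compact in the sector, and dominated
  convergence passes to the limit in both integrals.\<close>

lemma hardy_polar_product: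
  fixes W W' Z Z' :: "real \<Rightarrow> real"
  assumes be: "pi \<le> \<beta>" "\<beta> \<le> 2 * pi" and k: "0 \<le> k" and H: "hardy_ineq (Lambda \<beta>) k"
    and ab: "0 < a" "a \<le> b" "b < \<beta>" and cd: "c \<le> d"
    and W: "\<And>x. (W has_real_derivative W' x) (at x)" "continuous_on UNIV W'" "\<And>x. x \<notin> {a..b} \<Longrightarrow> W x = 0"
    and Z: "\<And>x. (Z has_real_derivative Z' x) (at x)" "continuous_on UNIV Z'" "\<And>x. x \<notin> {c..d} \<Longrightarrow> Z x = 0"
  shows "k * integral UNIV (polar_weight \<beta> W Z) \<le> integral UNIV (polar_energy W W' Z Z')"
proof -
  define a' b' c' d' where "a' = a / 2" and "b' = (b + \<beta>) / 2" and "c' = c - 1" and "d' = d + 1"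
  have ab': "0 < a'" "a' < a" "b < b'" "b' < \<beta>" and cd': "c' < c" "d < d'"
    using ab unfolding a'_def b'_def c'_def d'_def by auto
  have b2: "b' < 2 * pi" using ab' be by simp
  have e: "0 < 1 / real (Suc n)" for n by simp
  have "\<forall>n. \<exists>p. smooth_approx a' b' W W' (1 / real (Suc n)) p"
    by (intro allI smooth_approx_exists[OF W ab'(2) ab(2) ab'(3) e])
  from choice[OF this] obtain pf where pf: "\<forall>n. smooth_approx a' b' W W' (1 / real (Suc n)) (pf n)"
    by (elim exE)
  define f f' where "f n = fst (pf n)" and "f' n = snd (pf n)" for n
  have f: "smooth1 (f n)" "(f n has_real_derivative f' n x) (at x)"
    "x \<notin> {a'..b'} \<Longrightarrow> f n x = 0" "\<bar>f n x - W x\<bar> \<le> 1 / real (Suc n)" "\<bar>f' n x - W' x\<bar> \<le> 1 / real (Suc n)" for n x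
    using pf[rule_format, of n] unfolding f_def f'_def smooth_approx_def by blast+
  have "\<forall>n. \<exists>p. smooth_approx c' d' Z Z' (1 / real (Suc n)) p"
    by (intro allI smooth_approx_exists[OF Z cd'(1) cd cd'(2) e])
  from choice[OF this] obtain pg where pg: "\<forall>n. smooth_approx c' d' Z Z' (1 / real (Suc n)) (pg n)"
    by (elim exE)
  define g g' where "g n = fst (pg n)" and "g' n = snd (pg n)" for n
  have g: "smooth1 (g n)" "(g n has_real_derivative g' n x) (at x)"
    "x \<notin> {c'..d'} \<Longrightarrow> g n x = 0" "\<bar>g n x - Z x\<bar> \<le> 1 / real (Suc n)" "\<bar>g' n x - Z' x\<bar> \<le> 1 / real (Suc n)" for n x
    using pg[rule_format, of n] unfolding g_def g'_def smooth_approx_def by blast+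
  have f'0: "f' n x = 0" if "x \<notin> {a'..b'}" for n x by (rule C1_bounded_support[OF f(2,3) that])
  have g'0: "g' n x = 0" if "x \<notin> {c'..d'}" for n x by (rule C1_bounded_support[OF g(2,3) that])
  have cf': "continuous_on UNIV (f' n)" and cg': "continuous_on UNIV (g' n)" for n
  proof -
    obtain h where "\<forall>x. (f n has_real_derivative h x) (at x)" "smooth1 h" using smooth1_D[OF f(1)] by blast
    moreover from this have "h = f' n" using f(2) DERIV_unique by blast
    ultimately show "continuous_on UNIV (f' n)" using smooth1_cont by blast
    obtain h where "\<forall>x. (g n has_real_derivative h x) (at x)" "smooth1 h" using smooth1_D[OF g(1)] by blast
    moreover from this have "h = g' n" using g(2) DERIV_unique by blast
    ultimately show "continuous_on UNIV (g' n)" using smooth1_cont by blast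
  qed
  obtain M where M: "M > 0" "\<And>x. \<bar>W x\<bar> \<le> M" "\<And>x. \<bar>W' x\<bar> \<le> M" "\<And>x. \<bar>Z x\<bar> \<le> M" "\<And>x. \<bar>Z' x\<bar> \<le> M"
  proof -
    have W'0: "W' x = 0" if "x \<notin> {a..b}" for x by (rule C1_bounded_support[OF W(1,3) that])
    have Z'0: "Z' x = 0" if "x \<notin> {c..d}" for x by (rule C1_bounded_support[OF Z(1,3) that])
    obtain M1 where M1: "M1 > 0" "\<And>x. \<bar>W x\<bar> \<le> M1" using compact_support_bounded[OF DERIV_imp_continuous_on[OF W(1)] W(3)] by blast
    obtain M2 where M2: "M2 > 0" "\<And>x. \<bar>W' x\<bar> \<le> M2" using compact_support_bounded[OF W(2) W'0] by blast
    obtain M3 where M3: "M3 > 0" "\<And>x. \<bar>Z x\<bar> \<le> M3" using compact_support_bounded[OF DERIV_imp_continuous_on[OF Z(1)] Z(3)] by blast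
    obtain M4 where M4: "M4 > 0" "\<And>x. \<bar>Z' x\<bar> \<le> M4" using compact_support_bounded[OF Z(2) Z'0] by blast
    show ?thesis
    proof (rule that[of "M1 + M2 + M3 + M4"])
      fix x
      show "0 < M1 + M2 + M3 + M4" "\<bar>W x\<bar> \<le> M1 + M2 + M3 + M4" "\<bar>W' x\<bar> \<le> M1 + M2 + M3 + M4"
        "\<bar>Z x\<bar> \<le> M1 + M2 + M3 + M4" "\<bar>Z' x\<bar> \<le> M1 + M2 + M3 + M4"
        using M1(1) M2(1) M3(1) M4(1) M1(2)[of x] M2(2)[of x] M3(2)[of x] M4(2)[of x] by linarith+
    qed
  qed
  define N where "N = M + 1"
  have N: "\<bar>f n x\<bar> \<le> N" "\<bar>f' n x\<bar> \<le> N" "\<bar>g n x\<bar> \<le> N" "\<bar>g' n x\<bar> \<le> N" "N > 0" for n x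
  proof -
    have j: "1 / real (Suc n) \<le> 1" by simp
    have aux: "\<bar>x\<bar> \<le> N" if "\<bar>x - y\<bar> \<le> e" "e \<le> 1" "\<bar>y\<bar> \<le> M" for x y e :: real
      using that unfolding N_def by linarith
    show "\<bar>f n x\<bar> \<le> N" by (rule aux[OF f(4) j M(2)])
    show "\<bar>f' n x\<bar> \<le> N" by (rule aux[OF f(5) j M(3)])
    show "\<bar>g n x\<bar> \<le> N" by (rule aux[OF g(4) j M(4)])
    show "\<bar>g' n x\<bar> \<le> N" by (rule aux[OF g(5) j M(5)])
    show "N > 0" using M(1) by (simp add: N_def)
  qed
  obtain m where m: "m > 0" "\<And>t. t \<in> {a'..b'} \<Longrightarrow> m \<le> wD \<beta> t"
  proof -
    have "\<exists>t\<in>{a'..b'}. \<forall>s\<in>{a'..b'}. wD \<beta> t \<le> wD \<beta> s"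
      by (rule continuous_attains_inf) (use ab ab' continuous_on_subset[OF continuous_wD[OF be]] in auto)
    then obtain t where t: "t \<in> {a'..b'}" "\<And>s. s \<in> {a'..b'} \<Longrightarrow> wD \<beta> t \<le> wD \<beta> s" by blast
    show ?thesis by (rule that[of "wD \<beta> t"]) (use t wD_pos[OF be, of t] ab' in auto)
  qed
  let ?K = "polar_rect a' b' c' d'"
  \<comment> \<open>A common bound for both integrands on the rectangle: there the radius is at
    least \<open>exp c'\<close> and \<open>wD\<close> at least \<open>m\<close>.\<close>
  define C where "C = (N\<^sup>2 * N\<^sup>2 + N\<^sup>2 * N\<^sup>2) / (exp c')\<^sup>2 + (N * N)\<^sup>2 / (exp c' * m)\<^sup>2"
  have cK: "compact ?K" by (rule compact_polar_rect[OF ab'(1) b2])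
  have "\<exists>R>0. \<forall>z. z \<notin> cbox (-R,-R) (R,R) \<longrightarrow> z \<notin> ?K"
    by (rule integrable_compact_support(3)[of UNIV ?K "\<lambda>_. 0"]) (use cK in simp_all)
  then obtain R where R: "\<And>z. z \<notin> cbox (-R,-R) (R,R) \<Longrightarrow> z \<notin> ?K" by blast
  let ?h = "\<lambda>z. if z \<in> cbox (-R,-R) (R,R) then C else 0"
  have cont: "continuous_on UNIV (f n)" "continuous_on UNIV (g n)" for n
    by (rule DERIV_imp_continuous_on[OF f(2)] DERIV_imp_continuous_on[OF g(2)])+
  have pI: "polar_energy (f n) (f' n) (g n) (g' n) integrable_on UNIV" "polar_weight \<beta> (f n) (g n) integrable_on UNIV"
    "z \<notin> ?K \<Longrightarrow> polar_energy (f n) (f' n) (g n) (g' n) z = 0" "z \<notin> ?K \<Longrightarrow> polar_weight \<beta> (f n) (g n) z = 0" for n z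
  proof -
    note P = polar_integrable[OF be k H ab'(1,4) cont(1)[of n] cf'[of n] cont(2)[of n] cg'[of n], where c=c' and d=d']
    show "polar_energy (f n) (f' n) (g n) (g' n) integrable_on UNIV"
      by (rule P(1)) (erule f(3) f'0 g(3) g'0)+
    show "polar_weight \<beta> (f n) (g n) integrable_on UNIV"
      by (rule P(3)) (erule f(3) f'0 g(3) g'0)+
    show "z \<notin> ?K \<Longrightarrow> polar_energy (f n) (f' n) (g n) (g' n) z = 0"
      by (rule P(4)) (erule f(3) f'0 g(3) g'0 | assumption)+
    show "z \<notin> ?K \<Longrightarrow> polar_weight \<beta> (f n) (g n) z = 0"
      by (rule P(5)) (erule f(3) f'0 g(3) g'0 | assumption)+
  qed
  have Cpos: "0 \<le> C" unfolding C_def by (intro add_nonneg_nonneg divide_nonneg_nonneg mult_nonneg_nonneg) simp_all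
  have bnd: "norm (polar_energy (f n) (f' n) (g n) (g' n) z) \<le> ?h z \<and> norm (polar_weight \<beta> (f n) (g n) z) \<le> ?h z" for n z
  proof (cases "z \<in> ?K")
    case False
    have "polar_energy (f n) (f' n) (g n) (g' n) z = 0" "polar_weight \<beta> (f n) (g n) z = 0"
      by (rule pI(3)[OF False] pI(4)[OF False])+
    then show ?thesis using Cpos by simp
  next
    case True
    then have zb: "z \<in> cbox (-R,-R) (R,R)" using R by blast
    have t: "ang z \<in> {a'..b'}" "c' \<le> ln (norm z)" using True unfolding polar_rect_def by auto
    have nz: "norm z > 0" by (rule ang_pos_nz) (use t ab' in auto)
    have "exp c' \<le> exp (ln (norm z))" using t by simp
    then have en: "exp c' \<le> norm z" unfolding exp_ln[OF nz] .
    have sq: "(x::real)\<^sup>2 \<le> N\<^sup>2" if "\<bar>x\<bar> \<le> N" for x using that N(5) by (simp add: abs_le_square_iff[symmetric])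
    have A: "\<bar>polar_energy (f n) (f' n) (g n) (g' n) z\<bar> \<le> (N\<^sup>2 * N\<^sup>2 + N\<^sup>2 * N\<^sup>2) / (exp c')\<^sup>2"
    proof -
      have "polar_energy (f n) (f' n) (g n) (g' n) z \<le> (N\<^sup>2 * N\<^sup>2 + N\<^sup>2 * N\<^sup>2) / (exp c')\<^sup>2"
        unfolding polar_energy_def
        by (intro frac_le add_mono mult_mono sq N power_mono en add_nonneg_nonneg mult_nonneg_nonneg) simp_all
      moreover have "0 \<le> polar_energy (f n) (f' n) (g n) (g' n) z" unfolding polar_energy_def
        by (intro divide_nonneg_nonneg add_nonneg_nonneg mult_nonneg_nonneg) simp_all
      ultimately show ?thesis by simp
    qed
    have B: "\<bar>polar_weight \<beta> (f n) (g n) z\<bar> \<le> (N * N)\<^sup>2 / (exp c' * m)\<^sup>2"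
    proof -
      have "\<bar>f n (ang z) * g n (ln (norm z))\<bar> \<le> N * N" unfolding abs_mult by (intro mult_mono N) (use N(5) in simp_all)
      then have "(f n (ang z) * g n (ln (norm z)))\<^sup>2 \<le> (N * N)\<^sup>2" using N(5) by (simp add: abs_le_square_iff[symmetric])
      moreover have "(exp c' * m)\<^sup>2 \<le> (norm z * wD \<beta> (ang z))\<^sup>2"
        by (intro power_mono mult_mono en m(2) t) (use m nz in simp_all)
      moreover have "0 < (exp c' * m)\<^sup>2" using m by simp
      ultimately have "polar_weight \<beta> (f n) (g n) z \<le> (N * N)\<^sup>2 / (exp c' * m)\<^sup>2"
        unfolding polar_weight_def by (intro frac_le) simp_all
      moreover have "0 \<le> polar_weight \<beta> (f n) (g n) z" unfolding polar_weight_def by simp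
      ultimately show ?thesis by simp
    qed
    have "0 \<le> (N\<^sup>2 * N\<^sup>2 + N\<^sup>2 * N\<^sup>2) / (exp c')\<^sup>2" "0 \<le> (N * N)\<^sup>2 / (exp c' * m)\<^sup>2" by simp_all
    then show ?thesis using A B unfolding C_def real_norm_def if_P[OF zb] by (intro conjI) linarith+
  qed
  have lim: "(\<lambda>n. f n x) \<longlonglongrightarrow> W x" "(\<lambda>n. f' n x) \<longlonglongrightarrow> W' x" "(\<lambda>n. g n x) \<longlonglongrightarrow> Z x" "(\<lambda>n. g' n x) \<longlonglongrightarrow> Z' x" for x
    by (rule tendsto_of_le_inverse_Suc, rule f g)+
  have l1: "(\<lambda>n. integral UNIV (polar_energy (f n) (f' n) (g n) (g' n))) \<longlonglongrightarrow> integral UNIV (polar_energy W W' Z Z')"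
  proof (rule dominated_convergence(2)[OF pI(1) integrable_box_const])
    show "norm (polar_energy (f n) (f' n) (g n) (g' n) z) \<le> ?h z" for n z using bnd by blast
    show "(\<lambda>n. polar_energy (f n) (f' n) (g n) (g' n) z) \<longlonglongrightarrow> polar_energy W W' Z Z' z" for z
      unfolding polar_energy_def divide_inverse by (intro tendsto_intros lim)
  qed
  have l2: "(\<lambda>n. integral UNIV (polar_weight \<beta> (f n) (g n))) \<longlonglongrightarrow> integral UNIV (polar_weight \<beta> W Z)"
  proof (rule dominated_convergence(2)[OF pI(2) integrable_box_const])
    show "norm (polar_weight \<beta> (f n) (g n) z) \<le> ?h z" for n z using bnd by blast
    show "(\<lambda>n. polar_weight \<beta> (f n) (g n) z) \<longlonglongrightarrow> polar_weight \<beta> W Z z" for z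
      unfolding polar_weight_def divide_inverse by (intro tendsto_intros lim)
  qed
  have "k * integral UNIV (polar_weight \<beta> (f n) (g n)) \<le> integral UNIV (polar_energy (f n) (f' n) (g n) (g' n))" for n
    by (rule hardy_smooth_polar[OF be k H ab'(1,4) f(1) g(1) f(2) cf' g(2) cg' f(3) g(3)])
  then show ?thesis by (intro LIMSEQ_le[OF tendsto_mult_left[OF l2] l1]) blast
qed

text \<open>Integration by parts in polar coordinates without a change of variables: the integrands
  are the divergences of \<open>P\<close> times the gradient of the angle and of \<open>P\<close>
  times the gradient of ln r, and both gradients are divergence free.\<close>

lemma polar_divergence:
  fixes f f' g g' :: "real \<Rightarrow> real"
  assumes ab: "0 < a" "b < 2 * pi"
    and f: "\<And>x. (f has_real_derivative f' x) (at x)" "continuous_on UNIV f'" "\<And>x. x \<notin> {a..b} \<Longrightarrow> f x = 0"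
    and g: "\<And>x. (g has_real_derivative g' x) (at x)" "continuous_on UNIV g'" "\<And>x. x \<notin> {c..d} \<Longrightarrow> g x = 0"
  shows "((\<lambda>z. f' (ang z) * g (ln (norm z)) / (norm z)\<^sup>2) has_integral 0) UNIV"
    and "((\<lambda>z. f (ang z) * g' (ln (norm z)) / (norm z)\<^sup>2) has_integral 0) UNIV"
proof -
  let ?K = "polar_rect a b c d"
  define P where "P z = f (ang z) * g (ln (norm z))" for z
  define px where "px z = f' (ang z) * (- rad_y z) * g (ln (norm z)) + f (ang z) * (g' (ln (norm z)) * rad_x z)" for z
  define py where "py z = f' (ang z) * rad_x z * g (ln (norm z)) + f (ang z) * (g' (ln (norm z)) * rad_y z)" for z
  have f'0: "f' x = 0" if "x \<notin> {a..b}" for x by (rule C1_bounded_support[OF f(1,3) that])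
  have g'0: "g' x = 0" if "x \<notin> {c..d}" for x by (rule C1_bounded_support[OF g(1,3) that])
  have C: "C1_on UNIV P px py"
    unfolding P_def[abs_def] px_def[abs_def] py_def[abs_def] by (rule C1_on_polar_product[OF ab f g])
  have cK: "compact ?K" by (rule compact_polar_rect[OF ab])
  have ok: "open (- ?K)" using cK by (simp add: compact_imp_closed open_Compl)
  have o: "open (-{0::real\<times>real})" by (simp add: open_Compl)
  have z: "P z = 0 \<and> px z = 0 \<and> py z = 0" if "z \<notin> ?K" for z
  proof -
    have "ang z \<notin> {a..b} \<or> ln (norm z) \<notin> {c..d}" using that unfolding polar_rect_def by blast
    then show ?thesis using f(3)[of "ang z"] f'0[of "ang z"] g(3)[of "ln (norm z)"] g'0[of "ln (norm z)"]
      unfolding P_def px_def py_def by auto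
  qed
  have nK: "z \<noteq> 0" if "z \<in> ?K" for z
    using polar_rect_ang_pos[OF ab that] ang_pos_nz(1) by blast
  have prod: "C1_on UNIV (\<lambda>z. P z * R z) (\<lambda>z. px z * R z + P z * Rx z) (\<lambda>z. py z * R z + P z * Ry z)"
    if R: "C1_on (-{0}) R Rx Ry" for R Rx Ry
  proof (rule C1_on_locally)
    fix w
    show "\<exists>N. open N \<and> w \<in> N \<and> C1_on N (\<lambda>z. P z * R z) (\<lambda>z. px z * R z + P z * Rx z) (\<lambda>z. py z * R z + P z * Ry z)"
    proof (cases "w \<in> ?K")
      case True
      then show ?thesis
        using nK o C1_on_mult[OF C1_on_subset[OF C, of "-{0}"] R] by (intro exI[of _ "-{0}"]) simp
    next
      case False
      have "C1_on (- ?K) (\<lambda>z. P z * R z) (\<lambda>z. px z * R z + P z * Rx z) (\<lambda>z. py z * R z + P z * Ry z)"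
        by (rule C1_on_cong[OF C1_on_const[of _ 0] ok]) (use z in auto)
      then show ?thesis using False ok by (intro exI[of _ "- ?K"]) simp
    qed
  qed
  have zero: "P z * R = 0" if "z \<notin> ?K" for z R using z[OF that] by simp
  note X = partial_integral_zero[OF prod[OF C1_on_rad(1)] zero cK]
  note Y = partial_integral_zero[OF prod[OF C1_on_rad(2)] zero cK]
  \<comment> \<open>At the origin both sides are 0, because division by 0 yields 0.\<close>
  have fin: "F z * G z / (norm z)\<^sup>2 = F z * G z * ((rad_x z)\<^sup>2 + (rad_y z)\<^sup>2)" for F G and z :: "real \<times> real"
    by (cases "z = 0") (simp add: rad_x_def rad_y_def, simp add: rad_sq)
  have "((\<lambda>z. (py z * rad_x z + P z * (- 2 * rad_x z * rad_y z)) - (px z * rad_y z + P z * (- 2 * rad_x z * rad_y z))) has_integral (0 - 0)) UNIV"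
    by (rule has_integral_diff[OF X(2) Y(1)])
  moreover have "(py z * rad_x z + P z * (- 2 * rad_x z * rad_y z)) - (px z * rad_y z + P z * (- 2 * rad_x z * rad_y z))
      = f' (ang z) * g (ln (norm z)) / (norm z)\<^sup>2" for z
  proof -
    have "(py z * rad_x z + P z * (- 2 * rad_x z * rad_y z)) - (px z * rad_y z + P z * (- 2 * rad_x z * rad_y z))
      = f' (ang z) * g (ln (norm z)) * ((rad_x z)\<^sup>2 + (rad_y z)\<^sup>2)"
      unfolding px_def py_def power2_eq_square by (simp add: algebra_simps)
    then show ?thesis using fin[of "\<lambda>z. f' (ang z)" z "\<lambda>z. g (ln (norm z))"] by metis
  qed
  ultimately show "((\<lambda>z. f' (ang z) * g (ln (norm z)) / (norm z)\<^sup>2) has_integral 0) UNIV" by simp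
  have "((\<lambda>z. (px z * rad_x z + P z * ((rad_y z)\<^sup>2 - (rad_x z)\<^sup>2)) + (py z * rad_y z + P z * ((rad_x z)\<^sup>2 - (rad_y z)\<^sup>2))) has_integral (0 + 0)) UNIV"
    by (rule has_integral_add[OF X(1) Y(2)])
  moreover have "(px z * rad_x z + P z * ((rad_y z)\<^sup>2 - (rad_x z)\<^sup>2)) + (py z * rad_y z + P z * ((rad_x z)\<^sup>2 - (rad_y z)\<^sup>2))
      = f (ang z) * g' (ln (norm z)) / (norm z)\<^sup>2" for z
  proof -
    have "(px z * rad_x z + P z * ((rad_y z)\<^sup>2 - (rad_x z)\<^sup>2)) + (py z * rad_y z + P z * ((rad_x z)\<^sup>2 - (rad_y z)\<^sup>2))
      = f (ang z) * g' (ln (norm z)) * ((rad_x z)\<^sup>2 + (rad_y z)\<^sup>2)"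
      unfolding px_def py_def power2_eq_square by (simp add: algebra_simps)
    then show ?thesis using fin[of "\<lambda>z. f (ang z)" z "\<lambda>z. g' (ln (norm z))"] by metis
  qed
  ultimately show "((\<lambda>z. f (ang z) * g' (ln (norm z)) / (norm z)\<^sup>2) has_integral 0) UNIV" by simp
qed

section \<open>Positivity of the angular profile\<close>

definition pospow :: "real \<Rightarrow> real \<Rightarrow> real" where
  "pospow m x = (max x 0) powr m"

lemma pospow_0: "0 < m \<Longrightarrow> pospow m 0 = 0"
  by (simp add: pospow_def)

lemma pospow_mult: "pospow m x * pospow n x = pospow (m + n) x"
  by (simp add: pospow_def powr_add)

lemma pospow_mult_self: "0 < m \<Longrightarrow> pospow m x * x = pospow (m + 1) x"
  by (cases "x > 0") (simp_all add: pospow_def powr_add max_def)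

lemma continuous_pospow: "0 < m \<Longrightarrow> continuous_on UNIV (pospow m)"
  unfolding pospow_def[abs_def] by (intro continuous_on_powr' continuous_intros) auto

lemma pospow_deriv:
  assumes "1 < m"
  shows "(pospow m has_real_derivative m * pospow (m - 1) x) (at x)"
proof -
  consider "x > 0" | "x < 0" | "x = 0" by linarith
  then show ?thesis
  proof cases
    case 1
    have "((\<lambda>x. x powr m) has_real_derivative m * x powr (m - 1)) (at x)"
      by (rule has_real_derivative_powr[OF 1])
    then have "(pospow m has_real_derivative m * x powr (m - 1)) (at x)"
      by (rule has_field_derivative_transform_within_open[of _ _ _ "{0<..}"]) (use 1 in \<open>auto simp: pospow_def max_def\<close>)
    then show ?thesis using 1 by (simp add: pospow_def max_def)
  next
    case 2
    have "((\<lambda>x. 0) has_real_derivative 0) (at x)" by simp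
    then have "(pospow m has_real_derivative 0) (at x)"
      by (rule has_field_derivative_transform_within_open[of _ _ _ "{..<0}"]) (use 2 assms in \<open>auto simp: pospow_def max_def\<close>)
    then show ?thesis using 2 assms by (simp add: pospow_def max_def)
  next
    case 3
    have "((\<lambda>h. pospow (m - 1) h) \<longlongrightarrow> pospow (m - 1) 0) (at 0)"
      using continuous_pospow[of "m - 1"] assms by (simp add: continuous_on_def)
    then have "((\<lambda>h. pospow (m - 1) h) \<longlongrightarrow> 0) (at 0)" using assms by (simp add: pospow_0)
    moreover have "\<forall>\<^sub>F h in at 0. pospow (m - 1) h = (pospow m (0 + h) - pospow m 0) / h"
    proof -
      have "pospow (m - 1) h = (pospow m (0 + h) - pospow m 0) / h" if "h \<noteq> 0" for h
        using pospow_mult_self[of "m - 1" h] assms that by (simp add: pospow_0 field_simps)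
      then show ?thesis by (simp add: eventually_at_filter)
    qed
    ultimately have "((\<lambda>h. (pospow m (0 + h) - pospow m 0) / h) \<longlongrightarrow> 0) (at 0)"
      by (rule Lim_transform_eventually)
    then show ?thesis using 3 assms by (simp add: DERIV_def pospow_0)
  qed
qed

text \<open>A power above 1 of the positive part makes the truncation of \<open>v\<close> at two zeros continuously
  differentiable.\<close>

definition cut :: "real \<Rightarrow> real \<Rightarrow> (real \<Rightarrow> real) \<Rightarrow> real \<Rightarrow> real" where
  "cut l r h x = (if x \<le> l then 0 else if x \<le> r then h x else 0)"

lemma cut_outside: "h l = 0 \<Longrightarrow> x \<notin> {l..r} \<Longrightarrow> cut l r h x = 0"
  by (auto simp: cut_def)

lemma cut_deriv:
  assumes h: "\<And>x. (h has_real_derivative h' x) (at x)" and lr: "l \<le> r"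
    and z: "h l = 0" "h r = 0" "h' l = 0" "h' r = 0"
  shows "(cut l r h has_real_derivative cut l r h' x) (at x)"
proof -
  have i: "((\<lambda>x. if x \<le> r then h x else 0) has_real_derivative (if x \<le> r then h' x else 0)) (at x)" for x
    by (rule DERIV_If_le) (use h z in auto)
  show ?thesis unfolding cut_def[abs_def]
    by (rule DERIV_If_le) (use i z lr in auto)
qed

lemma continuous_cut:
  assumes "continuous_on UNIV h" "l \<le> r" "h l = 0" "h r = 0"
  shows "continuous_on UNIV (cut l r h)"
  unfolding cut_def[abs_def] by (intro continuous_If_le assms(1) continuous_on_const) (use assms in auto)

text \<open>With \<open>W\<close> the cut \<open>m\<close>-th power of a solution of \<open>v'' = q v\<close>, the derivative of
  \<open>W W'\<close> is \<open>(2m-1)/m W'\<^sup>2 + m q W\<^sup>2\<close>.\<close>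

lemma cut_power:
  assumes v: "\<And>x. (v has_real_derivative v1 x) (at x)" "\<And>x. (v1 has_real_derivative q x * v x) (at x)"
    and q: "continuous_on UNIV q" and lr: "l \<le> r" "v l = 0" "v r = 0" and m: "1 < m"
  defines "W \<equiv> cut l r (\<lambda>x. pospow m (v x))"
    and "W' \<equiv> cut l r (\<lambda>x. m * pospow (m - 1) (v x) * v1 x)"
    and "A \<equiv> cut l r (\<lambda>x. m * pospow (2*m - 1) (v x) * v1 x)"
    and "A' \<equiv> cut l r (\<lambda>x. (2*m-1)/m * (m * pospow (m - 1) (v x) * v1 x)\<^sup>2 + m * q x * (pospow m (v x))\<^sup>2)"
  shows "(W has_real_derivative W' x) (at x)" "continuous_on UNIV W'"
    "x \<notin> {l..r} \<Longrightarrow> W x = 0"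
    "(A has_real_derivative A' x) (at x)" "continuous_on UNIV A'" "x \<notin> {l..r} \<Longrightarrow> A x = 0"
    "A' x = (2*m-1)/m * (W' x)\<^sup>2 + m * (cut l r q x) * (W x)\<^sup>2"
    "((\<lambda>x. (W x)\<^sup>2) has_real_derivative 2 * A x) (at x)" "A x = W x * W' x"
proof -
  have cv: "continuous_on UNIV v" "continuous_on UNIV v1"
    by (rule DERIV_imp_continuous_on[OF v(1)] DERIV_imp_continuous_on[OF v(2)])+
  have cp: "continuous_on UNIV (\<lambda>x. pospow k (v x))" if "k > 0" for k
    by (rule continuous_on_compose2[OF continuous_pospow[OF that] cv(1)]) simp
  have p0: "pospow k (v l) = 0" "pospow k (v r) = 0" if "k > 0" for k using lr pospow_0 that by simp_all
  have dp: "((\<lambda>x. pospow k (v x)) has_real_derivative k * pospow (k - 1) (v x) * v1 x) (at x)" if "1 < k" for k x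
    by (rule DERIV_chain2[OF pospow_deriv[OF that] v(1)])
  show dW: "(W has_real_derivative W' x) (at x)" for x
    unfolding W_def W'_def by (rule cut_deriv) (use dp m lr p0 in auto)
  show "continuous_on UNIV W'" unfolding W'_def
    by (rule continuous_cut) (use cp cv m lr p0 in \<open>auto intro!: continuous_on_mult continuous_on_const\<close>)
  show "x \<notin> {l..r} \<Longrightarrow> W x = 0" unfolding W_def by (rule cut_outside) (use p0 m in auto)
  have dA: "((\<lambda>x. m * pospow (2*m - 1) (v x) * v1 x) has_real_derivative
      (2*m-1)/m * (m * pospow (m - 1) (v x) * v1 x)\<^sup>2 + m * q x * (pospow m (v x))\<^sup>2) (at x)" for x
  proof -
    have "((\<lambda>x. m * (pospow (2*m - 1) (v x) * v1 x)) has_real_derivative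
      m * (((2*m-1) * pospow (2*m - 1 - 1) (v x) * v1 x) * v1 x + (q x * v x) * pospow (2*m - 1) (v x))) (at x)"
      by (rule DERIV_cmult[OF DERIV_mult[OF dp v(2)]]) (use m in simp)
    moreover have "pospow (2*m - 1 - 1) (v x) = pospow (m - 1) (v x) * pospow (m - 1) (v x)"
      unfolding pospow_mult by (simp add: algebra_simps)
    moreover have "v x * pospow (2*m - 1) (v x) = pospow m (v x) * pospow m (v x)"
      using pospow_mult_self[of "2*m - 1" "v x"] m unfolding pospow_mult by (simp add: mult.commute)
    ultimately have "((\<lambda>x. m * (pospow (2*m - 1) (v x) * v1 x)) has_real_derivative
      m * (((2*m-1) * (pospow (m - 1) (v x) * pospow (m - 1) (v x)) * v1 x) * v1 x + q x * (pospow m (v x) * pospow m (v x)))) (at x)"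
      by (simp only: mult.assoc)
    moreover have "m * (((2*m-1) * (p * p) * s) * s + k * (w * w)) = (2*m-1)/m * (m * p * s)\<^sup>2 + m * k * w\<^sup>2" for p s k w
      using m by (simp add: power2_eq_square field_simps)
    ultimately show ?thesis by (simp only: mult.assoc)
  qed
  have cA': "continuous_on UNIV (\<lambda>x. (2*m-1)/m * (m * pospow (m - 1) (v x) * v1 x)\<^sup>2 + m * q x * (pospow m (v x))\<^sup>2)"
    using m by (intro continuous_on_add continuous_on_mult continuous_on_power continuous_on_const cp cv q) auto
  show "(A has_real_derivative A' x) (at x)"
    unfolding A_def A'_def by (rule cut_deriv[OF dA lr(1)]) (use p0 m in auto)
  show "continuous_on UNIV A'" unfolding A'_def by (rule continuous_cut[OF cA' lr(1)]) (use p0 m in auto)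
  show "x \<notin> {l..r} \<Longrightarrow> A x = 0" unfolding A_def by (rule cut_outside) (use p0 m in auto)
  show "A' x = (2*m-1)/m * (W' x)\<^sup>2 + m * (cut l r q x) * (W x)\<^sup>2"
    unfolding A'_def W'_def W_def cut_def by simp
  show AW: "A x = W x * W' x" for x
  proof -
    have "pospow (2*m - 1) (v x) = pospow m (v x) * pospow (m - 1) (v x)"
      unfolding pospow_mult by (simp add: algebra_simps)
    then show ?thesis unfolding A_def W_def W'_def cut_def by simp
  qed
  show "((\<lambda>x. (W x)\<^sup>2) has_real_derivative 2 * A x) (at x)"
    using DERIV_power[OF dW[of x], of 2] unfolding AW by (simp add: algebra_simps)
qed

text \<open>If the profile \<open>y\<close> had a zero, the positive part of \<open>y(\<theta>) cos(\<mu> ln r)\<close> raised to a power slightly above 1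
  would violate the Hardy inequality on the sector.\<close>

lemma no_nodal_interval:
  assumes be: "pi \<le> \<beta>" "\<beta> \<le> 2 * pi" and H: "hardy_ineq (Lambda \<beta>) c" and c: "0 < c'" "c' < c"
    and y: "\<And>x. (y has_real_derivative y1 x) (at x)" "\<And>x. (y1 has_real_derivative q x * y x) (at x)"
    and q: "continuous_on UNIV q" "\<And>x. l \<le> x \<Longrightarrow> x \<le> r \<Longrightarrow> q x = - c' / (wD \<beta> x)\<^sup>2"
    and lr: "0 < l" "l < r" "r < \<beta>" "y l = 0" "y r = 0" and pos: "l < t" "t < r" "0 < y t"
  shows False
proof -
  \<comment> \<open>The radial cosine raises the constant \<open>c'\<close> by
    \<open>\<mu>\<^sup>2\<close>. Half of the gap is spent on it, which leaves the constant
    \<open>(c + c') / 2\<close>.\<close>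
  define \<mu> where "\<mu> = sqrt ((c - c') / 2)"
  have mu: "\<mu> > 0" "\<mu>\<^sup>2 = (c - c') / 2" using c by (simp_all add: \<mu>_def)
  \<comment> \<open>The power \<open>m = 1 + s\<close> costs the factor
    \<open>\<kappa> = 1 + s\<^sup>2 / (1 + 2 * s)\<close>. As the loss is quadratic in
    \<open>s\<close>, this choice keeps it within half of the remaining gap.\<close>
  define s where "s = min 1 (sqrt ((c - c') / (2 * (c + c'))))"
  have s: "0 < s" "s \<le> 1" "s\<^sup>2 \<le> (c - c') / (2 * (c + c'))"
  proof -
    show "0 < s" "s \<le> 1" using c by (simp_all add: s_def)
    have "s \<le> sqrt ((c - c') / (2 * (c + c')))" by (simp add: s_def)
    then have "s\<^sup>2 \<le> (sqrt ((c - c') / (2 * (c + c'))))\<^sup>2" using \<open>0 < s\<close> by (intro power_mono) auto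
    also have "\<dots> = (c - c') / (2 * (c + c'))" by (rule real_sqrt_pow2) (use c in simp)
    finally show "s\<^sup>2 \<le> (c - c') / (2 * (c + c'))" .
  qed
  define m where "m = 1 + s"
  define \<kappa> where "\<kappa> = m\<^sup>2 / (2 * m - 1)"
  have m: "1 < m" using s by (simp add: m_def)
  have kap: "\<kappa> > 0" using m by (simp add: \<kappa>_def)
  have kapc: "\<kappa> * (c' + \<mu>\<^sup>2) < c"
  proof -
    have "\<kappa> = 1 + s\<^sup>2 / (1 + 2 * s)"
      unfolding \<kappa>_def m_def using s by (simp add: field_simps power2_eq_square)
    also have "s\<^sup>2 / (1 + 2 * s) \<le> s\<^sup>2 / 1" using s by (intro divide_left_mono) auto
    finally have "\<kappa> \<le> 1 + (c - c') / (2 * (c + c'))" using s(3) by simp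
    then have "\<kappa> * (c' + \<mu>\<^sup>2) \<le> (1 + (c - c') / (2 * (c + c'))) * (c' + \<mu>\<^sup>2)"
      using mu c by (intro mult_right_mono) auto
    also have "\<dots> = (c + c') / 2 + (c - c') / 4"
      unfolding mu(2) using c by (simp add: field_simps)
    also have "\<dots> < c" using c by (simp add: field_simps)
    finally show ?thesis .
  qed
  define z z1 where "z = (\<lambda>x. cos (\<mu> * x))" and "z1 = (\<lambda>x. - \<mu> * sin (\<mu> * x))"
  have dz: "(z has_real_derivative z1 x) (at x)" "(z1 has_real_derivative - \<mu>\<^sup>2 * z x) (at x)" for x
    unfolding z_def z1_def by (auto intro!: derivative_eq_intros simp: power2_eq_square)
  \<comment> \<open>The first zeros of the cosine on either side of 0 bound the support in ln
    r.\<close>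
  define L where "L = pi / (2 * \<mu>)"
  have L: "0 < L" "\<mu> * L = pi / 2" using mu by (simp_all add: L_def)
  have z0: "z (-L) = 0" "z L = 0" unfolding z_def by (simp_all add: L(2))
  have LL: "- L \<le> L" "l \<le> r" using L lr by auto
  note W = cut_power[OF y q(1) LL(2) lr(4,5) m]
  note Z = cut_power[OF dz continuous_on_const LL(1) z0 m]
  define W W' A A' where "W = cut l r (\<lambda>x. pospow m (y x))" and "W' = cut l r (\<lambda>x. m * pospow (m - 1) (y x) * y1 x)"
    and "A = cut l r (\<lambda>x. m * pospow (2*m - 1) (y x) * y1 x)"
    and "A' = cut l r (\<lambda>x. (2*m-1)/m * (m * pospow (m - 1) (y x) * y1 x)\<^sup>2 + m * q x * (pospow m (y x))\<^sup>2)"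
  define Z Z' B B' where "Z = cut (-L) L (\<lambda>x. pospow m (z x))" and "Z' = cut (-L) L (\<lambda>x. m * pospow (m - 1) (z x) * z1 x)"
    and "B = cut (-L) L (\<lambda>x. m * pospow (2*m - 1) (z x) * z1 x)"
    and "B' = cut (-L) L (\<lambda>x. (2*m-1)/m * (m * pospow (m - 1) (z x) * z1 x)\<^sup>2 + m * (- \<mu>\<^sup>2) * (pospow m (z x))\<^sup>2)"
  note W = W[folded W_def W'_def A_def A'_def]
  note Z = Z[folded Z_def Z'_def B_def B'_def]
  have r2: "r < 2 * pi" using lr be by simp
  have cW: "continuous_on UNIV (\<lambda>x. 2 * A x)" "continuous_on UNIV (\<lambda>x. 2 * B x)"
    using DERIV_imp_continuous_on[OF W(4)] DERIV_imp_continuous_on[OF Z(4)] by (auto intro: continuous_on_mult continuous_on_const)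
  have W20: "(W x)\<^sup>2 = 0" if "x \<notin> {l..r}" for x using W(3)[OF that] by simp
  have Z20: "(Z x)\<^sup>2 = 0" if "x \<notin> {-L..L}" for x using Z(3)[OF that] by simp
  \<comment> \<open>\<open>A'\<close> and \<open>B'\<close> are derivatives of compactly supported
    functions, so these integrals vanish. By \<open>cut_power\<close> they exchange the squared
    derivatives in the energy for multiples of \<open>W\<^sup>2 Z\<^sup>2\<close>.\<close>
  have D1: "((\<lambda>x. A' (ang x) * (Z (ln (norm x)))\<^sup>2 / (norm x)\<^sup>2) has_integral 0) UNIV"
    by (rule polar_divergence(1)[OF lr(1) r2 W(4,5,6) Z(8) cW(2) Z20])
  have D2: "((\<lambda>x. (W (ang x))\<^sup>2 * B' (ln (norm x)) / (norm x)\<^sup>2) has_integral 0) UNIV"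
    by (rule polar_divergence(2)[OF lr(1) r2 W(8) cW(1) W20 Z(4,5,6)])
  have k: "0 \<le> c" using c by simp
  have W'0: "W' x = 0" if "x \<notin> {l..r}" for x by (rule C1_bounded_support[OF W(1,3) that])
  have Z'0: "Z' x = 0" if "x \<notin> {-L..L}" for x by (rule C1_bounded_support[OF Z(1,3) that])
  have LLL: "l \<le> r" using lr by simp
  have main: "c * integral UNIV (polar_weight \<beta> W Z) \<le> integral UNIV (polar_energy W W' Z Z')"
    by (rule hardy_polar_product[OF be k H lr(1) LLL lr(3) LL(1) W(1,2,3) Z(1,2,3)])
  note cc = DERIV_imp_continuous_on[OF W(1)] W(2) DERIV_imp_continuous_on[OF Z(1)] Z(2)
  have iE: "polar_energy W W' Z Z' integrable_on UNIV"
    by (rule polar_integrable(1)[OF be k H lr(1,3) cc]) (erule W(3) W'0 Z(3) Z'0)+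
  have iJ: "polar_weight \<beta> W Z integrable_on UNIV"
    by (rule polar_integrable(3)[OF be k H lr(1,3) cc]) (erule W(3) W'0 Z(3) Z'0)+
  have le: "integral UNIV (polar_energy W W' Z Z') \<le> \<kappa> * (c' + \<mu>\<^sup>2) * integral UNIV (polar_weight \<beta> W Z)"
  proof -
    let ?d1 = "\<lambda>x. A' (ang x) * (Z (ln (norm x)))\<^sup>2 / (norm x)\<^sup>2"
    let ?d2 = "\<lambda>x. (W (ang x))\<^sup>2 * B' (ln (norm x)) / (norm x)\<^sup>2"
    have i: "((\<lambda>x. polar_energy W W' Z Z' x - (m / (2*m-1) * ?d1 x + m / (2*m-1) * ?d2 x)) has_integral
       (integral UNIV (polar_energy W W' Z Z') - (m / (2*m-1) * 0 + m / (2*m-1) * 0))) UNIV"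
      by (intro has_integral_diff has_integral_add has_integral_mult_right D1 D2 integrable_integral iE)
    have j: "((\<lambda>x. \<kappa> * (c' + \<mu>\<^sup>2) * polar_weight \<beta> W Z x) has_integral (\<kappa> * (c' + \<mu>\<^sup>2) * integral UNIV (polar_weight \<beta> W Z))) UNIV"
      by (intro has_integral_mult_right integrable_integral iJ)
    have "polar_energy W W' Z Z' x - (m / (2*m-1) * ?d1 x + m / (2*m-1) * ?d2 x) \<le> \<kappa> * (c' + \<mu>\<^sup>2) * polar_weight \<beta> W Z x" for x
    proof -
      define w w' v v' where "w = W (ang x)" and "w' = W' (ang x)" and "v = Z (ln (norm x))" and "v' = Z' (ln (norm x))"
      define Q where "Q = cut l r q (ang x)"
      define S where "S = cut (-L) L (\<lambda>_. - \<mu>\<^sup>2) (ln (norm x))"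
      have A': "A' (ang x) = (2*m-1)/m * w'\<^sup>2 + m * Q * w\<^sup>2" unfolding w_def w'_def Q_def by (rule W(7))
      have B': "B' (ln (norm x)) = (2*m-1)/m * v'\<^sup>2 + m * S * v\<^sup>2" unfolding v_def v'_def S_def by (rule Z(7))
      have mm: "m / (2*m-1) * ((2*m-1)/m * a + m * b * e) = a + \<kappa> * b * e" for a b e
        using m by (simp add: \<kappa>_def field_simps power2_eq_square)
      have "polar_energy W W' Z Z' x - (m / (2*m-1) * ?d1 x + m / (2*m-1) * ?d2 x)
         = (w'\<^sup>2 * v\<^sup>2 + w\<^sup>2 * v'\<^sup>2 - (m / (2*m-1) * ((2*m-1)/m * w'\<^sup>2 + m * Q * w\<^sup>2)) * v\<^sup>2
             - w\<^sup>2 * (m / (2*m-1) * ((2*m-1)/m * v'\<^sup>2 + m * S * v\<^sup>2))) / (norm x)\<^sup>2"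
        unfolding polar_energy_def A' B' w_def[symmetric] w'_def[symmetric] v_def[symmetric] v'_def[symmetric]
        by (simp add: diff_divide_distrib add_divide_distrib mult.assoc)
      also have "\<dots> = \<kappa> * (- Q - S) * (w * v)\<^sup>2 / (norm x)\<^sup>2"
        unfolding mm by (simp add: power_mult_distrib algebra_simps)
      also have "\<dots> \<le> \<kappa> * (c' + \<mu>\<^sup>2) * ((w * v)\<^sup>2 / (norm x * wD \<beta> (ang x))\<^sup>2)"
      proof (cases "w * v = 0")
        case True
        then show ?thesis by (simp only: zero_power2 mult_zero_right div_0 order_refl)
      next
        case False
        then have ax: "l < ang x" "ang x \<le> r" using W(3)[of "ang x"] unfolding w_def by (auto simp: W_def cut_def split: if_splits)
        have D: "0 < wD \<beta> (ang x)" "wD \<beta> (ang x) \<le> 1" using wD_pos[OF be, of "ang x"] wD_le_1[OF be] ax lr by auto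
        have Q: "- Q = c' / (wD \<beta> (ang x))\<^sup>2" using ax q(2)[of "ang x"] by (simp add: Q_def cut_def)
        \<comment> \<open>Since \<open>wD \<le> 1\<close>, the radial contribution
          \<open>\<mu>\<^sup>2\<close> can be absorbed into the Hardy weight.\<close>
        have D1: "1 \<le> 1 / (wD \<beta> (ang x))\<^sup>2" using D by (simp add: power_le_one)
        have "- S \<le> \<mu>\<^sup>2" unfolding S_def cut_def by simp
        also have "\<mu>\<^sup>2 = \<mu>\<^sup>2 * 1" by simp
        also have "\<dots> \<le> \<mu>\<^sup>2 * (1 / (wD \<beta> (ang x))\<^sup>2)" using D1 by (intro mult_left_mono) auto
        finally have "- Q - S \<le> (c' + \<mu>\<^sup>2) / (wD \<beta> (ang x))\<^sup>2" using Q by (simp add: add_divide_distrib)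
        then have "\<kappa> * (- Q - S) * (w * v)\<^sup>2 / (norm x)\<^sup>2 \<le> \<kappa> * ((c' + \<mu>\<^sup>2) / (wD \<beta> (ang x))\<^sup>2) * (w * v)\<^sup>2 / (norm x)\<^sup>2"
          using kap by (intro divide_right_mono mult_right_mono mult_left_mono) auto
        also have "\<dots> = \<kappa> * (c' + \<mu>\<^sup>2) * ((w * v)\<^sup>2 / (norm x * wD \<beta> (ang x))\<^sup>2)"
          by (simp add: power_mult_distrib)
        finally show ?thesis .
      qed
      finally show ?thesis unfolding polar_weight_def w_def v_def .
    qed
    from has_integral_le[OF i j this] show ?thesis by simp
  qed
  have "0 < integral UNIV (polar_weight \<beta> W Z)"
  proof -
    have nn: "0 \<le> polar_weight \<beta> W Z x" for x unfolding polar_weight_def by simp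
    have "0 \<le> integral UNIV (polar_weight \<beta> W Z)" by (rule integral_nonneg[OF iJ nn])
    moreover have "integral UNIV (polar_weight \<beta> W Z) \<noteq> 0"
    proof
      assume I0: "integral UNIV (polar_weight \<beta> W Z) = 0"
      \<comment> \<open>At radius 1 and angle \<open>t\<close> the radial factor is at its maximum
        and \<open>y\<close> is positive, so the continuous weight is positive there and cannot
        integrate to 0.\<close>
      define x0 where "x0 = (1 * cos t, 1 * sin t)"
      have ax: "ang x0 = t" unfolding x0_def by (rule ang_unique) (use pos lr be in auto)
      have nx: "norm x0 = 1" unfolding x0_def by (simp add: norm_prod_def)
      have xL: "x0 \<in> Lambda \<beta>" unfolding Lambda_eq[OF be(2)] using ax pos lr by simp
      have oL: "open (Lambda \<beta>)" by (rule open_Lam[OF be k H lr(1,3)])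
      obtain u v where uv: "cbox u v \<subseteq> Lambda \<beta>" "x0 \<in> box u v" "\<forall>i\<in>Basis. u \<bullet> i < v \<bullet> i"
        by (rule open_contains_cbox[OF oL xL])
      have cJ: "continuous_on (Lambda \<beta>) (polar_weight \<beta> W Z)"
      proof -
        have nz: "\<forall>z\<in>Lambda \<beta>. (norm z * wD \<beta> (ang z))\<^sup>2 \<noteq> 0"
          using norm_wD_pos[OF be k H lr(1,3)] by force
        show ?thesis unfolding polar_weight_def[abs_def]
          by (intro continuous_on_divide continuous_on_mult continuous_on_power continuous_on_norm continuous_on_id
            continuous_on_polar_comp[OF be k H lr(1,3)] cc(1,3) continuous_wD[OF be] nz)
      qed
      have iuv: "polar_weight \<beta> W Z integrable_on cbox u v" by (rule integrable_on_subcbox[OF iJ]) simp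
      have "integral (cbox u v) (polar_weight \<beta> W Z) \<le> integral UNIV (polar_weight \<beta> W Z)"
        by (rule integral_subset_le[OF _ iuv iJ]) (use nn in auto)
      moreover have "0 \<le> integral (cbox u v) (polar_weight \<beta> W Z)" by (rule integral_nonneg[OF iuv nn])
      ultimately have "integral (cbox u v) (polar_weight \<beta> W Z) = 0" using I0 by simp
      then have "(polar_weight \<beta> W Z has_integral 0) (cbox u v)" using integrable_integral[OF iuv] by simp
      then have "polar_weight \<beta> W Z x0 = 0"
        by (rule has_integral_0_cbox_imp_0[OF continuous_on_subset[OF cJ uv(1)] nn])
          (use uv(2) box_subset_cbox in auto)
      moreover have "polar_weight \<beta> W Z x0 > 0"
      proof -
        have "W t > 0" using pos by (simp add: W_def cut_def pospow_def)
        moreover have "Z 0 > 0" using L by (simp add: Z_def cut_def pospow_def z_def)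
        moreover have "wD \<beta> t > 0" using wD_pos[OF be] pos lr by simp
        ultimately show ?thesis unfolding polar_weight_def ax nx by simp
      qed
      ultimately show False by simp
    qed
    ultimately show ?thesis by simp
  qed
  then have "\<kappa> * (c' + \<mu>\<^sup>2) * integral UNIV (polar_weight \<beta> W Z) < c * integral UNIV (polar_weight \<beta> W Z)"
    using kapc by simp
  with main le show False by simp
qed

section \<open>Angular solutions and their logarithmic derivatives\<close>

lemma wD_ge_sin:
  assumes a: "0 < a" "a < pi/2" and t: "a \<le> t" "t \<le> \<beta> - a"
  shows "sin a \<le> wD \<beta> t"
proof -
  have mono: "sin a \<le> sin x" if "a \<le> x" "x \<le> pi/2" for x
    using that a by (intro sin_monotone_2pi_le) auto
  show ?thesis unfolding wD_def using mono[of t] mono[of "\<beta> - t"] t by auto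
qed

text \<open>A zero to the left of the middle and its mirror image would enclose the midpoint, where
  the solution equals 1; \<open>no_nodal_interval\<close> excludes this.\<close>

lemma angular_solution:
  assumes be: "pi \<le> \<beta>" "\<beta> \<le> 2 * pi" and H: "hardy_ineq (Lambda \<beta>) c" and c: "0 < c'" "c' < c"
    and a: "0 < a" "a < pi/2"
  obtains y y1 q where "\<And>x. (y has_real_derivative y1 x) (at x)" "\<And>x. (y1 has_real_derivative q x * y x) (at x)"
    "y1 (\<beta>/2) = 0" "\<And>x. y (\<beta> - x) = y x" "\<And>x. y1 (\<beta> - x) = - y1 x"
    "\<And>x. a \<le> x \<Longrightarrow> x \<le> \<beta> - a \<Longrightarrow> 0 < y x"
    "\<And>x. a \<le> x \<Longrightarrow> x \<le> \<beta> - a \<Longrightarrow> q x = - c' / (wD \<beta> x)\<^sup>2"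
proof -
  \<comment> \<open>Truncating \<open>wD\<close> at \<open>sin a\<close> from below makes the
    coefficient bounded and continuous on the whole line without changing it on
    \<open>[a, \<beta> - a]\<close>.\<close>
  define q where "q = (\<lambda>x. - c' / (max (wD \<beta> x) (sin a))\<^sup>2)"
  have sa: "sin a > 0" using a by (intro sin_gt_zero) auto
  have m0: "max (wD \<beta> x) (sin a) > 0" for x using sa by (simp add: less_max_iff_disj)
  have nz: "\<forall>x\<in>UNIV. (max (wD \<beta> x) (sin a))\<^sup>2 \<noteq> 0"
    using m0 by (metis less_irrefl power_not_zero)
  have qc: "continuous_on UNIV q" unfolding q_def
    by (intro continuous_on_divide continuous_on_const continuous_on_power continuous_on_max continuous_wD[OF be] nz)
  have qb: "\<bar>q x\<bar> \<le> c' / (sin a)\<^sup>2" for x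
  proof -
    have "(sin a)\<^sup>2 \<le> (max (wD \<beta> x) (sin a))\<^sup>2" using sa by (intro power_mono) auto
    moreover have "0 < (sin a)\<^sup>2" using sa by simp
    ultimately have "c' / (max (wD \<beta> x) (sin a))\<^sup>2 \<le> c' / (sin a)\<^sup>2" using c by (intro frac_le) auto
    then show ?thesis unfolding q_def using c by (simp add: abs_divide)
  qed
  have qs: "q (2 * (\<beta>/2) - x) = q x" for x unfolding q_def using wD_reflect[OF be, of x] by simp
  have qe: "q x = - c' / (wD \<beta> x)\<^sup>2" if "a \<le> x" "x \<le> \<beta> - a" for x
    using wD_ge_sin[OF a that] unfolding q_def by (simp add: max_def)
  obtain y y1 where y: "\<And>x. (y has_real_derivative y1 x) (at x)" "\<And>x. (y1 has_real_derivative q x * y x) (at x)"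
    "y (\<beta>/2) = 1" "y1 (\<beta>/2) = 0" and sym': "\<And>x. y (2 * (\<beta>/2) - x) = y x" "\<And>x. y1 (2 * (\<beta>/2) - x) = - y1 x"
    by (rule even_linear_ode_exists[OF qc qb qs]) blast
  have sym: "y (\<beta> - x) = y x" "y1 (\<beta> - x) = - y1 x" for x using sym'[of x] by simp_all
  have yc: "continuous_on S y" for S by (rule DERIV_imp_continuous_on[OF y(1)])
  have half: "0 < y x" if x: "a \<le> x" "x \<le> \<beta>/2" for x
  proof (rule ccontr)
    assume "\<not> 0 < y x"
    then have "y x \<le> 0" by simp
    let ?S = "{t \<in> {x..\<beta>/2}. y t = 0}"
    have "\<exists>t\<ge>x. t \<le> \<beta>/2 \<and> y t = 0" by (rule IVT'[OF \<open>y x \<le> 0\<close> _ x(2) yc]) (simp add: y(3))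
    then have ne: "?S \<noteq> {}" by auto
    have "compact ?S"
    proof -
      have "closed {t. y t = 0}" by (intro closed_Collect_eq yc continuous_on_const)
      moreover have "?S = {x..\<beta>/2} \<inter> {t. y t = 0}" by auto
      ultimately show ?thesis by (simp add: compact_Int_closed)
    qed
    then obtain l where l: "l \<in> ?S" "\<And>t. t \<in> ?S \<Longrightarrow> t \<le> l" using compact_attains_sup[OF _ ne] by blast
    have lx: "x \<le> l" "l \<le> \<beta>/2" "y l = 0" using l(1) by auto
    have "l \<noteq> \<beta>/2" using lx(3) y(3) by auto
    then have lb: "l < \<beta>/2" using lx by simp
    have yr: "y (\<beta> - l) = 0" using sym(1)[of l] lx by simp
    show False
    proof (rule no_nodal_interval[OF be H c y(1,2) qc])
      show "q s = - c' / (wD \<beta> s)\<^sup>2" if "l \<le> s" "s \<le> \<beta> - l" for s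
        by (rule qe) (use that lx x in auto)
      show "0 < l" "l < \<beta> - l" "\<beta> - l < \<beta>" "y l = 0" "y (\<beta> - l) = 0" "l < \<beta>/2" "\<beta>/2 < \<beta> - l" "0 < y (\<beta>/2)"
        using lx lb x a yr y(3) by auto
    qed
  qed
  have pos: "0 < y x" if "a \<le> x" "x \<le> \<beta> - a" for x
  proof (cases "x \<le> \<beta>/2")
    case True
    then show ?thesis using half that by simp
  next
    case False
    then have "0 < y (\<beta> - x)" using half[of "\<beta> - x"] that by simp
    then show ?thesis using sym by simp
  qed
  show ?thesis by (rule that[OF y(1,2,4) sym pos qe])
qed

text \<open>\<open>fB\<close> is the logarithmic derivative of the symmetric solution; \<open>fA\<close> that of the solution
  vanishing at \<open>a\<close>, obtained from the first one by reduction of order.\<close>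

lemma angular_profiles:
  assumes be: "pi \<le> \<beta>" "\<beta> \<le> 2 * pi" and H: "hardy_ineq (Lambda \<beta>) c" and c: "0 < c'" "c' < c"
    and a: "0 < a" "a < pi/2"
  obtains fB fA :: "real \<Rightarrow> real"
  where "\<And>t. a < t \<Longrightarrow> t < \<beta> - a \<Longrightarrow> (fB has_real_derivative - ((fB t)\<^sup>2 + c' / (wD \<beta> t)\<^sup>2)) (at t)"
    "\<And>t. fB (\<beta> - t) = - fB t"
    "\<And>t. a < t \<Longrightarrow> t \<le> \<beta>/2 \<Longrightarrow> 0 \<le> fB t"
    "\<And>t. pi/2 \<le> t \<Longrightarrow> t \<le> \<beta>/2 \<Longrightarrow> fB t * (pi/2) \<le> fB (pi/2) * (pi - t)"
    "\<And>t. pi/2 \<le> t \<Longrightarrow> t \<le> \<beta>/2 \<Longrightarrow> fB t \<le> fB (pi/2)"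
    "\<And>t. a < t \<Longrightarrow> t < pi/2 \<Longrightarrow> (fA has_real_derivative - ((fA t)\<^sup>2 + c' / (sin t)\<^sup>2)) (at t)"
    "\<And>s t. a < s \<Longrightarrow> s \<le> t \<Longrightarrow> t \<le> pi/2 \<Longrightarrow> fB t * sin t \<le> fA s * sin s"
proof -
  obtain y y1 q where y: "\<And>x. (y has_real_derivative y1 x) (at x)" "\<And>x. (y1 has_real_derivative q x * y x) (at x)"
    "y1 (\<beta>/2) = 0" "\<And>x. y (\<beta> - x) = y x" "\<And>x. y1 (\<beta> - x) = - y1 x"
    and pos: "\<And>x. a \<le> x \<Longrightarrow> x \<le> \<beta> - a \<Longrightarrow> 0 < y x"
    and q: "\<And>x. a \<le> x \<Longrightarrow> x \<le> \<beta> - a \<Longrightarrow> q x = - c' / (wD \<beta> x)\<^sup>2"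
  proof (rule angular_solution[OF be H c a])
  qed (rule that, assumption+)
  define fB where "fB = (\<lambda>t. y1 t / y t)"
  have bl: "a < \<beta>/2" "pi/2 \<le> \<beta>/2" "\<beta>/2 < \<beta> - a" using a be by simp_all
  have dB: "(fB has_real_derivative - ((fB t)\<^sup>2 + c' / (wD \<beta> t)\<^sup>2)) (at t)" if t: "a \<le> t" "t \<le> \<beta> - a" for t
  proof -
    have "(fB has_real_derivative ((q t * y t) * y t - y1 t * y1 t) / (y t * y t)) (at t)"
      unfolding fB_def using DERIV_divide[OF y(2) y(1), of t] pos[OF t] by simp
    moreover have "((q t * y t) * y t - y1 t * y1 t) / (y t * y t) = q t - (fB t)\<^sup>2"
      using pos[OF t] unfolding fB_def by (simp add: power2_eq_square diff_divide_distrib)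
    moreover have "q t - (fB t)\<^sup>2 = - ((fB t)\<^sup>2 + c' / (wD \<beta> t)\<^sup>2)" using q[OF t] by simp
    ultimately show ?thesis by (simp only:)
  qed
  have fodd: "fB (\<beta> - t) = - fB t" for t unfolding fB_def using y(4,5)[of t] by simp
  have fmid: "fB (\<beta>/2) = 0" unfolding fB_def using y(3) by simp
  have dec: "fB t \<le> fB s" if "a \<le> s" "s \<le> t" "t \<le> \<beta> - a" for s t
  proof (rule DERIV_nonpos_imp_nonincreasing[OF that(2)])
    fix x assume "s \<le> x" "x \<le> t"
    then have "(fB has_real_derivative - ((fB x)\<^sup>2 + c' / (wD \<beta> x)\<^sup>2)) (at x)" using dB[of x] that by simp
    moreover have "0 \<le> (fB x)\<^sup>2 + c' / (wD \<beta> x)\<^sup>2" using c by (intro add_nonneg_nonneg divide_nonneg_nonneg) auto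
    ultimately show "\<exists>D. (fB has_real_derivative D) (at x) \<and> D \<le> 0"
      by (intro exI[of _ "- ((fB x)\<^sup>2 + c' / (wD \<beta> x)\<^sup>2)"]) simp
  qed
  have fB0: "0 \<le> fB t" if "a \<le> t" "t \<le> \<beta>/2" for t
    using dec[OF that] bl fmid by simp
  \<comment> \<open>\<open>fB t / (pi - t)\<close> is nonincreasing here. In this range
    \<open>fB' = - (fB\<^sup>2 + c')\<close>, \<open>fB\<close> decreases, and it vanishes at
    \<open>\<beta>/2 \<le> pi\<close>; the mean value theorem then gives
    \<open>fB x \<le> (pi - x) * ((fB x)\<^sup>2 + c')\<close>, which is the sign of the derivative
    of the quotient.\<close>
  have mid: "fB t * (pi/2) \<le> fB (pi/2) * (pi - t)" if t: "pi/2 \<le> t" "t \<le> \<beta>/2" for t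
  proof (cases "t = \<beta>/2")
    case True
    have "0 \<le> fB (pi/2)" using fB0[of "pi/2"] a bl by simp
    then show ?thesis unfolding True fmid using be by simp
  next
    case False
    then have tl: "t < \<beta>/2" using t by simp
    have "fB t / (pi - t) \<le> fB (pi/2) / (pi - pi/2)"
    proof (rule DERIV_nonpos_imp_nonincreasing[OF t(1), of "\<lambda>t. fB t / (pi - t)"])
      fix x assume x: "pi/2 \<le> x" "x \<le> t"
      then have xl: "x < \<beta>/2" "a \<le> x" using tl a by auto
      then have px: "0 < pi - x" using be by simp
      have V: "wD \<beta> s = 1" if "x \<le> s" "s \<le> \<beta>/2" for s
      proof (cases "s = pi/2")
        case True
        show ?thesis unfolding wD_def True by simp
      next
        case False
        then show ?thesis using that x be by (simp add: wD_def)
      qed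
      have d: "((\<lambda>t. fB t / (pi - t)) has_real_derivative
          ((- ((fB x)\<^sup>2 + c' / (wD \<beta> x)\<^sup>2)) * (pi - x) - fB x * (- 1)) / ((pi - x) * (pi - x))) (at x)"
      proof (rule DERIV_divide)
        show "(fB has_real_derivative - ((fB x)\<^sup>2 + c' / (wD \<beta> x)\<^sup>2)) (at x)" by (rule dB) (use xl bl in auto)
        show "((\<lambda>t. pi - t) has_real_derivative - 1) (at x)" by (auto intro!: derivative_eq_intros)
      qed (use px in simp)
      obtain w where w: "x < w" "w < \<beta>/2" "fB (\<beta>/2) - fB x = (\<beta>/2 - x) * (- ((fB w)\<^sup>2 + c' / (wD \<beta> w)\<^sup>2))"
      proof -
        have "\<exists>w>x. w < \<beta>/2 \<and> fB (\<beta>/2) - fB x = (\<beta>/2 - x) * (- ((fB w)\<^sup>2 + c' / (wD \<beta> w)\<^sup>2))"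
          by (rule MVT2[OF xl(1)]) (rule dB, use xl bl in auto)
        then show ?thesis using that by blast
      qed
      have "0 \<le> fB w" "fB w \<le> fB x" using fB0[of w] dec[of x w] w xl bl by auto
      then have sq: "(fB w)\<^sup>2 \<le> (fB x)\<^sup>2" by (intro power_mono)
      have "wD \<beta> w = 1" using V[of w] w by simp
      then have "fB x = (\<beta>/2 - x) * ((fB w)\<^sup>2 + c')" using w(3) unfolding fmid by (simp add: algebra_simps)
      also have "\<dots> \<le> (pi - x) * ((fB x)\<^sup>2 + c')" using sq be xl c by (intro mult_mono) auto
      finally have "(- ((fB x)\<^sup>2 + c' / (wD \<beta> x)\<^sup>2)) * (pi - x) - fB x * (- 1) \<le> 0"
        using V[of x] xl by (simp add: algebra_simps)
      then have "((- ((fB x)\<^sup>2 + c' / (wD \<beta> x)\<^sup>2)) * (pi - x) - fB x * (- 1)) / ((pi - x) * (pi - x)) \<le> 0"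
        using px by (intro divide_nonpos_pos mult_pos_pos)
      then show "\<exists>D. ((\<lambda>t. fB t / (pi - t)) has_real_derivative D) (at x) \<and> D \<le> 0" using d by blast
    qed
    then show ?thesis using tl be by (simp add: divide_simps mult.commute)
  qed
  define p where "p = (\<lambda>x. 1 / (y x)\<^sup>2)"
  have yc: "continuous_on S y" "continuous_on S y1" for S
    by (rule DERIV_imp_continuous_on[OF y(1)] DERIV_imp_continuous_on[OF y(2)])+
  have pc: "continuous_on {a..\<beta>-a} p" unfolding p_def
    by (intro continuous_on_divide continuous_on_const continuous_on_power yc) (use pos in force)
  define J where "J = (\<lambda>t. integral {a..t} p)"
  have dJw: "(J has_real_derivative p t) (at t within {a..\<beta>-a})" if "t \<in> {a..\<beta>-a}" for t
    unfolding J_def by (rule integral_has_real_derivative[OF pc that])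
  have dJ: "(J has_real_derivative p t) (at t)" if "a < t" "t < \<beta> - a" for t
    using dJw[of t] that by (simp add: at_within_Icc_at)
  have Jc: "continuous_on {a..\<beta>-a} J" by (rule DERIV_continuous_on[OF dJw])
  have J0: "J a = 0" unfolding J_def by simp
  have Jpos: "0 < J t" if t: "a < t" "t < \<beta> - a" for t
  proof -
    have "\<exists>l z. a < z \<and> z < t \<and> (J has_real_derivative l) (at z) \<and> J t - J a = (t - a) * l"
    proof (rule MVT[OF t(1)])
      show "continuous_on {a..t} J" by (rule continuous_on_subset[OF Jc]) (use t in auto)
      show "J differentiable (at x)" if "a < x" "x < t" for x
        using dJ[of x] that t unfolding real_differentiable_def by auto
    qed
    then obtain l z where z: "a < z" "z < t" "(J has_real_derivative l) (at z)" "J t - J a = (t - a) * l" by blast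
    have "l = p z" using DERIV_unique[OF z(3) dJ] z t by simp
    moreover have "p z > 0" unfolding p_def using pos[of z] z t by simp
    ultimately show ?thesis using z(4) t J0 by simp
  qed
  define u u1 where "u = (\<lambda>t. y t * J t)" and "u1 = (\<lambda>t. y1 t * J t + 1 / y t)"
  have du: "(u has_real_derivative u1 t) (at t)" if t: "a < t" "t < \<beta> - a" for t
  proof -
    have "(u has_real_derivative (y1 t * J t + p t * y t)) (at t)" unfolding u_def by (rule DERIV_mult[OF y(1) dJ[OF t]])
    moreover have "p t * y t = 1 / y t" unfolding p_def using pos[of t] t by (simp add: power2_eq_square)
    ultimately show ?thesis unfolding u1_def by simp
  qed
  have du1: "(u1 has_real_derivative q t * u t) (at t)" if t: "a < t" "t < \<beta> - a" for t
  proof -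
    have yp: "y t \<noteq> 0" using pos[of t] t by simp
    have "(u1 has_real_derivative ((q t * y t) * J t + p t * y1 t + (0 * y t - 1 * y1 t) / (y t * y t))) (at t)"
      unfolding u1_def
      by (rule DERIV_add[OF DERIV_mult[OF y(2) dJ[OF t]] DERIV_divide[OF DERIV_const y(1) yp]])
    moreover have "(q t * y t) * J t + p t * y1 t + (0 * y t - 1 * y1 t) / (y t * y t) = q t * u t"
      unfolding p_def u_def by (simp add: power2_eq_square)
    ultimately show ?thesis by simp
  qed
  have upos: "0 < u t" if "a < t" "t < \<beta> - a" for t
    unfolding u_def using pos[of t] Jpos[OF that] that by simp
  define fA where "fA = (\<lambda>t. u1 t / u t)"
  have pl: "pi/2 < \<beta> - a" using a be by simp
  have dA: "(fA has_real_derivative - ((fA t)\<^sup>2 + c' / (sin t)\<^sup>2)) (at t)" if t: "a < t" "t \<le> pi/2" for t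
  proof -
    have tb: "t < \<beta> - a" using t pl by simp
    have un: "u t \<noteq> 0" using upos[OF t(1) tb] by simp
    have "(fA has_real_derivative ((q t * u t) * u t - u1 t * u1 t) / (u t * u t)) (at t)"
      unfolding fA_def by (rule DERIV_divide[OF du1[OF t(1) tb] du[OF t(1) tb] un])
    moreover have "((q t * u t) * u t - u1 t * u1 t) / (u t * u t) = q t - (fA t)\<^sup>2"
      using un unfolding fA_def by (simp add: power2_eq_square diff_divide_distrib)
    moreover have "q t = - c' / (sin t)\<^sup>2" using q[of t] t tb by (simp add: wD_def)
    then have "q t - (fA t)\<^sup>2 = - ((fA t)\<^sup>2 + c' / (sin t)\<^sup>2)" by simp
    ultimately show ?thesis by (simp only:)
  qed
  \<comment> \<open>A solution vanishing at the left end has the larger logarithmic derivative: the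
    excess is \<open>1 / (y\<^sup>2 * J)\<close>.\<close>
  have fAB: "fB t \<le> fA t" if t: "a < t" "t \<le> pi/2" for t
  proof -
    have tb: "t < \<beta> - a" using t pl by simp
    have yp: "0 < y t" "0 < J t" using pos[of t] Jpos[OF t(1) tb] t tb by simp_all
    have "fA t = fB t + 1 / ((y t)\<^sup>2 * J t)"
      unfolding fA_def fB_def u1_def u_def using yp by (simp add: field_simps power2_eq_square)
    then show ?thesis using yp by simp
  qed
  \<comment> \<open>\<open>G\<close> is \<open>- u\<^sup>2\<close> times the derivative of
    \<open>fA * sin\<close>. The equation for \<open>u\<close> reduces the derivative of
    \<open>G\<close> to \<open>u * u1 * sin\<close>, which is nonnegative, and \<open>G\<close>
    starts nonnegative because \<open>u\<close> vanishes at \<open>a\<close>.\<close>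
  define G where "G = (\<lambda>t. (u1 t)\<^sup>2 * sin t - u t * u1 t * cos t + c' * (u t)\<^sup>2 / sin t)"
  have sp: "0 < sin t" if "a \<le> t" "t \<le> pi/2" for t using that a by (intro sin_gt_zero) auto
  have Gpos: "0 \<le> G t" if t: "a < t" "t \<le> pi/2" for t
  proof -
    have "G a \<le> G t"
    proof (rule DERIV_nonneg_imp_increasing_open[OF less_imp_le[OF t(1)]])
      fix x assume x: "a < x" "x < t"
      then have xb: "a < x" "x < \<beta> - a" "x \<le> pi/2" using t pl by auto
      have sx: "sin x \<noteq> 0" using sp[of x] xb by simp
      have d: "(G has_real_derivative ((of_nat 2 * ((q x * u x) * u1 x ^ (2 - Suc 0))) * sin x + cos x * (u1 x)\<^sup>2
          - ((u1 x * u1 x + (q x * u x) * u x) * cos x + (- sin x) * (u x * u1 x))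
          + ((c' * (of_nat 2 * (u1 x * u x ^ (2 - Suc 0)))) * sin x - c' * (u x)\<^sup>2 * cos x) / (sin x * sin x))) (at x)"
        unfolding G_def
        by (intro DERIV_add DERIV_diff DERIV_mult DERIV_divide DERIV_power DERIV_cmult DERIV_sin DERIV_cos du[OF xb(1,2)] du1[OF xb(1,2)] sx)
      have qx: "q x = - c' / (sin x)\<^sup>2" using q[of x] xb by (simp add: wD_def)
      have e: "(of_nat 2 * ((q x * u x) * u1 x ^ (2 - Suc 0))) * sin x + cos x * (u1 x)\<^sup>2
          - ((u1 x * u1 x + (q x * u x) * u x) * cos x + (- sin x) * (u x * u1 x))
          + ((c' * (of_nat 2 * (u1 x * u x ^ (2 - Suc 0)))) * sin x - c' * (u x)\<^sup>2 * cos x) / (sin x * sin x) = u x * u1 x * sin x"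
        unfolding qx using sx by (simp add: field_simps power2_eq_square)
      have "0 \<le> u x * u1 x * sin x"
      proof -
        have "0 \<le> y1 x"
          using fB0[of x] xb bl pos[of x] unfolding fB_def by (simp add: zero_le_divide_iff)
        then have "0 \<le> u1 x" unfolding u1_def using Jpos[OF xb(1,2)] pos[of x] xb by simp
        then show ?thesis using upos[OF xb(1,2)] sp[of x] xb by simp
      qed
      then show "\<exists>D. (G has_real_derivative D) (at x) \<and> 0 \<le> D" using d unfolding e by blast
    next
      have sub: "{a..t} \<subseteq> {a..\<beta>-a}" using t pl by auto
      have cJ: "continuous_on {a..t} J" by (rule continuous_on_subset[OF Jc sub])
      have ynz: "\<forall>x\<in>{a..t}. y x \<noteq> 0" using pos sub by force
      have snz: "\<forall>x\<in>{a..t}. sin x \<noteq> 0" using sp t by force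
      have cu: "continuous_on {a..t} u" "continuous_on {a..t} u1" unfolding u_def u1_def
        by (intro continuous_on_mult continuous_on_add continuous_on_divide continuous_on_const yc cJ ynz)+
      show "continuous_on {a..t} G" unfolding G_def
        by (intro continuous_on_mult continuous_on_add continuous_on_diff continuous_on_divide continuous_on_power
            continuous_on_const continuous_on_sin continuous_on_cos continuous_on_id cu snz)
    qed
    moreover have "0 \<le> G a"
    proof -
      have "u a = 0" unfolding u_def using J0 by simp
      then show ?thesis unfolding G_def using sp[of a] a by simp
    qed
    ultimately show ?thesis by simp
  qed
  have gdec: "fA t * sin t \<le> fA s * sin s" if st: "a < s" "s \<le> t" "t \<le> pi/2" for s t
  proof (rule DERIV_nonpos_imp_nonincreasing[OF st(2), of "\<lambda>t. fA t * sin t"])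
    fix x assume x: "s \<le> x" "x \<le> t"
    then have xb: "a < x" "x \<le> pi/2" "x < \<beta> - a" using st pl by auto
    have d: "((\<lambda>t. fA t * sin t) has_real_derivative ((- ((fA x)\<^sup>2 + c' / (sin x)\<^sup>2)) * sin x + cos x * fA x)) (at x)"
      by (rule DERIV_mult[OF dA[OF xb(1,2)] DERIV_sin])
    have ux: "u x > 0" "sin x > 0" using upos[OF xb(1,3)] sp[of x] xb by simp_all
    have "(- ((fA x)\<^sup>2 + c' / (sin x)\<^sup>2)) * sin x + cos x * fA x = - (G x / (u x)\<^sup>2)"
      unfolding fA_def G_def using ux by (simp add: field_simps power2_eq_square)
    also have "\<dots> \<le> 0" using Gpos[OF xb(1,2)] by simp
    finally show "\<exists>D. ((\<lambda>t. fA t * sin t) has_real_derivative D) (at x) \<and> D \<le> 0" using d by blast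
  qed
  show ?thesis
  proof (rule that[of fB fA])
    fix s t :: real assume st: "a < s" "s \<le> t" "t \<le> pi/2"
    have "fB t * sin t \<le> fA t * sin t" using fAB[of t] sp[of t] st by (intro mult_right_mono) auto
    also have "\<dots> \<le> fA s * sin s" by (rule gdec[OF st])
    finally show "fB t * sin t \<le> fA s * sin s" .
  qed (use dB fodd fB0 mid dA dec a bl in \<open>auto\<close>)
qed

section \<open>The flux across the interface\<close>

lemma cos_ge_of_abs_le: "\<bar>x\<bar> \<le> y \<Longrightarrow> y \<le> pi \<Longrightarrow> cos y \<le> cos x"
  using cos_monotone_0_pi_le[of "\<bar>x\<bar>" y] by simp

text \<open>Jordan's inequality, from the decrease of sin t / t; it is used for \<gamma>/2 in the
  middle range of the flux estimate.\<close>

lemma sin_ge_linear: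
  assumes "0 \<le> x" "x \<le> pi/2"
  shows "2 * x / pi \<le> sin x"
proof (cases "x = 0")
  case False
  then have x: "0 < x" using assms by simp
  have tan: "t * cos t \<le> sin t" if t: "0 \<le> t" "t \<le> pi/2" for t
  proof -
    have "sin 0 - 0 * cos 0 \<le> sin t - t * cos t"
    proof (rule DERIV_nonneg_imp_nondecreasing[OF t(1), of "\<lambda>t. sin t - t * cos t"])
      fix s assume s: "0 \<le> s" "s \<le> t"
      have "((\<lambda>t. sin t - t * cos t) has_real_derivative s * sin s) (at s)"
        by (auto intro!: derivative_eq_intros)
      moreover have "0 \<le> s * sin s" using s t by (intro mult_nonneg_nonneg sin_ge_zero) auto
      ultimately show "\<exists>D. ((\<lambda>t. sin t - t * cos t) has_real_derivative D) (at s) \<and> 0 \<le> D" by blast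
    qed
    then show ?thesis by simp
  qed
  have "sin (pi/2) / (pi/2) \<le> sin x / x"
  proof (rule DERIV_nonpos_imp_nonincreasing[OF assms(2), of "\<lambda>t. sin t / t"])
    fix t assume t: "x \<le> t" "t \<le> pi/2"
    then have t0: "0 < t" using x by simp
    have d: "((\<lambda>t. sin t / t) has_real_derivative (cos t * t - sin t * 1) / (t * t)) (at t)"
      by (rule DERIV_divide[OF DERIV_sin DERIV_ident]) (use t0 in simp)
    have "cos t * t - sin t * 1 \<le> 0" using tan[of t] t t0 by (simp add: mult.commute)
    then have "(cos t * t - sin t * 1) / (t * t) \<le> 0" using t0 by (intro divide_nonpos_pos) auto
    then show "\<exists>D. ((\<lambda>t. sin t / t) has_real_derivative D) (at t) \<and> D \<le> 0" using d by blast
  qed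
  then have "2 / pi * x \<le> sin x" using x by (simp add: pos_le_divide_eq)
  then show ?thesis by simp
qed simp

lemma le_of_sin_diff: "0 \<le> sin (x - y) \<Longrightarrow> - pi < x - y \<Longrightarrow> x - y < pi \<Longrightarrow> y \<le> (x::real)"
  using sin_less_zero[of "y - x"] sin_gt_zero[of "y - x"] sin_minus[of "x - y"]
  by (cases "y \<le> x") simp_all

text \<open>Here \<open>(r, \<theta>)\<close> are polar coordinates of a point about the vertex \<open>O\<close>, and \<open>(r', \<theta>')\<close> those
  about the image of \<open>O\<close> under the rotation about \<open>P\<close> that takes the line of \<open>L2\<close> to the line of \<open>L1\<close>.\<close>

lemma flux_nonneg:
  fixes \<beta> \<gamma> r \<theta> r' \<theta>' a :: real and fA fB :: "real \<Rightarrow> real"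
  defines "\<kappa> \<equiv> \<theta> - pi + \<gamma>"
  assumes bg: "0 < \<gamma>" "\<gamma> < pi" "pi \<le> \<beta>" "\<beta> \<le> 2 * pi"
    and r: "0 < r" "0 < r'" and th: "a < \<theta>" "\<theta> < \<beta> - a" and th': "a < \<theta>'" "\<theta>' < pi/2" and a: "0 < a" "a < pi/2"
    and X: "r' * cos \<theta>' = r * cos \<kappa> + cos \<gamma> + 1" and Y: "r' * sin \<theta>' = r * sin \<kappa> + sin \<gamma>"
    and p: "0 < r * cos \<kappa> + cos \<gamma>" and Yd: "r' * sin \<theta>' \<le> r * wD \<beta> \<theta>"
    and odd: "\<And>t. fB (\<beta> - t) = - fB t" and B0: "\<And>t. a < t \<Longrightarrow> t \<le> \<beta>/2 \<Longrightarrow> 0 \<le> fB t"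
    and Bmid: "\<And>t. pi/2 \<le> t \<Longrightarrow> t \<le> \<beta>/2 \<Longrightarrow> fB t * (pi/2) \<le> fB (pi/2) * (pi - t)"
      "\<And>t. pi/2 \<le> t \<Longrightarrow> t \<le> \<beta>/2 \<Longrightarrow> fB t \<le> fB (pi/2)"
    and AB: "\<And>s t. a < s \<Longrightarrow> s \<le> t \<Longrightarrow> t \<le> pi/2 \<Longrightarrow> fB t * sin t \<le> fA s * sin s"
  shows "0 \<le> fB \<theta> / r * (wD' \<beta> \<theta> - cos \<kappa>)
     + fA \<theta>' / r' * (cos \<theta>' + wD \<beta> \<theta> * sin (\<theta>' - \<kappa>) - wD' \<beta> \<theta> * cos (\<theta>' - \<kappa>))"
proof -
  have sg: "0 < sin \<gamma>" using bg by (intro sin_gt_zero) auto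
  have th'0: "0 < \<theta>'" "0 < \<theta>" using th' a th by auto
  have sc': "0 < sin \<theta>'" "0 < cos \<theta>'" using th' th'0 by (auto intro: sin_gt_zero cos_gt_zero)
  have Ypos: "0 < r' * sin \<theta>'" using sc' r by simp
  \<comment> \<open>\<open>fA / r'\<close> equals \<open>gA\<close> divided by
    \<open>r' * sin \<theta>'\<close>, the distance to the line of \<open>L1\<close>. In this form
    the bound \<open>AB\<close> on the profiles and the bound \<open>Yd\<close> on the distances can
    be applied separately.\<close>
  define gA where "gA = fA \<theta>' * sin \<theta>'"
  have gA0: "0 \<le> gA"
  proof -
    have "0 \<le> fB \<theta>' * sin \<theta>'" using B0[of \<theta>'] th' sc' bg by simp
    also have "\<dots> \<le> gA" unfolding gA_def using AB[of \<theta>' \<theta>'] th' by simp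
    finally show ?thesis .
  qed
  have fAg: "fA \<theta>' / r' = gA / (r' * sin \<theta>')" unfolding gA_def using sc' r by simp
  have fA0: "0 \<le> fA \<theta>' / r'" unfolding fAg using gA0 Ypos by simp
  have cg2: "0 < cos (\<gamma>/2)" using bg by (intro cos_gt_zero) auto
  have y: "r * sin \<theta> = (r * cos \<kappa> + cos \<gamma>) * sin \<gamma> - (r' * sin \<theta>') * cos \<gamma>"
  proof -
    have "(r * cos \<kappa> + cos \<gamma>) * sin \<gamma> - (r' * sin \<theta>') * cos \<gamma> = - (r * sin (\<kappa> - \<gamma>))"
      unfolding Y sin_diff by (simp add: algebra_simps)
    also have "sin (\<kappa> - \<gamma>) = - sin \<theta>" unfolding \<kappa>_def using sin_minus_pi[of \<theta>] by simp
    finally show ?thesis by simp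
  qed
  \<comment> \<open>By \<open>y\<close>, the height \<open>r * sin \<theta>\<close> is a combination
    of the two edge coordinates. As the first is positive and the second at most the sector
    distance, the point cannot lie far below the axis.\<close>
  have ylow: "- sin \<theta> < cos \<gamma> * wD \<beta> \<theta>" if "0 < cos \<gamma>"
  proof -
    have "- (r * sin \<theta>) < (r' * sin \<theta>') * cos \<gamma>" unfolding y using p sg by simp
    also have "\<dots> \<le> (r * wD \<beta> \<theta>) * cos \<gamma>" using Yd that by (intro mult_right_mono) auto
    finally have "r * (- sin \<theta>) < r * (cos \<gamma> * wD \<beta> \<theta>)" by (simp add: algebra_simps)
    then show ?thesis using r(1) by (simp only: mult_less_cancel_left_pos)
  qed
  have ypos: "0 < sin \<theta>" if "cos \<gamma> \<le> 0"
  proof -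
    have "0 < (r * cos \<kappa> + cos \<gamma>) * sin \<gamma>" using p sg by simp
    moreover have "(r' * sin \<theta>') * cos \<gamma> \<le> 0" using that Ypos by (intro mult_nonneg_nonpos) auto
    ultimately have "0 < r * sin \<theta>" unfolding y by linarith
    then show ?thesis using r by (simp add: zero_less_mult_iff)
  qed
  \<comment> \<open>In the frame of \<open>L1\<close>, the vector from the second centre to the
    point is \<open>r\<close> in direction \<kappa> plus \<open>2 * cos (\<gamma>/2)\<close> in
    direction \<open>\<gamma>/2\<close>. Hence \<open>\<theta>'\<close> lies between \<kappa> and
    \<open>\<gamma>/2\<close>; \<open>F2\<close> and \<open>F3\<close> are the lower bounds this
    gives in the two orders.\<close>
  have F2: "\<kappa> \<le> \<theta>'" if "\<kappa> \<le> \<gamma>/2"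
  proof (rule ccontr)
    assume "\<not> \<kappa> \<le> \<theta>'"
    then have k: "\<theta>' < \<kappa>" by simp
    have "r' * sin (\<theta>' - \<kappa>) = (r' * sin \<theta>') * cos \<kappa> - (r' * cos \<theta>') * sin \<kappa>" unfolding sin_diff by (simp add: algebra_simps)
    also have "\<dots> = sin (\<gamma> - \<kappa>) - sin \<kappa>" unfolding X Y sin_diff by (simp add: algebra_simps)
    also have "\<dots> = 2 * sin (\<gamma>/2 - \<kappa>) * cos (\<gamma>/2)"
      unfolding sin_diff_sin by (simp add: diff_divide_distrib)
    also have "\<dots> \<ge> 0" using cg2 k th'0 that bg by (intro mult_nonneg_nonneg) (auto intro: sin_ge_zero)
    finally have "0 \<le> sin (\<theta>' - \<kappa>)" using r by (simp add: zero_le_mult_iff)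
    then have "\<kappa> \<le> \<theta>'" by (rule le_of_sin_diff) (use k th'0 that bg in auto)
    then show False using k by simp
  qed
  have F3: "\<gamma>/2 \<le> \<theta>'" if "\<gamma>/2 \<le> \<kappa>" "\<kappa> - \<gamma>/2 \<le> pi"
  proof -
    have "r' * sin (\<theta>' - \<gamma>/2) = (r' * sin \<theta>') * cos (\<gamma>/2) - (r' * cos \<theta>') * sin (\<gamma>/2)"
      unfolding sin_diff by (simp add: algebra_simps)
    also have "\<dots> = r * sin (\<kappa> - \<gamma>/2) + sin (\<gamma> - \<gamma>/2) - sin (\<gamma>/2)" unfolding X Y sin_diff by (simp add: algebra_simps)
    also have "\<dots> = r * sin (\<kappa> - \<gamma>/2)" by simp
    also have "\<dots> \<ge> 0" using r that by (intro mult_nonneg_nonneg sin_ge_zero) auto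
    finally have "0 \<le> sin (\<theta>' - \<gamma>/2)" using r by (simp add: zero_le_mult_iff)
    then show ?thesis by (rule le_of_sin_diff) (use th' th'0 bg in auto)
  qed
  consider (1) "\<theta> \<le> pi/2" | (2) "pi/2 < \<theta>" "\<theta> \<le> \<beta> - pi/2" | (3) "pi/2 < \<theta>" "\<beta> - pi/2 < \<theta>" by linarith
  then show ?thesis
  proof cases
    case 1
    have D: "wD \<beta> \<theta> = sin \<theta>" "wD' \<beta> \<theta> = cos \<theta>" using 1 by (simp_all add: wD_def wD'_def)
    have st: "0 < sin \<theta>" "0 \<le> cos \<theta>" using 1 th'0 by (auto intro!: sin_gt_zero cos_ge_zero)
    have kg: "\<kappa> \<le> \<gamma>/2" unfolding \<kappa>_def using 1 bg by simp
    have kt: "\<kappa> \<le> \<theta>'" by (rule F2[OF kg])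
    \<comment> \<open>\<open>pp\<close>, \<open>Z\<close> and \<open>1 - x\<close>,
      \<open>yy\<close> are two sets of rectangular coordinates for the same distance to
      \<open>P\<close>. From \<open>Z \<le> yy\<close> follows
      \<open>\<bar>1 - x\<bar> \<le> pp\<close>, so the slope seen from the second centre is at most
      the slope seen from \<open>O\<close>.\<close>
    have le: "\<theta>' \<le> \<theta>"
    proof -
      define pp where "pp = r * cos \<kappa> + cos \<gamma>"
      define x where "x = r * cos \<theta>"
      define yy where "yy = r * sin \<theta>"
      define Z where "Z = r' * sin \<theta>'"
      have Zy: "Z \<le> yy" "0 < Z" using Yd Ypos unfolding D Z_def yy_def by auto
      have "cos \<theta> = - cos (\<kappa> - \<gamma>)" "sin \<theta> = - sin (\<kappa> - \<gamma>)"
        unfolding \<kappa>_def using cos_minus_pi[of \<theta>] sin_minus_pi[of \<theta>] by simp_all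
      then have cs: "cos \<theta> = - (cos \<kappa> * cos \<gamma> + sin \<kappa> * sin \<gamma>)" "sin \<theta> = - (sin \<kappa> * cos \<gamma> - cos \<kappa> * sin \<gamma>)"
        unfolding cos_diff sin_diff by simp_all
      have xy: "x = - (r * cos \<kappa> * cos \<gamma> + r * sin \<kappa> * sin \<gamma>)" "yy = - (r * sin \<kappa> * cos \<gamma> - r * cos \<kappa> * sin \<gamma>)"
        unfolding x_def yy_def cs by (simp_all add: algebra_simps)
      have n1: "(r * cos \<kappa>)\<^sup>2 + (r * sin \<kappa>)\<^sup>2 = x\<^sup>2 + yy\<^sup>2"
        unfolding x_def yy_def power_mult_distrib distrib_left[symmetric] by simp
      have n2: "(cos \<gamma>)\<^sup>2 + (sin \<gamma>)\<^sup>2 = 1" by simp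
      have "pp\<^sup>2 + Z\<^sup>2 = ((r * cos \<kappa>)\<^sup>2 + (r * sin \<kappa>)\<^sup>2) + ((cos \<gamma>)\<^sup>2 + (sin \<gamma>)\<^sup>2) - 2 * x"
        unfolding pp_def Z_def Y xy(1) by (simp add: power2_eq_square algebra_simps)
      then have "pp\<^sup>2 + Z\<^sup>2 = (1 - x)\<^sup>2 + yy\<^sup>2" unfolding n1 n2 by (simp add: power2_eq_square algebra_simps)
      moreover have "Z\<^sup>2 \<le> yy\<^sup>2" using Zy by (intro power_mono) auto
      ultimately have "(1 - x)\<^sup>2 \<le> pp\<^sup>2" by linarith
      then have "\<bar>1 - x\<bar> \<le> pp" using p unfolding pp_def[symmetric] by (simp add: abs_le_square_iff[symmetric])
      then have "x \<le> pp + 1" by linarith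
      then have "x * Z \<le> (pp + 1) * yy" using Zy st r p unfolding pp_def[symmetric]
        by (intro mult_mono) auto
      moreover have "r * r' * sin (\<theta> - \<theta>') = (r' * cos \<theta>') * yy - x * Z"
        unfolding sin_diff x_def yy_def Z_def by (simp add: algebra_simps)
      ultimately have nn: "0 \<le> r * r' * sin (\<theta> - \<theta>')" unfolding X pp_def[symmetric] by simp
      have "0 \<le> sin (\<theta> - \<theta>')"
      proof (rule ccontr)
        assume "\<not> 0 \<le> sin (\<theta> - \<theta>')"
        then have "r * r' * sin (\<theta> - \<theta>') < 0" using r by (intro mult_pos_neg mult_pos_pos) auto
        then show False using nn by simp
      qed
      then show ?thesis by (rule le_of_sin_diff) (use 1 th' th'0 in auto)
    qed
    have e1: "cos \<theta> - cos \<kappa> = 2 * cos (\<theta> + \<gamma>/2) * cos (\<gamma>/2)"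
    proof -
      have "cos \<kappa> = - cos (\<theta> + \<gamma>)" unfolding \<kappa>_def using cos_minus_pi[of "\<theta> + \<gamma>"] by (simp add: algebra_simps)
      then have "cos \<theta> - cos \<kappa> = cos (\<theta> + \<gamma>) + cos \<theta>" by simp
      also have "\<dots> = 2 * cos ((\<theta> + \<gamma> + \<theta>) / 2) * cos ((\<theta> + \<gamma> - \<theta>) / 2)" by (rule cos_plus_cos)
      also have "(\<theta> + \<gamma> + \<theta>) / 2 = \<theta> + \<gamma>/2" by simp
      finally show ?thesis by simp
    qed
    have e2: "cos \<theta>' + sin \<theta> * sin (\<theta>' - \<kappa>) - cos \<theta> * cos (\<theta>' - \<kappa>) = 2 * cos (\<theta>' - \<gamma>/2) * cos (\<gamma>/2)"
    proof -
      have "sin \<theta> * sin (\<theta>' - \<kappa>) - cos \<theta> * cos (\<theta>' - \<kappa>) = - cos (\<theta> + (\<theta>' - \<kappa>))" unfolding cos_add by simp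
      also have "\<theta> + (\<theta>' - \<kappa>) = (\<theta>' - \<gamma>) + pi" unfolding \<kappa>_def by simp
      also have "- cos ((\<theta>' - \<gamma>) + pi) = cos (\<theta>' - \<gamma>)" by simp
      finally have "cos \<theta>' + sin \<theta> * sin (\<theta>' - \<kappa>) - cos \<theta> * cos (\<theta>' - \<kappa>) = cos \<theta>' + cos (\<theta>' - \<gamma>)" by simp
      also have "\<dots> = 2 * cos ((\<theta>' + (\<theta>' - \<gamma>)) / 2) * cos ((\<theta>' - (\<theta>' - \<gamma>)) / 2)" by (rule cos_plus_cos)
      also have "(\<theta>' + (\<theta>' - \<gamma>)) / 2 = \<theta>' - \<gamma>/2" by (simp add: field_simps)
      finally show ?thesis by simp
    qed
    \<comment> \<open>The flux is \<open>2 * cos (\<gamma>/2)\<close> times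
      \<open>fB \<theta> / r * cB + fA \<theta>' / r' * cA\<close>. Only \<open>cB\<close> can be
      negative; it is at least \<open>- cA\<close>, and its coefficient is at most that of
      \<open>cA\<close>.\<close>
    define cA cB where "cA = cos (\<theta>' - \<gamma>/2)" and "cB = cos (\<theta> + \<gamma>/2)"
    have cA0: "0 \<le> cA" unfolding cA_def using th' th'0 bg by (intro cos_ge_zero) auto
    have cAB: "0 \<le> cB + cA"
    proof -
      have "cos (pi - (\<theta> + \<gamma>/2)) \<le> cA" unfolding cA_def
      proof (rule cos_ge_of_abs_le)
        have "\<theta>' - \<gamma>/2 \<le> pi - (\<theta> + \<gamma>/2)" using le 1 by simp
        moreover have "- (\<theta>' - \<gamma>/2) \<le> pi - (\<theta> + \<gamma>/2)" using kt unfolding \<kappa>_def by simp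
        ultimately show "\<bar>\<theta>' - \<gamma>/2\<bar> \<le> pi - (\<theta> + \<gamma>/2)" by (simp add: abs_le_iff)
        show "pi - (\<theta> + \<gamma>/2) \<le> pi" using th'0 bg by simp
      qed
      then show ?thesis unfolding cB_def by simp
    qed
    have gB: "0 \<le> fB \<theta> * sin \<theta>" "fB \<theta> * sin \<theta> \<le> gA"
      using B0[of \<theta>] th st 1 bg AB[of \<theta>' \<theta>] th' le unfolding gA_def by auto
    have fBg: "fB \<theta> / r = (fB \<theta> * sin \<theta>) / (r * sin \<theta>)" using st r by simp
    have "(fB \<theta> * sin \<theta>) / (r * sin \<theta>) \<le> gA / (r' * sin \<theta>')"
      using gB gA0 Yd Ypos unfolding D by (intro frac_le) auto
    then have "(fB \<theta> / r) * cA \<le> (fA \<theta>' / r') * cA" unfolding fBg fAg using cA0 by (rule mult_right_mono)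
    moreover have "0 \<le> (fB \<theta> / r) * (cB + cA)" using B0[of \<theta>] th 1 bg r cAB by (intro mult_nonneg_nonneg divide_nonneg_pos) auto
    ultimately have "0 \<le> (fB \<theta> / r) * cB + (fA \<theta>' / r') * cA" by (simp add: distrib_left)
    then have "0 \<le> 2 * cos (\<gamma>/2) * ((fB \<theta> / r) * cB + (fA \<theta>' / r') * cA)" using cg2 by simp
    then show ?thesis unfolding D e1 e2 cA_def cB_def by (simp add: algebra_simps)
  next
    case 2
    have D: "wD \<beta> \<theta> = 1" "wD' \<beta> \<theta> = 0" using 2 by (simp_all add: wD_def wD'_def)
    have kr: "- (pi/2) \<le> \<kappa>" "\<kappa> \<le> pi/2 + \<gamma>" unfolding \<kappa>_def using 2 bg by auto
    \<comment> \<open>If \<kappa> exceeded \<pi>/2, then \<open>p\<close> would force cos \<gamma> >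
      0, and the point would lie lower than \<open>ylow\<close> permits.\<close>
    have kp: "\<kappa> \<le> pi/2"
    proof (rule ccontr)
      assume "\<not> \<kappa> \<le> pi/2"
      then have k: "pi/2 < \<kappa>" by simp
      have "0 < cos (\<kappa> - pi)" using k kr bg by (intro cos_gt_zero_pi) auto
      then have "cos \<kappa> < 0" by simp
      then have "r * cos \<kappa> < 0" using r by (simp add: mult_less_0_iff)
      then have cg: "0 < cos \<gamma>" using p by simp
      have "cos \<gamma> = sin (pi/2 - \<gamma>)" by (simp add: sin_diff)
      also have "\<dots> \<le> sin (\<theta> - pi)"
        using k 2 bg unfolding \<kappa>_def by (intro sin_monotone_2pi_le) auto
      also have "\<dots> = - sin \<theta>" by simp
      also have "\<dots> < cos \<gamma>" using ylow[OF cg] D by simp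
      finally show False by simp
    qed
    have ck: "0 \<le> cos \<kappa>" using kr kp by (intro cos_ge_zero) auto
    have e: "cos \<theta>' + sin (\<theta>' - \<kappa>) = cos \<theta>' * (1 - sin \<kappa>) + sin \<theta>' * cos \<kappa>"
      unfolding sin_diff by (simp add: algebra_simps)
    have s1: "0 \<le> cos \<theta>' * (1 - sin \<kappa>)" "0 \<le> sin \<theta>' * cos \<kappa>" using sc' ck by simp_all
    have goal: "fB \<theta> / r * cos \<kappa> \<le> fA \<theta>' / r' * (cos \<theta>' + sin (\<theta>' - \<kappa>))"
    proof (cases "\<theta> \<le> \<beta>/2")
      case False
      have "0 \<le> fB (\<beta> - \<theta>)" by (rule B0) (use th False in auto)
      then have "fB \<theta> \<le> 0" using odd[of \<theta>] by simp
      then have "fB \<theta> / r * cos \<kappa> \<le> 0" using r ck by (intro mult_nonpos_nonneg divide_nonpos_pos) auto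
      also have "0 \<le> fA \<theta>' / r' * (cos \<theta>' + sin (\<theta>' - \<kappa>))" unfolding e using fA0 s1 by (intro mult_nonneg_nonneg) auto
      finally show ?thesis .
    next
      case True
      have fb: "0 \<le> fB \<theta>" using B0 th True by simp
      have gp: "fB (pi/2) \<le> gA" unfolding gA_def using AB[of \<theta>' "pi/2"] th' by simp
      \<comment> \<open>For \<open>\<kappa> \<le> \<gamma>/2\<close> the bracket is at least
        \<open>cos \<kappa>\<close>, and monotonicity of \<open>fB\<close> suffices. Beyond that
        only \<open>sin \<theta>' * cos \<kappa>\<close> is kept of it; the linear decay of
        \<open>fB\<close> towards \<pi> makes up for this, because
        \<open>pi - \<theta> \<le> \<gamma>/2 \<le> \<theta>'\<close>.\<close>
      have key: "fB \<theta> * cos \<kappa> \<le> gA * (cos \<theta>' + sin (\<theta>' - \<kappa>))"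
      proof (cases "\<kappa> \<le> \<gamma>/2")
        case kg: True
        have kt: "\<kappa> \<le> \<theta>'" by (rule F2[OF kg])
        have "cos \<kappa> - cos \<theta>' = 2 * sin ((\<kappa> + \<theta>')/2) * sin ((\<theta>' - \<kappa>)/2)" by (rule cos_diff_cos)
        moreover have "sin (\<theta>' - \<kappa>) = 2 * sin ((\<theta>' - \<kappa>)/2) * cos ((\<theta>' - \<kappa>)/2)"
        proof -
          have "2 * ((\<theta>' - \<kappa>)/2) = \<theta>' - \<kappa>" by simp
          then show ?thesis using sin_double[of "(\<theta>' - \<kappa>)/2"] by metis
        qed
        moreover have "sin ((\<kappa> + \<theta>')/2) \<le> cos ((\<theta>' - \<kappa>)/2)"
        proof -
          have "sin ((\<kappa> + \<theta>')/2) = cos (pi/2 - (\<kappa> + \<theta>')/2)" by (simp add: cos_diff)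
          also have "\<dots> \<le> cos ((\<theta>' - \<kappa>)/2)"
            using kt kr kp th' th'0 by (intro cos_monotone_0_pi_le) (auto simp: field_simps)
          finally show ?thesis .
        qed
        moreover have "0 \<le> 2 * sin ((\<theta>' - \<kappa>)/2)" using kt kr th' by (intro mult_nonneg_nonneg sin_ge_zero) auto
        ultimately have "cos \<kappa> - cos \<theta>' \<le> sin (\<theta>' - \<kappa>)"
          using mult_left_mono[of "sin ((\<kappa> + \<theta>')/2)" "cos ((\<theta>' - \<kappa>)/2)" "2 * sin ((\<theta>' - \<kappa>)/2)"] by (simp add: algebra_simps)
        then have "cos \<kappa> \<le> cos \<theta>' + sin (\<theta>' - \<kappa>)" by simp
        moreover have "fB \<theta> \<le> gA" using Bmid(2)[of \<theta>] 2 True gp by simp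
        ultimately show ?thesis using gA0 ck by (intro mult_mono) auto
      next
        case False
        then have kg: "\<gamma>/2 \<le> \<kappa>" by simp
        have t2: "\<gamma>/2 \<le> \<theta>'" by (rule F3[OF kg]) (use kp bg in auto)
        have pt: "pi - \<theta> \<le> \<gamma>/2" "0 \<le> pi - \<theta>" using kg True bg unfolding \<kappa>_def by auto
        have "2 * (\<gamma>/2) / pi \<le> sin (\<gamma>/2)" using bg by (intro sin_ge_linear) auto
        also have "\<dots> \<le> sin \<theta>'" using t2 th' bg by (intro sin_monotone_2pi_le) auto
        finally have "\<gamma> / pi \<le> sin \<theta>'" by simp
        then have "\<gamma>/2 \<le> sin \<theta>' * (pi/2)" by (simp add: pos_divide_le_eq)
        then have "pi - \<theta> \<le> sin \<theta>' * (pi/2)" using pt by simp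
        then have i3: "gA * (pi - \<theta>) \<le> gA * (sin \<theta>' * (pi/2))" using gA0 by (rule mult_left_mono)
        have i1: "fB \<theta> * (pi/2) \<le> fB (pi/2) * (pi - \<theta>)" by (rule Bmid(1)) (use 2 True in auto)
        have i2: "fB (pi/2) * (pi - \<theta>) \<le> gA * (pi - \<theta>)" using gp pt(2) by (rule mult_right_mono)
        have "fB \<theta> * (pi/2) \<le> (gA * sin \<theta>') * (pi/2)"
          unfolding mult.assoc[of gA] by (rule order_trans[OF i1 order_trans[OF i2 i3]])
        then have "fB \<theta> \<le> gA * sin \<theta>'" by (simp only: mult_le_cancel_right_pos pi_half_gt_zero)
        then have "fB \<theta> * cos \<kappa> \<le> (gA * sin \<theta>') * cos \<kappa>" using ck by (rule mult_right_mono)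
        also have "\<dots> \<le> gA * (cos \<theta>' + sin (\<theta>' - \<kappa>))"
          unfolding e using gA0 s1(1) by (simp add: distrib_left mult.assoc)
        finally show ?thesis .
      qed
      have "fB \<theta> / r * cos \<kappa> = (fB \<theta> * cos \<kappa>) / r" by simp
      also have "\<dots> \<le> (gA * (cos \<theta>' + sin (\<theta>' - \<kappa>))) / (r' * sin \<theta>')"
        using key Yd Ypos gA0 s1 unfolding D by (intro frac_le) (auto simp: e)
      also have "\<dots> = fA \<theta>' / r' * (cos \<theta>' + sin (\<theta>' - \<kappa>))" unfolding fAg by simp
      finally show ?thesis .
    qed
    show ?thesis unfolding D using goal by simp
  next
    case 3
    define \<eta> where "\<eta> = \<beta> - \<theta>"
    have eta: "0 < \<eta>" "\<eta> < pi/2" "a < \<eta>" unfolding \<eta>_def using 3 th a by auto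
    have D: "wD \<beta> \<theta> = sin \<eta>" "wD' \<beta> \<theta> = - cos \<eta>" using 3 by (simp_all add: wD_def wD'_def \<eta>_def)
    have fb: "fB \<theta> = - fB \<eta>" "0 \<le> fB \<eta>" using odd[of \<theta>] B0[of \<eta>] eta bg unfolding \<eta>_def by auto
    have se: "0 < sin \<eta>" "0 < cos \<eta>" using eta by (auto intro: sin_gt_zero cos_gt_zero)
    define \<xi> where "\<xi> = \<beta> + \<gamma> - pi"
    have xi: "\<xi> = \<eta> + \<kappa>" "\<gamma> \<le> \<xi>" unfolding \<xi>_def \<eta>_def \<kappa>_def using bg by auto
    have kl: "- (pi/2) < \<kappa>" using 3 bg unfolding \<kappa>_def by auto
    \<comment> \<open>The claim is \<open>\<beta> + \<gamma> \<le> 2 * pi\<close>: for a wider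
      opening no point of this angular range meets the hypotheses on \<open>edge_p\<close> and on
      the distances. Once it is known, \<open>fB \<theta> \<le> 0\<close> makes both terms of the
      flux nonnegative separately.\<close>
    have xp: "\<xi> \<le> pi"
    proof (rule ccontr)
      assume "\<not> \<xi> \<le> pi"
      then have x: "pi < \<xi>" by simp
      have k: "pi/2 < \<kappa>" using x xi eta by simp
      have t3: "\<theta> \<le> 3 * pi / 2"
      proof (rule ccontr)
        assume "\<not> \<theta> \<le> 3 * pi / 2"
        then have t: "3 * pi / 2 < \<theta>" by simp
        have "\<eta> \<le> 2 * pi - \<theta>" unfolding \<eta>_def using bg by simp
        then have "sin \<eta> \<le> sin (2 * pi - \<theta>)" using eta t by (intro sin_monotone_2pi_le) auto
        also have "sin (2 * pi - \<theta>) = - sin \<theta>" by (simp add: sin_diff)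
        finally have s: "sin \<eta> \<le> - sin \<theta>" .
        then have "\<not> 0 < sin \<theta>" using se by simp
        then have cg: "0 < cos \<gamma>" using ypos by force
        have "- sin \<theta> < cos \<gamma> * sin \<eta>" using ylow[OF cg] D by simp
        also have "\<dots> \<le> 1 * sin \<eta>" using se by (intro mult_right_mono) auto
        finally show False using s by simp
      qed
      have "0 < cos (\<kappa> - pi)" using k t3 bg unfolding \<kappa>_def by (intro cos_gt_zero_pi) auto
      then have "r * cos \<kappa> < 0" using r by (simp add: mult_less_0_iff)
      then have cg: "0 < cos \<gamma>" using p by simp
      have g2: "\<gamma> < pi/2"
      proof (rule ccontr)
        assume "\<not> \<gamma> < pi/2"
        then have "0 \<le> cos (pi - \<gamma>)" using bg by (intro cos_ge_zero) auto
        then show False using cg by simp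
      qed
      have "cos \<gamma> * sin \<eta> \<le> sin (\<eta> + \<gamma>)" unfolding sin_add using se sg by (simp add: mult.commute)
      also have "sin (\<eta> + \<gamma>) = sin (pi - (\<eta> + \<gamma>))" by simp
      also have "\<dots> \<le> sin (pi - (2 * pi - \<theta>))"
        using x t3 eta g2 unfolding \<xi>_def \<eta>_def by (intro sin_monotone_2pi_le) auto
      also have "\<dots> = - sin \<theta>" by (simp add: sin_diff)
      also have "\<dots> < cos \<gamma> * sin \<eta>" using ylow[OF cg] D by simp
      finally show False by simp
    qed
    have c1: "0 \<le> cos \<eta> + cos \<kappa>"
    proof -
      have "cos (pi - \<eta>) \<le> cos \<kappa>" by (rule cos_ge_of_abs_le) (use xp xi kl eta in \<open>auto simp: abs_le_iff\<close>)
      then show ?thesis by simp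
    qed
    have c2: "0 \<le> cos \<theta>' + cos (\<xi> - \<theta>')"
    proof -
      have "cos (pi - \<theta>') \<le> cos (\<xi> - \<theta>')" by (rule cos_ge_of_abs_le) (use xp xi th' th'0 bg in \<open>auto simp: abs_le_iff\<close>)
      then show ?thesis by simp
    qed
    have e: "cos \<theta>' + sin \<eta> * sin (\<theta>' - \<kappa>) - (- cos \<eta>) * cos (\<theta>' - \<kappa>) = cos \<theta>' + cos (\<xi> - \<theta>')"
    proof -
      have "sin \<eta> * sin (\<theta>' - \<kappa>) + cos \<eta> * cos (\<theta>' - \<kappa>) = cos (\<eta> - (\<theta>' - \<kappa>))" unfolding cos_diff[of \<eta>] by simp
      also have "\<eta> - (\<theta>' - \<kappa>) = \<xi> - \<theta>'" using xi by simp
      finally show ?thesis by simp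
    qed
    have "fB \<theta> / r * (- cos \<eta> - cos \<kappa>) = (fB \<eta> / r) * (cos \<eta> + cos \<kappa>)" unfolding fb(1) by (simp add: algebra_simps)
    also have "\<dots> \<ge> 0" using fb r c1 by (intro mult_nonneg_nonneg divide_nonneg_pos) auto
    finally have t1: "0 \<le> fB \<theta> / r * (- cos \<eta> - cos \<kappa>)" .
    have t2: "0 \<le> fA \<theta>' / r' * (cos \<theta>' + cos (\<xi> - \<theta>'))" using fA0 c2 by (rule mult_nonneg_nonneg)
    show ?thesis unfolding D e using t1 t2 by (rule add_nonneg_nonneg)
  qed
qed

section \<open>The vector field\<close>

lemma C1_on_comp2:
  assumes f: "C1_on N f fx fy" and a: "C1_on M a ax ay" and b: "C1_on M b bx by'"
    and sub: "\<And>z. z \<in> M \<Longrightarrow> (a z, b z) \<in> N"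
  shows "C1_on M (\<lambda>z. f (a z, b z)) (\<lambda>z. fx (a z, b z) * ax z + fy (a z, b z) * bx z)
    (\<lambda>z. fx (a z, b z) * ay z + fy (a z, b z) * by' z)"
proof -
  have "((\<lambda>z. f (a z, b z)) has_derivative (\<lambda>h. fst h * (fx (a z, b z) * ax z + fy (a z, b z) * bx z)
      + snd h * (fx (a z, b z) * ay z + fy (a z, b z) * by' z))) (at z)" if z: "z \<in> M" for z
  proof -
    have "(a has_derivative (\<lambda>h. fst h * ax z + snd h * ay z)) (at z)"
      "(b has_derivative (\<lambda>h. fst h * bx z + snd h * by' z)) (at z)"
      using a b z unfolding C1_on_def by blast+
    then have "((\<lambda>z. (a z, b z)) has_derivative (\<lambda>h. (fst h * ax z + snd h * ay z, fst h * bx z + snd h * by' z))) (at z)"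
      by (rule has_derivative_Pair)
    moreover have "(f has_derivative (\<lambda>h. fst h * fx (a z, b z) + snd h * fy (a z, b z))) (at (a z, b z))"
      using f sub[OF z] unfolding C1_on_def by blast
    ultimately have "((\<lambda>z. f (a z, b z)) has_derivative
      (\<lambda>h. fst (fst h * ax z + snd h * ay z, fst h * bx z + snd h * by' z) * fx (a z, b z)
        + snd (fst h * ax z + snd h * ay z, fst h * bx z + snd h * by' z) * fy (a z, b z))) (at z)"
      by (rule has_derivative_compose)
    then show ?thesis by (simp add: algebra_simps)
  qed
  moreover have "continuous_on M (\<lambda>z. (a z, b z))"
    by (intro continuous_on_Pair C1_on_cont[OF a] C1_on_cont[OF b])
  then have "continuous_on M (\<lambda>z. g (a z, b z))" if "continuous_on N g" for g :: "real \<times> real \<Rightarrow> real"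
    by (rule continuous_on_compose2[OF that]) (use sub in auto)
  then have "continuous_on M (\<lambda>z. fx (a z, b z))" "continuous_on M (\<lambda>z. fy (a z, b z))"
    using f unfolding C1_on_def by blast+
  ultimately show ?thesis using a b unfolding C1_on_def by (auto intro!: continuous_on_add continuous_on_mult)
qed

text \<open>If \<open>f = y'/y\<close>, the field is \<open>- \<nabla> ln (y \<circ> \<Theta>)\<close>, and the hypothesis on \<open>f\<close> is the equation \<open>y'' + V y = 0\<close>.\<close>

lemma riccati_field:
  assumes T: "C1_on N \<Theta> tx ty" "C1_on N tx txx txy" "C1_on N ty tyx tyy"
    and harm: "\<And>z. z \<in> N \<Longrightarrow> txx z + tyy z = 0"
    and f: "\<And>z. z \<in> N \<Longrightarrow> (f has_real_derivative - ((f (\<Theta> z))\<^sup>2 + V (\<Theta> z))) (at (\<Theta> z))"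
    and V: "continuous_on (\<Theta> ` N) V"
  obtains ax ay bx by' where
    "C1_on N (\<lambda>z. - f (\<Theta> z) * tx z) ax ay" "C1_on N (\<lambda>z. - f (\<Theta> z) * ty z) bx by'"
    "\<And>z. z \<in> N \<Longrightarrow> ax z + by' z - ((- f (\<Theta> z) * tx z)\<^sup>2 + (- f (\<Theta> z) * ty z)\<^sup>2) = V (\<Theta> z) * ((tx z)\<^sup>2 + (ty z)\<^sup>2)"
proof -
  have cf: "continuous_on (\<Theta> ` N) f"
    by (intro continuous_at_imp_continuous_on ballI) (use f DERIV_isCont in blast)
  have c: "continuous_on (\<Theta> ` N) (\<lambda>t. (f t)\<^sup>2 + V t)"
    by (intro continuous_on_add continuous_on_power cf V)
  have "C1_on N (\<lambda>z. - f (\<Theta> z)) (\<lambda>z. ((f (\<Theta> z))\<^sup>2 + V (\<Theta> z)) * tx z) (\<lambda>z. ((f (\<Theta> z))\<^sup>2 + V (\<Theta> z)) * ty z)"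
  proof (rule C1_on_comp[OF T(1), where \<phi>="\<lambda>t. - f t" and \<phi>'="\<lambda>t. (f t)\<^sup>2 + V t", OF _ c])
    fix z assume "z \<in> N"
    from DERIV_minus[OF f[OF this]] show "((\<lambda>t. - f t) has_real_derivative (f (\<Theta> z))\<^sup>2 + V (\<Theta> z)) (at (\<Theta> z))"
      by (simp only: minus_minus)
  qed
  from C1_on_mult[OF this T(2)] C1_on_mult[OF this T(3)]
  show ?thesis
  proof (rule that)
    fix z assume "z \<in> N"
    from harm[OF this] have h: "tyy z = - txx z" by simp
    show "((f (\<Theta> z))\<^sup>2 + V (\<Theta> z)) * tx z * tx z + - f (\<Theta> z) * txx z
       + (((f (\<Theta> z))\<^sup>2 + V (\<Theta> z)) * ty z * ty z + - f (\<Theta> z) * tyy z)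
       - ((- f (\<Theta> z) * tx z)\<^sup>2 + (- f (\<Theta> z) * ty z)\<^sup>2) = V (\<Theta> z) * ((tx z)\<^sup>2 + (ty z)\<^sup>2)"
      unfolding h by (simp add: power2_eq_square algebra_simps)
  qed
qed

section \<open>Cutoff, sector distance and rotated polar angle\<close>

definition step :: "real \<Rightarrow> real" where
  "step x = (if x \<le> 0 then 0 else if x \<le> 1 then 3 * x^2 - 2 * x^3 else 1)"

definition step' :: "real \<Rightarrow> real" where
  "step' x = (if x \<le> 0 then 0 else if x \<le> 1 then 6 * x - 6 * x^2 else 0)"

lemma step_deriv: "(step has_real_derivative step' x) (at x)"
proof -
  have i: "((\<lambda>x. if x \<le> 1 then 3 * x^2 - 2 * x^3 else 1) has_real_derivative (if x \<le> 1 then 6 * x - 6 * x^2 else 0)) (at x)" for x :: real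
    by (rule DERIV_If_le) (auto intro!: derivative_eq_intros simp: power2_eq_square)
  show ?thesis unfolding step_def[abs_def] step'_def
    by (rule DERIV_If_le) (use i in auto)
qed

lemma continuous_step': "continuous_on UNIV step'"
  unfolding step'_def[abs_def] by (intro continuous_If_le continuous_intros) auto

lemma step_range: "0 \<le> step x" "step x \<le> 1" "0 \<le> step' x"
proof -
  have "0 \<le> step x \<and> step x \<le> 1 \<and> 0 \<le> step' x"
  proof (cases "0 < x \<and> x \<le> 1")
    case True
    have "3 * x^2 - 2 * x^3 = x^2 * (1 + 2 * (1 - x))" "1 - (3 * x^2 - 2 * x^3) = (1 - x)^2 * (1 + 2 * x)"
      "6 * x - 6 * x^2 = 6 * x * (1 - x)"
      by (simp_all add: algebra_simps power2_eq_square power3_eq_cube)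
    moreover have "0 \<le> x^2 * (1 + 2 * (1 - x))" "0 \<le> (1 - x)^2 * (1 + 2 * x)" "0 \<le> 6 * x * (1 - x)"
      using True by (intro mult_nonneg_nonneg; simp)+
    ultimately have "0 \<le> 3 * x^2 - 2 * x^3" "3 * x^2 - 2 * x^3 \<le> 1" "0 \<le> 6 * x - 6 * x^2" by linarith+
    then show ?thesis using True by (simp add: step_def step'_def)
  next
    case False
    then show ?thesis by (auto simp: step_def step'_def)
  qed
  then show "0 \<le> step x" "step x \<le> 1" "0 \<le> step' x" by auto
qed

lemma step_le_0: "x \<le> 0 \<Longrightarrow> step x = 0" "x \<le> 0 \<Longrightarrow> step' x = 0"
  by (simp_all add: step_def step'_def)

lemma step_ge_1: "1 \<le> x \<Longrightarrow> step x = 1"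
  by (cases "x = 1") (simp_all add: step_def)

text \<open>Convexity of the square: interpolating two fields does not increase the quadratic term
  beyond the interpolated one, so the interface term is the only extra contribution.\<close>

lemma convex_sq: "0 \<le> e \<Longrightarrow> e \<le> 1 \<Longrightarrow> (e * a + (1 - e) * b)\<^sup>2 \<le> e * a\<^sup>2 + (1 - e) * b\<^sup>2" for a b e :: real
proof -
  assume e: "0 \<le> e" "e \<le> 1"
  have "e * a\<^sup>2 + (1 - e) * b\<^sup>2 - (e * a + (1 - e) * b)\<^sup>2 = e * (1 - e) * (a - b)\<^sup>2"
    by (simp add: power2_eq_square algebra_simps)
  also have "\<dots> \<ge> 0" using e by simp
  finally show ?thesis by simp
qed

text \<open>The sector distance as an explicit formula. It is \<open>C^1\<close> off the cut, also
  across the angles where the nearest part of the boundary changes, and can therefore drive the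
  cutoff.\<close>

definition bdl :: "real \<Rightarrow> real \<times> real \<Rightarrow> real" where
  "bdl \<beta> z = norm z * wD \<beta> (ang z)"

lemma C1_on_bdl:
  assumes be: "pi \<le> \<beta>" "\<beta> \<le> 2 * pi"
  shows "C1_on {z. 0 < ang z} (bdl \<beta>)
    (\<lambda>z. norm z * rad_x z * wD \<beta> (ang z) + norm z * (wD' \<beta> (ang z) * (- rad_y z)))
    (\<lambda>z. norm z * rad_y z * wD \<beta> (ang z) + norm z * (wD' \<beta> (ang z) * rad_x z))"
  unfolding bdl_def[abs_def]
proof (rule C1_on_mult)
  have o: "open (-{0::real\<times>real})" by (simp add: open_Compl)
  have "C1_on (-{0}) (\<lambda>z. exp (ln (norm z))) (\<lambda>z. exp (ln (norm z)) * rad_x z) (\<lambda>z. exp (ln (norm z)) * rad_y z)"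
    by (rule C1_on_comp[OF C1_on_lnr DERIV_exp]) (intro continuous_on_exp continuous_on_id)
  then have "C1_on (-{0}) norm (\<lambda>z. norm z * rad_x z) (\<lambda>z. norm z * rad_y z)"
    by (rule C1_on_cong[OF _ o]) simp_all
  then show "C1_on {z. 0 < ang z} norm (\<lambda>z. norm z * rad_x z) (\<lambda>z. norm z * rad_y z)"
  proof (rule C1_on_subset)
    show "{z. 0 < ang z} \<subseteq> -{0}" using ang_pos_nz(1) by blast
  qed
  show "C1_on {z. 0 < ang z} (\<lambda>z. wD \<beta> (ang z)) (\<lambda>z. wD' \<beta> (ang z) * (- rad_y z)) (\<lambda>z. wD' \<beta> (ang z) * rad_x z)"
    by (rule C1_on_comp[OF C1_on_ang wD_deriv[OF be]]) (rule continuous_on_subset[OF continuous_wD'[OF be]], simp)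
qed

lemma C1_on_edge:
  "C1_on N (\<lambda>z. edge_p \<gamma> z + 1) (\<lambda>z. - cos \<gamma>) (\<lambda>z. sin \<gamma>)"
  "C1_on N (edge_Y \<gamma>) (\<lambda>z. - sin \<gamma>) (\<lambda>z. - cos \<gamma>)"
  unfolding C1_on_def edge_p_def[abs_def] edge_Y_def[abs_def]
  by (auto intro!: derivative_eq_intros simp: algebra_simps)

text \<open>The rotation about \<open>P\<close> that lays \<open>L1\<close> on the axis to the right
  of \<open>P\<close>; the summand 1 keeps \<open>P\<close> at (1, 0). The point sent to the origin
  is the centre of \<open>F\<^sub>A\<close>, on the line of \<open>L1\<close> at distance 1 beyond
  \<open>P\<close>.\<close>

definition rot :: "real \<Rightarrow> real \<times> real \<Rightarrow> real \<times> real" where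
  "rot \<gamma> z = (edge_p \<gamma> z + 1, edge_Y \<gamma> z)"

lemma C1_on_rot:
  assumes "C1_on N f fx fy"
  shows "C1_on {z. rot \<gamma> z \<in> N} (\<lambda>z. f (rot \<gamma> z)) (\<lambda>z. fx (rot \<gamma> z) * (- cos \<gamma>) + fy (rot \<gamma> z) * (- sin \<gamma>))
    (\<lambda>z. fx (rot \<gamma> z) * sin \<gamma> + fy (rot \<gamma> z) * (- cos \<gamma>))"
  unfolding rot_def by (rule C1_on_comp2[OF assms C1_on_edge]) simp

lemma open_rot: "open N \<Longrightarrow> open {z. rot \<gamma> z \<in> N}"
proof -
  assume "open N"
  moreover have "continuous_on UNIV (rot \<gamma>)" unfolding rot_def[abs_def]
    by (intro continuous_on_Pair continuous_on_add continuous_on_const continuous_edge)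
  moreover have "{z. rot \<gamma> z \<in> N} = rot \<gamma> -` N" by auto
  ultimately show ?thesis using open_vimage by metis
qed

text \<open>\<open>(rot_tx, rot_ty)\<close> is the gradient of the polar angle about the second
  centre.\<close>

definition rot_tx where "rot_tx \<gamma> z = rad_y (rot \<gamma> z) * cos \<gamma> - rad_x (rot \<gamma> z) * sin \<gamma>"
definition rot_ty where "rot_ty \<gamma> z = - rad_y (rot \<gamma> z) * sin \<gamma> - rad_x (rot \<gamma> z) * cos \<gamma>"

lemma C1_on_rot_ang:
  "C1_on {z. rot \<gamma> z \<in> {w. 0 < ang w}} (\<lambda>z. ang (rot \<gamma> z)) (rot_tx \<gamma>) (rot_ty \<gamma>)"
proof -
  have o: "open {w. 0 < ang w}" using open_ang[of UNIV] by simp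
  show ?thesis
    by (rule C1_on_cong[OF C1_on_rot[OF C1_on_ang] open_rot[OF o]]) (simp_all add: rot_tx_def rot_ty_def)
qed

lemma C1_on_rot_grad:
  obtains txx txy tyx tyy where
    "C1_on {z. rot \<gamma> z \<in> -{0}} (rot_tx \<gamma>) txx txy" "C1_on {z. rot \<gamma> z \<in> -{0}} (rot_ty \<gamma>) tyx tyy"
    "\<And>z. txx z + tyy z = 0"
proof -
  let ?N = "{z. rot \<gamma> z \<in> -{0}}"
  note Rx = C1_on_rot[OF C1_on_rad(1), of \<gamma>] and Ry = C1_on_rot[OF C1_on_rad(2), of \<gamma>]
  note c = C1_on_const[of ?N "cos \<gamma>"] and s = C1_on_const[of ?N "sin \<gamma>"] and ms = C1_on_const[of ?N "- sin \<gamma>"]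
  have e0: "rot_tx \<gamma> = (\<lambda>z. rad_y (rot \<gamma> z) * cos \<gamma> - rad_x (rot \<gamma> z) * sin \<gamma>)"
    by (simp add: rot_tx_def fun_eq_iff)
  have e: "rot_ty \<gamma> = (\<lambda>z. rad_y (rot \<gamma> z) * (- sin \<gamma>) - rad_x (rot \<gamma> z) * cos \<gamma>)"
    by (simp add: rot_ty_def fun_eq_iff)
  have sc: "sin \<gamma> * (sin \<gamma> * x) = x - cos \<gamma> * (cos \<gamma> * x)" for x
  proof -
    have "sin \<gamma> * (sin \<gamma> * x) + cos \<gamma> * (cos \<gamma> * x) = ((sin \<gamma>)\<^sup>2 + (cos \<gamma>)\<^sup>2) * x"
      by (simp only: power2_eq_square algebra_simps)
    then show ?thesis by simp
  qed
  from C1_on_diff[OF C1_on_mult[OF Ry c] C1_on_mult[OF Rx s], folded e0]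
    C1_on_diff[OF C1_on_mult[OF Ry ms] C1_on_mult[OF Rx c], folded e]
  show ?thesis
    by (rule that) (simp add: algebra_simps sc)
qed

text \<open>As sin x \<le> x, a lower bound for \<open>wD\<close> keeps the angle away from both
  sides. This places a compact support where the profiles are defined.\<close>

lemma bdl_ge_imp_ang:
  assumes be: "pi \<le> \<beta>" "\<beta> \<le> 2 * pi" and a: "0 < a" "a < pi/2" and z: "0 < ang z" "ang z < \<beta>"
    and w: "a < wD \<beta> (ang z)"
  shows "a < ang z \<and> ang z < \<beta> - a"
proof -
  have le: "wD \<beta> t \<le> t \<or> pi/2 < t" if "0 < t" for t
    using that sin_x_le_x[of t] unfolding wD_def by auto
  have "a < ang z" using le[OF z(1)] w a by linarith
  moreover have "a < \<beta> - ang z"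
    using le[of "\<beta> - ang z"] z w a wD_reflect[OF be, of "ang z"] by auto
  ultimately show ?thesis by simp
qed

text \<open>The field is \<open>\<eta> F\<^sub>A + (1 - \<eta>) F\<^sub>B\<close> on \<open>U\<close> and \<open>F\<^sub>B\<close> elsewhere, where \<open>F\<^sub>B = - fB(\<theta>) \<nabla>\<theta>\<close> and
  \<open>F\<^sub>A = - fA(\<theta>') \<nabla>\<theta>'\<close> with the polar angle \<open>\<theta>'\<close> about the rotated vertex.\<close>

lemma interpolated_field:
  fixes fA fB :: "real \<Rightarrow> real"
  assumes bg: "0 < \<gamma>" "\<gamma> < pi" "pi \<le> \<beta>" "\<beta> \<le> 2 * pi" and a: "0 < a" "a < pi/2" and k: "0 < k" and c': "0 < c'"
    and dB: "\<And>t. a < t \<Longrightarrow> t < \<beta> - a \<Longrightarrow> (fB has_real_derivative - ((fB t)\<^sup>2 + c' / (wD \<beta> t)\<^sup>2)) (at t)"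
    and dA: "\<And>t. a < t \<Longrightarrow> t < pi/2 \<Longrightarrow> (fA has_real_derivative - ((fA t)\<^sup>2 + c' / (sin t)\<^sup>2)) (at t)"
    and odd: "\<And>t. fB (\<beta> - t) = - fB t" and B0: "\<And>t. a < t \<Longrightarrow> t \<le> \<beta>/2 \<Longrightarrow> 0 \<le> fB t"
    and Bmid: "\<And>t. pi/2 \<le> t \<Longrightarrow> t \<le> \<beta>/2 \<Longrightarrow> fB t * (pi/2) \<le> fB (pi/2) * (pi - t)"
      "\<And>t. pi/2 \<le> t \<Longrightarrow> t \<le> \<beta>/2 \<Longrightarrow> fB t \<le> fB (pi/2)"
    and AB: "\<And>s t. a < s \<Longrightarrow> s \<le> t \<Longrightarrow> t \<le> pi/2 \<Longrightarrow> fB t * sin t \<le> fA s * sin s"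
  defines "NB \<equiv> {z. 0 < ang z \<and> ang z \<in> {a<..<\<beta>-a}}"
  defines "NA \<equiv> {z. rot \<gamma> z \<in> {w. 0 < ang w \<and> ang w \<in> {a<..<pi/2}}}"
  defines "U \<equiv> {z. 0 < edge_p \<gamma> z \<and> 0 < edge_Y \<gamma> z}"
  defines "\<eta> \<equiv> \<lambda>z. step (k * (bdl \<beta> z - edge_Y \<gamma> z))"
  obtains F1 F2 F1x F1y F2x F2y where
    "C1_on (NB \<inter> NA \<inter> U) F1 F1x F1y" "C1_on (NB \<inter> NA \<inter> U) F2 F2x F2y"
    "\<And>M. open M \<Longrightarrow> M \<subseteq> NB \<Longrightarrow> (\<And>z. z \<in> M \<Longrightarrow> z \<notin> U \<or> bdl \<beta> z < edge_Y \<gamma> z) \<Longrightarrow> C1_on M F1 F1x F1y \<and> C1_on M F2 F2x F2y"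
    "\<And>z. z \<in> NB \<Longrightarrow> z \<notin> U \<or> bdl \<beta> z < edge_Y \<gamma> z \<Longrightarrow> F1x z + F2y z - ((F1 z)\<^sup>2 + (F2 z)\<^sup>2) = c' / (bdl \<beta> z)\<^sup>2"
    "\<And>z. z \<in> NB \<inter> NA \<inter> U \<Longrightarrow>
      c' * (\<eta> z / (edge_Y \<gamma> z)\<^sup>2 + (1 - \<eta> z) / (bdl \<beta> z)\<^sup>2) \<le> F1x z + F2y z - ((F1 z)\<^sup>2 + (F2 z)\<^sup>2)"
proof -
  have oNB: "open NB" unfolding NB_def by (intro open_ang open_greaterThanLessThan)
  have oNA: "open NA" unfolding NA_def by (intro open_rot open_ang open_greaterThanLessThan)
  have oU: "open U" unfolding U_def by (intro open_Collect_conj open_Collect_less continuous_on_const continuous_edge)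
  have NBpos: "NB \<subseteq> {z. 0 < ang z}" unfolding NB_def by auto
  have NB0: "NB \<subseteq> -{0}" using NBpos ang_pos_nz(1) by blast
  have NApos: "NA \<subseteq> {z. rot \<gamma> z \<in> {w. 0 < ang w}}" unfolding NA_def by auto
  have NA0: "NA \<subseteq> {z. rot \<gamma> z \<in> -{0}}" using NApos ang_pos_nz(1) by blast
  have o: "open (-{0::real\<times>real})" by (simp add: open_Compl)
  have Rym: "C1_on (-{0}) (\<lambda>z. - rad_y z) (\<lambda>z. 2 * rad_x z * rad_y z) (\<lambda>z. - ((rad_x z)\<^sup>2 - (rad_y z)\<^sup>2))"
    by (rule C1_on_cong[OF C1_on_diff[OF C1_on_const[of _ 0] C1_on_rad(2)] o]) simp_all
  have wpos: "wD \<beta> t \<noteq> 0" if "a < t" "t < \<beta> - a" for t using wD_pos[OF bg(3,4), of t] that a by auto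
  have VB: "continuous_on (ang ` NB) (\<lambda>t. c' / (wD \<beta> t)\<^sup>2)"
    by (intro continuous_on_divide continuous_on_const continuous_on_power continuous_on_subset[OF continuous_wD[OF bg(3,4)]] subset_UNIV)
      (use wpos in \<open>auto simp: NB_def\<close>)
  obtain B1x B1y B2x B2y where B: "C1_on NB (\<lambda>z. - fB (ang z) * (- rad_y z)) B1x B1y" "C1_on NB (\<lambda>z. - fB (ang z) * rad_x z) B2x B2y"
    and Bdiv: "\<And>z. z \<in> NB \<Longrightarrow> B1x z + B2y z - ((- fB (ang z) * (- rad_y z))\<^sup>2 + (- fB (ang z) * rad_x z)\<^sup>2)
       = c' / (wD \<beta> (ang z))\<^sup>2 * ((- rad_y z)\<^sup>2 + (rad_x z)\<^sup>2)"
  proof (rule riccati_field[OF C1_on_subset[OF C1_on_ang NBpos] C1_on_subset[OF Rym NB0] C1_on_subset[OF C1_on_rad(1) NB0] _ _ VB, of fB])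
    show "2 * rad_x z * rad_y z + - 2 * rad_x z * rad_y z = 0" for z by simp
    show "(fB has_real_derivative - ((fB (ang z))\<^sup>2 + c' / (wD \<beta> (ang z))\<^sup>2)) (at (ang z))" if "z \<in> NB" for z
      by (rule dB) (use that in \<open>auto simp: NB_def\<close>)
  qed (rule that)
  obtain txx txy tyx tyy where T: "C1_on {z. rot \<gamma> z \<in> -{0}} (rot_tx \<gamma>) txx txy" "C1_on {z. rot \<gamma> z \<in> -{0}} (rot_ty \<gamma>) tyx tyy"
    and harm: "\<And>z. txx z + tyy z = 0"
  proof (rule C1_on_rot_grad[of \<gamma>])
  qed (rule that)
  have VA: "continuous_on ((\<lambda>z. ang (rot \<gamma> z)) ` NA) (\<lambda>t. c' / (sin t)\<^sup>2)"
  proof (intro continuous_on_divide continuous_on_const continuous_on_power continuous_on_sin continuous_on_id ballI)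
    fix t assume "t \<in> (\<lambda>z. ang (rot \<gamma> z)) ` NA"
    then have "0 < t" "t < pi" using a by (auto simp: NA_def)
    then show "(sin t)\<^sup>2 \<noteq> 0" using sin_gt_zero[of t] by simp
  qed
  obtain A1x A1y A2x A2y where A: "C1_on NA (\<lambda>z. - fA (ang (rot \<gamma> z)) * rot_tx \<gamma> z) A1x A1y" "C1_on NA (\<lambda>z. - fA (ang (rot \<gamma> z)) * rot_ty \<gamma> z) A2x A2y"
    and Adiv: "\<And>z. z \<in> NA \<Longrightarrow> A1x z + A2y z - ((- fA (ang (rot \<gamma> z)) * rot_tx \<gamma> z)\<^sup>2 + (- fA (ang (rot \<gamma> z)) * rot_ty \<gamma> z)\<^sup>2)
       = c' / (sin (ang (rot \<gamma> z)))\<^sup>2 * ((rot_tx \<gamma> z)\<^sup>2 + (rot_ty \<gamma> z)\<^sup>2)"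
  proof (rule riccati_field[OF C1_on_subset[OF C1_on_rot_ang NApos] C1_on_subset[OF T(1) NA0] C1_on_subset[OF T(2) NA0] harm _ VA, of fA])
    show "(fA has_real_derivative - ((fA (ang (rot \<gamma> z)))\<^sup>2 + c' / (sin (ang (rot \<gamma> z)))\<^sup>2)) (at (ang (rot \<gamma> z)))" if "z \<in> NA" for z
      by (rule dA) (use that in \<open>auto simp: NA_def\<close>)
  qed (rule that)
  define B1 B2 where "B1 = (\<lambda>z. - fB (ang z) * (- rad_y z))" and "B2 = (\<lambda>z. - fB (ang z) * rad_x z)"
  define A1 A2 where "A1 = (\<lambda>z. - fA (ang (rot \<gamma> z)) * rot_tx \<gamma> z)" and "A2 = (\<lambda>z. - fA (ang (rot \<gamma> z)) * rot_ty \<gamma> z)"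
  note B = B[folded B1_def B2_def] and A = A[folded A1_def A2_def]
  define Sx where "Sx z = norm z * rad_x z * wD \<beta> (ang z) + norm z * (wD' \<beta> (ang z) * (- rad_y z)) - (- sin \<gamma>)" for z
  define Sy where "Sy z = norm z * rad_y z * wD \<beta> (ang z) + norm z * (wD' \<beta> (ang z) * rad_x z) - (- cos \<gamma>)" for z
  define e where "e z = k * (bdl \<beta> z - edge_Y \<gamma> z)" for z
  have eta: "\<eta> z = step (e z)" for z unfolding \<eta>_def e_def ..
  define \<eta>x \<eta>y where "\<eta>x z = step' (e z) * (k * Sx z)" and "\<eta>y z = step' (e z) * (k * Sy z)" for z
  have Ce: "C1_on NB \<eta> \<eta>x \<eta>y"
  proof -
    have "C1_on NB (\<lambda>z. bdl \<beta> z - edge_Y \<gamma> z) Sx Sy" unfolding Sx_def[abs_def] Sy_def[abs_def]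
      by (rule C1_on_diff[OF C1_on_subset[OF C1_on_bdl[OF bg(3,4)] NBpos] C1_on_edge(2)])
    from C1_on_mult[OF C1_on_const[of NB k] this]
    have "C1_on NB e (\<lambda>z. 0 * (bdl \<beta> z - edge_Y \<gamma> z) + k * Sx z) (\<lambda>z. 0 * (bdl \<beta> z - edge_Y \<gamma> z) + k * Sy z)"
      unfolding e_def[abs_def] .
    then have "C1_on NB e (\<lambda>z. k * Sx z) (\<lambda>z. k * Sy z)" by (simp only: mult_zero_left add_0)
    from C1_on_comp[OF this step_deriv continuous_on_subset[OF continuous_step' subset_UNIV]]
    show ?thesis unfolding \<eta>x_def[abs_def] \<eta>y_def[abs_def] by (rule C1_on_cong[OF _ oNB]) (simp_all only: eta)
  qed
  define F1 where "F1 z = (if z \<in> U then \<eta> z * A1 z + (1 - \<eta> z) * B1 z else B1 z)" for z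
  define F2 where "F2 z = (if z \<in> U then \<eta> z * A2 z + (1 - \<eta> z) * B2 z else B2 z)" for z
  define F1x where "F1x z = (if z \<in> U then (\<eta>x z * A1 z + \<eta> z * A1x z) + ((0 - \<eta>x z) * B1 z + (1 - \<eta> z) * B1x z) else B1x z)" for z
  define F1y where "F1y z = (if z \<in> U then (\<eta>y z * A1 z + \<eta> z * A1y z) + ((0 - \<eta>y z) * B1 z + (1 - \<eta> z) * B1y z) else B1y z)" for z
  define F2x where "F2x z = (if z \<in> U then (\<eta>x z * A2 z + \<eta> z * A2x z) + ((0 - \<eta>x z) * B2 z + (1 - \<eta> z) * B2x z) else B2x z)" for z
  define F2y where "F2y z = (if z \<in> U then (\<eta>y z * A2 z + \<eta> z * A2y z) + ((0 - \<eta>y z) * B2 z + (1 - \<eta> z) * B2y z) else B2y z)" for z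
  let ?N = "NB \<inter> NA \<inter> U"
  have oN: "open ?N" by (intro open_Int oNB oNA oU)
  have sub: "?N \<subseteq> NB" "?N \<subseteq> NA" by auto
  note Ce' = C1_on_subset[OF Ce sub(1)]
  note C1e = C1_on_diff[OF C1_on_const[of ?N 1] Ce']
  \<comment> \<open>The cutoff vanishes together with its gradient where
    \<open>bdl < edge_Y\<close>, so on such open sets the field and its partial derivatives are
    those of \<open>F\<^sub>B\<close>, whichever branch of the definition applies.\<close>
  have off: "F1 z = B1 z \<and> F2 z = B2 z \<and> F1x z = B1x z \<and> F1y z = B1y z \<and> F2x z = B2x z \<and> F2y z = B2y z"
    if "z \<notin> U \<or> bdl \<beta> z < edge_Y \<gamma> z" for z
  proof (cases "z \<in> U")
    case False
    then show ?thesis by (simp add: F1_def F2_def F1x_def F1y_def F2x_def F2y_def)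
  next
    case True
    then have "bdl \<beta> z - edge_Y \<gamma> z \<le> 0" using that by simp
    then have "e z \<le> 0" unfolding e_def using k by (intro mult_nonneg_nonpos) auto
    then have "\<eta> z = 0" "\<eta>x z = 0" "\<eta>y z = 0" unfolding eta \<eta>x_def \<eta>y_def by (simp_all add: step_le_0)
    then show ?thesis by (simp add: F1_def F2_def F1x_def F1y_def F2x_def F2y_def)
  qed
  have normpos: "norm z > 0" if "z \<in> NB" for z using that ang_pos_nz(2) unfolding NB_def by blast
  have Bdiv': "B1x z + B2y z - ((B1 z)\<^sup>2 + (B2 z)\<^sup>2) = c' / (bdl \<beta> z)\<^sup>2" if z: "z \<in> NB" for z
  proof -
    have "(- rad_y z)\<^sup>2 + (rad_x z)\<^sup>2 = 1 / (norm z)\<^sup>2" using rad_sq[of z] normpos[OF z] by simp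
    then show ?thesis unfolding B1_def B2_def Bdiv[OF z] bdl_def by (simp add: power_mult_distrib)
  qed
  show ?thesis
  proof (rule that[of F1 F1x F1y F2 F2x F2y])
    show "C1_on ?N F1 F1x F1y"
      by (rule C1_on_cong[OF C1_on_add[OF C1_on_mult[OF Ce' C1_on_subset[OF A(1) sub(2)]] C1_on_mult[OF C1e C1_on_subset[OF B(1) sub(1)]]] oN])
        (simp_all add: F1_def F1x_def F1y_def)
    show "C1_on ?N F2 F2x F2y"
      by (rule C1_on_cong[OF C1_on_add[OF C1_on_mult[OF Ce' C1_on_subset[OF A(2) sub(2)]] C1_on_mult[OF C1e C1_on_subset[OF B(2) sub(1)]]] oN])
        (simp_all add: F2_def F2x_def F2y_def)
    show "C1_on M F1 F1x F1y \<and> C1_on M F2 F2x F2y"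
      if M: "open M" "M \<subseteq> NB" "\<And>z. z \<in> M \<Longrightarrow> z \<notin> U \<or> bdl \<beta> z < edge_Y \<gamma> z" for M
    proof
      show "C1_on M F1 F1x F1y"
        by (rule C1_on_cong[OF C1_on_subset[OF B(1) M(2)] M(1)]) (use off[OF M(3)] in simp_all)
      show "C1_on M F2 F2x F2y"
        by (rule C1_on_cong[OF C1_on_subset[OF B(2) M(2)] M(1)]) (use off[OF M(3)] in simp_all)
    qed
    show "F1x z + F2y z - ((F1 z)\<^sup>2 + (F2 z)\<^sup>2) = c' / (bdl \<beta> z)\<^sup>2" if "z \<in> NB" "z \<notin> U \<or> bdl \<beta> z < edge_Y \<gamma> z" for z
      using off[OF that(2)] Bdiv'[OF that(1)] by simp
    fix z assume z: "z \<in> ?N"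
    then have zU: "z \<in> U" and zB: "z \<in> NB" and zA: "z \<in> NA" by auto
    define r t r' t' where "r = norm z" and "t = ang z" and "r' = norm (rot \<gamma> z)" and "t' = ang (rot \<gamma> z)"
    have t: "a < t" "t < \<beta> - a" "0 < t" using zB unfolding NB_def t_def by auto
    have t': "a < t'" "t' < pi/2" "0 < t'" using zA unfolding NA_def t'_def by auto
    have rp: "0 < r" "0 < r'" using t(3) t'(3) unfolding t_def t'_def r_def r'_def by (auto dest: ang_pos_nz(2))
    have XY: "edge_p \<gamma> z + 1 = r' * cos t'" "edge_Y \<gamma> z = r' * sin t'"
      using polar_fst[of "rot \<gamma> z"] polar_snd[of "rot \<gamma> z"] unfolding r'_def t'_def by (simp_all add: rot_def)
    have pY: "edge_Y \<gamma> z = r * sin (t - pi + \<gamma>) + sin \<gamma>" "edge_p \<gamma> z = r * cos (t - pi + \<gamma>) + cos \<gamma>"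
      unfolding r_def t_def by (rule edge_Y_polar edge_p_polar)+
    have rx: "rad_x z = cos t / r" "rad_y z = sin t / r" "rad_x (rot \<gamma> z) = cos t' / r'" "rad_y (rot \<gamma> z) = sin t' / r'"
      using rp unfolding rad_x_def rad_y_def r_def[symmetric] r'_def[symmetric]
      by (simp_all add: polar_fst[of z] polar_snd[of z] polar_fst[of "rot \<gamma> z"] polar_snd[of "rot \<gamma> z"]
          r_def[symmetric] r'_def[symmetric] t_def[symmetric] t'_def[symmetric] power2_eq_square)
    have tx: "rot_tx \<gamma> z = sin (t' - \<gamma>) / r'" "rot_ty \<gamma> z = - cos (t' - \<gamma>) / r'"
      unfolding rot_tx_def rot_ty_def rx sin_diff cos_diff by (simp_all add: diff_divide_distrib add_divide_distrib)
    have Adiv': "A1x z + A2y z - ((A1 z)\<^sup>2 + (A2 z)\<^sup>2) = c' / (edge_Y \<gamma> z)\<^sup>2"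
    proof -
      have "(rot_tx \<gamma> z)\<^sup>2 + (rot_ty \<gamma> z)\<^sup>2 = 1 / r'\<^sup>2"
        unfolding tx power_divide power2_minus add_divide_distrib[symmetric] by simp
      moreover have "A1x z + A2y z - ((A1 z)\<^sup>2 + (A2 z)\<^sup>2) = c' / (sin t')\<^sup>2 * ((rot_tx \<gamma> z)\<^sup>2 + (rot_ty \<gamma> z)\<^sup>2)"
        using Adiv[OF zA] unfolding A1_def A2_def t'_def .
      ultimately show ?thesis unfolding XY(2) by (simp add: power_mult_distrib)
    qed
    define h where "h = \<eta> z"
    have h: "0 \<le> h" "h \<le> 1" unfolding h_def eta by (rule step_range)+
    \<comment> \<open>The gradient of \<open>bdl - edge_Y\<close> paired with
      \<open>F\<^sub>A - F\<^sub>B\<close>; up to the nonnegative factor \<open>step' * k\<close>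
      this is the interface term. The computation below rewrites it in the angles of the two
      centres.\<close>
    define Phi where "Phi = Sx z * (A1 z - B1 z) + Sy z * (A2 z - B2 z)"
    have Phi: "Phi = fB t / r * (wD' \<beta> t - cos (t - pi + \<gamma>))
       + fA t' / r' * (cos t' + wD \<beta> t * sin (t' - (t - pi + \<gamma>)) - wD' \<beta> t * cos (t' - (t - pi + \<gamma>)))"
    proof -
      have S: "Sx z = cos t * wD \<beta> t - wD' \<beta> t * sin t + sin \<gamma>" "Sy z = sin t * wD \<beta> t + wD' \<beta> t * cos t + cos \<gamma>"
        unfolding Sx_def Sy_def rx r_def[symmetric] t_def[symmetric] using rp by simp_all
      have AA: "A1 z = - fA t' * sin (t' - \<gamma>) / r'" "A2 z = fA t' * cos (t' - \<gamma>) / r'"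
        unfolding A1_def A2_def tx t'_def[symmetric] by simp_all
      have BB: "B1 z = fB t * sin t / r" "B2 z = - fB t * cos t / r"
        unfolding B1_def B2_def rx t_def[symmetric] by simp_all
      have k1: "Sx z * sin t - Sy z * cos t = - wD' \<beta> t + cos (t - pi + \<gamma>)"
      proof -
        have "cos (t - pi + \<gamma>) = - cos (t + \<gamma>)" using cos_minus_pi[of "t + \<gamma>"] by (simp add: algebra_simps)
        then have "cos (t - pi + \<gamma>) = sin t * sin \<gamma> - cos t * cos \<gamma>" unfolding cos_add by simp
        moreover have "wD' \<beta> t * (sin t * sin t) + wD' \<beta> t * (cos t * cos t) = wD' \<beta> t"
          by (simp only: distrib_left[symmetric] power2_eq_square[symmetric] sin_cos_squared_add mult_1_right)
        moreover have "Sx z * sin t - Sy z * cos t = - (wD' \<beta> t * (sin t * sin t) + wD' \<beta> t * (cos t * cos t)) + (sin t * sin \<gamma> - cos t * cos \<gamma>)"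
          unfolding S by (simp add: algebra_simps)
        ultimately show ?thesis by linarith
      qed
      have k2: "Sy z * cos (t' - \<gamma>) - Sx z * sin (t' - \<gamma>) =
          cos t' + wD \<beta> t * sin (t' - (t - pi + \<gamma>)) - wD' \<beta> t * cos (t' - (t - pi + \<gamma>))"
      proof -
        have "sin (t' - (t - pi + \<gamma>)) = - sin ((t' - \<gamma>) - t)" "cos (t' - (t - pi + \<gamma>)) = - cos ((t' - \<gamma>) - t)"
          using sin_periodic_pi[of "(t' - \<gamma>) - t"] cos_periodic_pi[of "(t' - \<gamma>) - t"] by (simp_all add: algebra_simps)
        moreover have "cos t' = cos ((t' - \<gamma>) + \<gamma>)" by simp
        ultimately have "cos t' + wD \<beta> t * sin (t' - (t - pi + \<gamma>)) - wD' \<beta> t * cos (t' - (t - pi + \<gamma>))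
           = (cos (t' - \<gamma>) * cos \<gamma> - sin (t' - \<gamma>) * sin \<gamma>)
             - wD \<beta> t * (sin (t' - \<gamma>) * cos t - cos (t' - \<gamma>) * sin t)
             + wD' \<beta> t * (cos (t' - \<gamma>) * cos t + sin (t' - \<gamma>) * sin t)"
          by (simp only: cos_add sin_diff[of "t' - \<gamma>" t] cos_diff[of "t' - \<gamma>" t])
        then show ?thesis unfolding S by (simp add: algebra_simps)
      qed
      have "Phi = fA t' / r' * (Sy z * cos (t' - \<gamma>) - Sx z * sin (t' - \<gamma>)) - fB t / r * (Sx z * sin t - Sy z * cos t)"
        unfolding Phi_def AA BB by (simp add: algebra_simps)
      then show ?thesis unfolding k1 k2 by (simp add: algebra_simps)
    qed
    \<comment> \<open>Where \<open>step'\<close> does not vanish, \<open>edge_Y < bdl\<close>, so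
      the comparison of distances required by \<open>flux_nonneg\<close> is available exactly where
      its conclusion matters.\<close>
    have flux: "0 \<le> step' (e z) * (k * Phi)"
    proof (cases "e z \<le> 0")
      case True
      then show ?thesis by (simp add: step_le_0)
    next
      case False
      then have "0 < k * (bdl \<beta> z - edge_Y \<gamma> z)" unfolding e_def by simp
      from zero_less_mult_pos[OF this k] have "0 < bdl \<beta> z - edge_Y \<gamma> z" .
      then have le: "r' * sin t' \<le> r * wD \<beta> t" unfolding bdl_def XY r_def t_def by simp
      have "0 \<le> Phi" unfolding Phi
      proof (rule flux_nonneg[where a=a])
        show "r' * cos t' = r * cos (t - pi + \<gamma>) + cos \<gamma> + 1" using XY(1) pY(2) by simp
        show "r' * sin t' = r * sin (t - pi + \<gamma>) + sin \<gamma>" using XY(2) pY(1) by simp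
        show "0 < r * cos (t - pi + \<gamma>) + cos \<gamma>" using zU pY(2) unfolding U_def by simp
      qed (use bg rp t t' a le odd B0 Bmid AB in blast)+
      then show ?thesis using step_range k by simp
    qed
    have "F1x z + F2y z = h * (A1x z + A2y z) + (1 - h) * (B1x z + B2y z) + step' (e z) * (k * Phi)"
      unfolding F1x_def F2y_def if_P[OF zU] h_def[symmetric] \<eta>x_def \<eta>y_def Phi_def by (simp add: algebra_simps)
    moreover have "(F1 z)\<^sup>2 \<le> h * (A1 z)\<^sup>2 + (1 - h) * (B1 z)\<^sup>2" "(F2 z)\<^sup>2 \<le> h * (A2 z)\<^sup>2 + (1 - h) * (B2 z)\<^sup>2"
      unfolding F1_def F2_def if_P[OF zU] h_def[symmetric] using convex_sq[OF h] by auto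
    ultimately have "h * (A1x z + A2y z - ((A1 z)\<^sup>2 + (A2 z)\<^sup>2)) + (1 - h) * (B1x z + B2y z - ((B1 z)\<^sup>2 + (B2 z)\<^sup>2))
       \<le> F1x z + F2y z - ((F1 z)\<^sup>2 + (F2 z)\<^sup>2)"
      using flux by (simp add: algebra_simps)
    then show "c' * (\<eta> z / (edge_Y \<gamma> z)\<^sup>2 + (1 - \<eta> z) / (bdl \<beta> z)\<^sup>2) \<le> F1x z + F2y z - ((F1 z)\<^sup>2 + (F2 z)\<^sup>2)"
      unfolding Adiv' Bdiv'[OF zB] h_def by (simp add: algebra_simps)
  qed
qed

text \<open>Completing the square: after adding the divergence of \<open>u\<^sup>2 F\<close>, which
  integrates to 0, the difference of the integrands is the square of the vector
  \<open>\<nabla>u + u F\<close> plus \<open>u\<^sup>2\<close> times the nonnegative defect in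
  \<open>W\<close>.\<close>

lemma energy_ge_of_field:
  assumes u: "C1_on UNIV u ux uy" and K: "compact K" and supp: "\<And>z. z \<notin> K \<Longrightarrow> u z = 0 \<and> ux z = 0 \<and> uy z = 0"
    and loc: "\<And>z. z \<in> K \<Longrightarrow> \<exists>N. open N \<and> z \<in> N \<and> C1_on N F1 F1x F1y \<and> C1_on N F2 F2x F2y"
    and W: "\<And>z. z \<in> K \<Longrightarrow> W z \<le> F1x z + F2y z - ((F1 z)\<^sup>2 + (F2 z)\<^sup>2)"
    and A: "((\<lambda>z. W z * (u z)\<^sup>2) has_integral A) UNIV" and B: "((\<lambda>z. (ux z)\<^sup>2 + (uy z)\<^sup>2) has_integral B) UNIV"
  shows "A \<le> B"
proof -
  have G: "C1_on UNIV (\<lambda>z. u z * u z * F z) (\<lambda>z. (ux z * u z + u z * ux z) * F z + u z * u z * Fx z)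
      (\<lambda>z. (uy z * u z + u z * uy z) * F z + u z * u z * Fy z)"
    if F: "\<And>z. z \<in> K \<Longrightarrow> \<exists>N. open N \<and> z \<in> N \<and> C1_on N F Fx Fy" for F Fx Fy
  proof (rule C1_on_locally)
    fix z
    show "\<exists>N. open N \<and> z \<in> N \<and> C1_on N (\<lambda>z. u z * u z * F z) (\<lambda>z. (ux z * u z + u z * ux z) * F z + u z * u z * Fx z)
      (\<lambda>z. (uy z * u z + u z * uy z) * F z + u z * u z * Fy z)"
    proof (cases "z \<in> K")
      case True
      from F[OF this] obtain N where N: "open N" "z \<in> N" "C1_on N F Fx Fy" by blast
      have u': "C1_on N u ux uy" by (rule C1_on_subset[OF u subset_UNIV])
      from C1_on_mult[OF C1_on_mult[OF u' u'] N(3)] N(1,2) show ?thesis by (intro exI[of _ N] conjI)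
    next
      case False
      have o: "open (-K)" using K compact_imp_closed by blast
      have "C1_on (-K) (\<lambda>z. u z * u z * F z) (\<lambda>z. (ux z * u z + u z * ux z) * F z + u z * u z * Fx z)
        (\<lambda>z. (uy z * u z + u z * uy z) * F z + u z * u z * Fy z)"
        by (rule C1_on_cong[OF C1_on_const[of _ 0] o]) (use supp in auto)
      then show ?thesis using False o by (intro exI[of _ "-K"] conjI) auto
    qed
  qed
  have 1: "C1_on UNIV (\<lambda>z. u z * u z * F1 z) (\<lambda>z. (ux z * u z + u z * ux z) * F1 z + u z * u z * F1x z)
      (\<lambda>z. (uy z * u z + u z * uy z) * F1 z + u z * u z * F1y z)" by (rule G) (use loc in blast)
  have 2: "C1_on UNIV (\<lambda>z. u z * u z * F2 z) (\<lambda>z. (ux z * u z + u z * ux z) * F2 z + u z * u z * F2x z)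
      (\<lambda>z. (uy z * u z + u z * uy z) * F2 z + u z * u z * F2y z)" by (rule G) (use loc in blast)
  have z: "u z * u z * F1 z = 0" "u z * u z * F2 z = 0" if "z \<notin> K" for z using supp[OF that] by simp_all
  note D = has_integral_add[OF B has_integral_add[OF partial_integral_zero(1)[OF 1 z(1) K] partial_integral_zero(2)[OF 2 z(2) K]]]
  have "A \<le> B + (0 + 0)"
  proof (rule has_integral_le[OF A D])
    fix z
    show "W z * (u z)\<^sup>2 \<le> (ux z)\<^sup>2 + (uy z)\<^sup>2 + ((ux z * u z + u z * ux z) * F1 z + u z * u z * F1x z
       + ((uy z * u z + u z * uy z) * F2 z + u z * u z * F2y z))"
    proof (cases "z \<in> K")
      case True
      have "0 \<le> (ux z + u z * F1 z)\<^sup>2 + (uy z + u z * F2 z)\<^sup>2 + (u z)\<^sup>2 * (F1x z + F2y z - ((F1 z)\<^sup>2 + (F2 z)\<^sup>2) - W z)"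
        using W[OF True] by (intro add_nonneg_nonneg mult_nonneg_nonneg) auto
      then show ?thesis by (simp add: power2_eq_square algebra_simps)
    next
      case False
      then show ?thesis using supp by simp
    qed
  qed
  then show ?thesis by simp
qed

section \<open>Test functions of the full domain\<close>

context
  fixes \<beta> \<gamma> :: real
  assumes bg: "0 < \<gamma>" "\<gamma> < pi" "pi \<le> \<beta>" "\<beta> \<le> 2 * pi"
begin

lemma gamma_le_pi: "\<gamma> \<le> pi" using bg(2) by simp

lemmas bg' = bg(1) gamma_le_pi bg(3,4)

lemma E_polar_neq_UNIV: "E_polar \<beta> \<gamma> \<noteq> UNIV"
  using E_polar_sub_Lambda[OF bg'] not_Lambda_P[OF bg] by blast

lemma bdist_E_le_bdl:
  assumes z: "z \<in> E_polar \<beta> \<gamma>"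
  shows "bdist (E_polar \<beta> \<gamma>) z \<le> bdl \<beta> z"
proof -
  have zL: "z \<in> Lambda \<beta>" using z E_polar_sub_Lambda[OF bg'] by blast
  have "bdist (E_polar \<beta> \<gamma>) z \<le> bdist (Lambda \<beta>) z"
  proof (rule bdist_ge[OF zL])
    show "Lambda \<beta> \<noteq> UNIV" using not_Lambda_P[OF bg] by blast
    fix w assume "w \<in> frontier (Lambda \<beta>)"
    then have "w \<notin> Lambda \<beta>" using open_Lambda[OF bg'] by (simp add: frontier_def interior_open)
    then have "w \<notin> E_polar \<beta> \<gamma>" using E_polar_sub_Lambda[OF bg'] by blast
    with z show "bdist (E_polar \<beta> \<gamma>) z \<le> dist z w" by (rule bdist_le_dist)
  qed
  also have "\<dots> \<le> bdl \<beta> z" unfolding bdl_def by (rule bdist_Lambda_le[OF bg(3,4) zL])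
  finally show ?thesis .
qed

lemma bdist_E_le_edge_Y:
  assumes z: "z \<in> E_polar \<beta> \<gamma>" and p: "0 < edge_p \<gamma> z" "0 < edge_Y \<gamma> z"
  shows "bdist (E_polar \<beta> \<gamma>) z \<le> edge_Y \<gamma> z"
proof -
  let ?w = "(1 - edge_p \<gamma> z * cos \<gamma>, edge_p \<gamma> z * sin \<gamma>)"
  have "edge_p \<gamma> ?w = edge_p \<gamma> z * ((sin \<gamma>)\<^sup>2 + (cos \<gamma>)\<^sup>2)"
    unfolding edge_p_def[of \<gamma> ?w] by (simp only: fst_conv snd_conv power2_eq_square algebra_simps)
  then have wp: "edge_p \<gamma> ?w = edge_p \<gamma> z" by simp
  have wY: "edge_Y \<gamma> ?w = 0" unfolding edge_Y_def by simp
  have "?w \<in> L1 \<gamma>" using wp wY p L1_iff[of ?w \<gamma>] by simp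
  then have "?w \<notin> E_polar \<beta> \<gamma>" using E_polar_disjoint[OF bg'] by blast
  with z have "bdist (E_polar \<beta> \<gamma>) z \<le> dist z ?w" by (rule bdist_le_dist)
  moreover have "(dist z ?w)\<^sup>2 = (edge_Y \<gamma> z)\<^sup>2" unfolding edge_dist[of z ?w \<gamma>] wp wY by simp
  then have "dist z ?w = edge_Y \<gamma> z" using p(2) by (simp add: power2_eq_iff_nonneg)
  ultimately show ?thesis by simp
qed

text \<open>The construction sees the support of a test function only through these two numbers:
  \<open>m / R\<close> limits the angles \<open>a\<close>, and \<open>m\<close> sets the width of
  the layer.\<close>

lemma compact_subset_bounds:
  assumes K: "compact K" "K \<subseteq> E_polar \<beta> \<gamma>"
  obtains m R where "0 < m" "0 < R"
    "\<And>z. z \<in> K \<Longrightarrow> m \<le> bdist (E_polar \<beta> \<gamma>) z \<and> norm z \<le> R \<and> norm (rot \<gamma> z) \<le> R"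
proof -
  obtain m where m: "0 < m" "\<And>z. z \<in> K \<Longrightarrow> m \<le> bdist (E_polar \<beta> \<gamma>) z"
  proof (cases "K = {}")
    case True
    then show ?thesis by (intro that[of 1]) auto
  next
    case False
    from continuous_attains_inf[OF K(1) False continuous_on_bdist]
    obtain x where x: "x \<in> K" "\<And>z. z \<in> K \<Longrightarrow> bdist (E_polar \<beta> \<gamma>) x \<le> bdist (E_polar \<beta> \<gamma>) z" by blast
    have "0 < bdist (E_polar \<beta> \<gamma>) x" using x(1) K(2) bdist_pos[OF open_E_polar[OF bg'] _ E_polar_neq_UNIV] by blast
    then show ?thesis using x(2) by (rule that)
  qed
  have "continuous_on K (rot \<gamma>)" unfolding rot_def[abs_def]
    by (intro continuous_on_Pair continuous_on_add continuous_on_const continuous_edge)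
  from compact_imp_bounded[OF compact_continuous_image[OF this K(1)]]
  obtain R1 where R1: "\<And>w. w \<in> rot \<gamma> ` K \<Longrightarrow> norm w \<le> R1" unfolding bounded_iff by blast
  from compact_imp_bounded[OF K(1)] obtain R2 where R2: "\<And>w. w \<in> K \<Longrightarrow> norm w \<le> R2" unfolding bounded_iff by blast
  show ?thesis
  proof (rule that[of m "max 1 (max R1 R2)"])
    fix z assume z: "z \<in> K"
    then have "rot \<gamma> z \<in> rot \<gamma> ` K" by (rule imageI)
    from R1[OF this] R2[OF z] m(2)[OF z]
    show "m \<le> bdist (E_polar \<beta> \<gamma>) z \<and> norm z \<le> max 1 (max R1 R2) \<and> norm (rot \<gamma> z) \<le> max 1 (max R1 R2)" by linarith
  qed (use m in auto)
qed

lemma rot_ang_gt: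
  assumes p: "0 < edge_p \<gamma> z" "m \<le> edge_Y \<gamma> z" and R: "norm (rot \<gamma> z) \<le> R" "0 < R" and m: "0 < m"
    and a: "a < m / R" "0 < a"
  shows "0 < ang (rot \<gamma> z) \<and> a < ang (rot \<gamma> z) \<and> ang (rot \<gamma> z) < pi/2"
proof -
  let ?w = "rot \<gamma> z"
  let ?t = "ang ?w"
  have Y: "0 < snd ?w" and X: "0 < fst ?w" using p m unfolding rot_def by simp_all
  have t: "0 < ?t" "?t < pi" using ang_lt_pi[of ?w] Y by auto
  have r: "0 < norm ?w" using ang_pos_nz(2)[OF t(1)] .
  have "0 < norm ?w * cos ?t" using X polar_fst[of ?w] by simp
  then have "0 < cos ?t" using r by (simp add: zero_less_mult_iff)
  then have "?t < pi/2" using cos_monotone_0_pi_le[of "pi/2" ?t] t by force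
  moreover have "m \<le> norm ?w * sin ?t" using p(2) polar_snd[of ?w] unfolding rot_def by simp
  then have "m \<le> R * sin ?t" using R(1) sin_gt_zero[OF t] by (meson less_imp_le mult_right_mono order_trans)
  then have "m / R \<le> sin ?t" using R(2) by (simp add: pos_divide_le_eq mult.commute)
  then have "a < ?t" using a sin_x_le_x[of ?t] t by linarith
  ultimately show ?thesis using t by blast
qed

text \<open>The interpolation parameter is chosen so that the field uses \<open>bdl\<close>, rather than the smaller
  \<open>edge_Y\<close>, only where the two differ by a factor at most \<open>1 / s\<close>.\<close>

lemma field_lower_bound:
  assumes d: "0 < d" "min Y D \<le> d" and Y: "0 < Y" "m \<le> Y" and m: "0 < m" and s: "0 < s" "s < 1" and D: "0 < D"
  shows "s\<^sup>2 / d\<^sup>2 \<le> step (1 / (m * (1/s - 1)) * (D - Y)) / Y\<^sup>2 + (1 - step (1 / (m * (1/s - 1)) * (D - Y))) / D\<^sup>2"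
proof -
  define k where "k = 1 / (m * (1/s - 1))"
  have "0 < 1/s - 1" using s by simp
  then have k: "0 < k" unfolding k_def using m by simp
  define e where "e = step (k * (D - Y))"
  have e: "0 \<le> e" "e \<le> 1" unfolding e_def by (rule step_range)+
  have mono: "s\<^sup>2 / d\<^sup>2 \<le> 1 / x\<^sup>2" if "0 < x" "s * x \<le> d" for x
  proof -
    have "s / d \<le> 1 / x" using that d by (simp add: field_simps)
    then have "(s / d)\<^sup>2 \<le> (1 / x)\<^sup>2" using s d by (intro power_mono) auto
    then show ?thesis by (simp add: power_divide)
  qed
  have sx: "s * x \<le> x" if "0 < x" for x using s that by simp
  have "s\<^sup>2 / d\<^sup>2 \<le> e * (1 / Y\<^sup>2) + (1 - e) * (1 / D\<^sup>2)"
  proof -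
    \<comment> \<open>The right-hand side is a convex combination, so each bound is needed only
      where its weight is nonzero.\<close>
    have mix: "s\<^sup>2 / d\<^sup>2 \<le> e * (1 / Y\<^sup>2) + (1 - e) * (1 / D\<^sup>2)"
      if "e = 0 \<or> s\<^sup>2 / d\<^sup>2 \<le> 1 / Y\<^sup>2" "e = 1 \<or> s\<^sup>2 / d\<^sup>2 \<le> 1 / D\<^sup>2"
    proof -
      have mono': "x * v \<le> x * w" if "x = 0 \<or> v \<le> w" "0 \<le> x" for x v w :: real
        using that by (elim disjE) (simp, rule mult_left_mono)
      have eq: "e * q + (1 - e) * q = q" for q by (simp add: algebra_simps)
      have "e * (s\<^sup>2 / d\<^sup>2) \<le> e * (1 / Y\<^sup>2)" by (rule mono'[OF that(1) e(1)])
      moreover have "(1 - e) * (s\<^sup>2 / d\<^sup>2) \<le> (1 - e) * (1 / D\<^sup>2)" by (rule mono') (use that(2) e(2) in auto)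
      ultimately show ?thesis using eq[of "s\<^sup>2 / d\<^sup>2"] by linarith
    qed
    show ?thesis
    proof (cases "D \<le> Y")
      case True
      then have "k * (D - Y) \<le> 0" using k by (intro mult_nonneg_nonpos) auto
      then have "e = 0" unfolding e_def by (rule step_le_0)
      moreover have "s * D \<le> d" using sx[OF D] d(2) True by simp
      ultimately show ?thesis using mono[OF D] by (intro mix) auto
    next
      case False
      then have Yd: "Y \<le> d" using d(2) by simp
      have "e = 1 \<or> s * D \<le> d"
      proof (cases "1 \<le> k * (D - Y)")
        case True
        then show ?thesis unfolding e_def by (simp add: step_ge_1)
      next
        case False
        then have "D - Y < 1 / k" using k by (simp add: pos_less_divide_eq mult.commute)
        also have "\<dots> = m * (1/s - 1)" unfolding k_def by simp
        also have "\<dots> \<le> Y * (1/s - 1)" using Y(2) \<open>0 < 1/s - 1\<close> by (intro mult_right_mono) auto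
        finally have "D \<le> Y / s" by (simp add: algebra_simps)
        then have "s * D \<le> Y" using s by (simp add: pos_le_divide_eq mult.commute)
        then show ?thesis using Yd by simp
      qed
      moreover have "s * Y \<le> d" using sx[OF Y(1)] Yd by simp
      ultimately show ?thesis using mono[OF D] mono[OF Y(1)] by (intro mix) auto
    qed
  qed
  then show ?thesis unfolding e_def k_def by simp
qed

text \<open>The angle \<open>a\<close> and the layer are chosen after the support of
  \<open>u\<close>, while the constant \<open>s\<^sup>2 * c'\<close> does not depend on it. The
  parameters \<open>s\<close> and \<open>c'\<close> can thus be sent to 1 and \<open>c\<close> for a
  fixed test function.\<close>

lemma hardy_E_approx:
  assumes H: "hardy_ineq (Lambda \<beta>) c" and c: "0 < c'" "c' < c" and s: "0 < s" "s < 1"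
    and K: "compact K" "K \<subseteq> E_polar \<beta> \<gamma>" and u: "C1_on UNIV u ux uy"
    and supp: "\<And>z. z \<notin> K \<Longrightarrow> u z = 0 \<and> ux z = 0 \<and> uy z = 0"
    and A: "((\<lambda>z. (u z)\<^sup>2 / (bdist (E_polar \<beta> \<gamma>) z)\<^sup>2) has_integral A) UNIV"
    and B: "((\<lambda>z. (ux z)\<^sup>2 + (uy z)\<^sup>2) has_integral B) UNIV"
  shows "s\<^sup>2 * c' * A \<le> B"
proof -
  let ?E = "E_polar \<beta> \<gamma>"
  obtain m R where mR: "0 < m" "0 < R"
    and KR: "\<And>z. z \<in> K \<Longrightarrow> m \<le> bdist ?E z \<and> norm z \<le> R \<and> norm (rot \<gamma> z) \<le> R"
  proof (rule compact_subset_bounds[OF K])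
  qed (rule that)
  \<comment> \<open>On the support, \<open>m / R\<close> is a lower bound for \<open>wD\<close> and,
    where \<open>L1\<close> matters, for the sine of the angle about the second centre. Halving it
    makes the bounds strict.\<close>
  define a where "a = min (m / (2 * R)) (pi/4)"
  have a: "0 < a" "a < pi/2" "a < m / R"
  proof -
    show "0 < a" unfolding a_def using mR by simp
    have "a \<le> pi/4" unfolding a_def by (rule min.cobounded2)
    then show "a < pi/2" using pi_gt_zero by linarith
    have "m / (2 * R) < m / R" using mR by (intro divide_strict_left_mono) auto
    then show "a < m / R" unfolding a_def by linarith
  qed
  define k where "k = 1 / (m * (1/s - 1))"
  have k: "0 < k" unfolding k_def using mR s by simp
  define NB where "NB = {z. 0 < ang z \<and> ang z \<in> {a<..<\<beta>-a}}"
  define NA where "NA = {z. rot \<gamma> z \<in> {w. 0 < ang w \<and> ang w \<in> {a<..<pi/2}}}"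
  define U where "U = {z. 0 < edge_p \<gamma> z \<and> 0 < edge_Y \<gamma> z}"
  define \<eta> where "\<eta> z = step (k * (bdl \<beta> z - edge_Y \<gamma> z))" for z
  obtain fB fA :: "real \<Rightarrow> real" where
    f: "\<And>t. a < t \<Longrightarrow> t < \<beta> - a \<Longrightarrow> (fB has_real_derivative - ((fB t)\<^sup>2 + c' / (wD \<beta> t)\<^sup>2)) (at t)"
    "\<And>t. a < t \<Longrightarrow> t < pi/2 \<Longrightarrow> (fA has_real_derivative - ((fA t)\<^sup>2 + c' / (sin t)\<^sup>2)) (at t)"
    "\<And>t. fB (\<beta> - t) = - fB t"
    "\<And>t. a < t \<Longrightarrow> t \<le> \<beta>/2 \<Longrightarrow> 0 \<le> fB t"
    "\<And>t. pi/2 \<le> t \<Longrightarrow> t \<le> \<beta>/2 \<Longrightarrow> fB t * (pi/2) \<le> fB (pi/2) * (pi - t)"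
    "\<And>t. pi/2 \<le> t \<Longrightarrow> t \<le> \<beta>/2 \<Longrightarrow> fB t \<le> fB (pi/2)"
    "\<And>s t. a < s \<Longrightarrow> s \<le> t \<Longrightarrow> t \<le> pi/2 \<Longrightarrow> fB t * sin t \<le> fA s * sin s"
  proof (rule angular_profiles[OF bg(3,4) H c a(1,2)], goal_cases)
    case (1 fB fA)
    show ?case by (rule 1(1)[of fB fA]; (rule 1(2-))?; assumption?)
  qed
  obtain F1 F2 F1x F1y F2x F2y where F:
    "C1_on (NB \<inter> NA \<inter> U) F1 F1x F1y" "C1_on (NB \<inter> NA \<inter> U) F2 F2x F2y"
    "\<And>M. open M \<Longrightarrow> M \<subseteq> NB \<Longrightarrow> (\<And>z. z \<in> M \<Longrightarrow> z \<notin> U \<or> bdl \<beta> z < edge_Y \<gamma> z) \<Longrightarrow> C1_on M F1 F1x F1y \<and> C1_on M F2 F2x F2y"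
    "\<And>z. z \<in> NB \<Longrightarrow> z \<notin> U \<or> bdl \<beta> z < edge_Y \<gamma> z \<Longrightarrow> F1x z + F2y z - ((F1 z)\<^sup>2 + (F2 z)\<^sup>2) = c' / (bdl \<beta> z)\<^sup>2"
    "\<And>z. z \<in> NB \<inter> NA \<inter> U \<Longrightarrow>
      c' * (\<eta> z / (edge_Y \<gamma> z)\<^sup>2 + (1 - \<eta> z) / (bdl \<beta> z)\<^sup>2) \<le> F1x z + F2y z - ((F1 z)\<^sup>2 + (F2 z)\<^sup>2)"
  proof (rule interpolated_field[OF bg a(1,2) k c(1), of fB fA, folded NB_def NA_def U_def \<eta>_def], goal_cases)
    case (1 t) show ?case by (rule f(1)[OF 1(2,3)])
  next
    case (2 t) show ?case by (rule f(2)[OF 2(2,3)])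
  next
    case 3 show ?case by (rule f(3))
  next
    case (4 t) show ?case by (rule f(4)[OF 4(2,3)])
  next
    case (5 t) show ?case by (rule f(5)[OF 5(2,3)])
  next
    case (6 t) show ?case by (rule f(6)[OF 6(2,3)])
  next
    case (7 s t) show ?case by (rule f(7)[OF 7(2-4)])
  next
    case (8 F1 F1x F1y F2 F2x F2y) show ?case by (rule 8(1)[OF 8(2-6)])
  qed
  have oNB: "open NB" unfolding NB_def by (intro open_ang open_greaterThanLessThan)
  have oNA: "open NA" unfolding NA_def by (intro open_rot open_ang open_greaterThanLessThan)
  have oU: "open U" unfolding U_def by (intro open_Collect_conj open_Collect_less continuous_on_const continuous_edge)
  have cbdl: "continuous_on NB (\<lambda>z. edge_Y \<gamma> z - bdl \<beta> z)"
  proof (intro continuous_on_diff continuous_edge continuous_on_subset[OF C1_on_cont[OF C1_on_bdl[OF bg(3,4)]]])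
    show "NB \<subseteq> {z. 0 < ang z}" unfolding NB_def by blast
  qed
  have KE: "z \<in> ?E" if "z \<in> K" for z using that K(2) by blast
  have bpos: "0 < bdist ?E z" if "z \<in> K" for z using KR[OF that] mR by linarith
  have KB: "z \<in> NB" "0 < bdl \<beta> z" if z: "z \<in> K" for z
  proof -
    have "z \<in> Lambda \<beta>" using KE[OF z] E_polar_sub_Lambda[OF bg'] by blast
    then have z0: "0 < ang z" "ang z < \<beta>" unfolding Lambda_eq[OF bg(4)] by simp_all
    have "m \<le> bdl \<beta> z" using bdist_E_le_bdl[OF KE[OF z]] KR[OF z] by linarith
    then show "0 < bdl \<beta> z" using mR by linarith
    have "m \<le> norm z * wD \<beta> (ang z)" using \<open>m \<le> bdl \<beta> z\<close> unfolding bdl_def .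
    also have "\<dots> \<le> R * wD \<beta> (ang z)"
      using KR[OF z] wD_pos[OF bg(3,4) z0] by (intro mult_right_mono) auto
    finally have "m / R \<le> wD \<beta> (ang z)" using mR by (simp add: pos_divide_le_eq mult.commute)
    then have "a < wD \<beta> (ang z)" using a(3) by linarith
    from bdl_ge_imp_ang[OF bg(3,4) a(1,2) z0 this] z0 show "z \<in> NB" unfolding NB_def by simp
  qed
  have KY: "m \<le> edge_Y \<gamma> z" and KA: "z \<in> NA" if z: "z \<in> K" and zU: "z \<in> U" for z
  proof -
    have p: "0 < edge_p \<gamma> z" "0 < edge_Y \<gamma> z" using zU unfolding U_def by simp_all
    show Y: "m \<le> edge_Y \<gamma> z" using bdist_E_le_edge_Y[OF KE[OF z] p] KR[OF z] by linarith
    from rot_ang_gt[OF p(1) Y _ mR(2,1) a(3,1)] KR[OF z] show "z \<in> NA" unfolding NA_def by simp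
  qed
  show ?thesis
  proof (rule energy_ge_of_field[OF u K(1) supp _ _ _ B, where W="\<lambda>z. s\<^sup>2 * c' / (bdist ?E z)\<^sup>2" and ?F1.0=F1 and ?F2.0=F2
        and ?F1x=F1x and ?F1y=F1y and ?F2x=F2x and ?F2y=F2y])
    have "((\<lambda>z. s\<^sup>2 * c' * ((u z)\<^sup>2 / (bdist ?E z)\<^sup>2)) has_integral s\<^sup>2 * c' * A) UNIV"
      by (rule has_integral_mult_right[OF A])
    then show "((\<lambda>z. s\<^sup>2 * c' / (bdist ?E z)\<^sup>2 * (u z)\<^sup>2) has_integral s\<^sup>2 * c' * A) UNIV" by simp
  next
    fix z assume z: "z \<in> K"
    show "\<exists>N. open N \<and> z \<in> N \<and> C1_on N F1 F1x F1y \<and> C1_on N F2 F2x F2y"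
    proof (cases "z \<in> U")
      case True
      then have "z \<in> NB \<inter> NA \<inter> U" using KB(1)[OF z] KA[OF z True] by blast
      moreover have "open (NB \<inter> NA \<inter> U)" by (intro open_Int oNB oNA oU)
      ultimately show ?thesis using F(1,2) by (intro exI[of _ "NB \<inter> NA \<inter> U"] conjI)
    next
      case False
      have ex: ?thesis if "open M" "M \<subseteq> NB" "z \<in> M" "\<And>z. z \<in> M \<Longrightarrow> z \<notin> U \<or> bdl \<beta> z < edge_Y \<gamma> z" for M
        using F(3)[OF that(1,2,4)] that(1,3) by (intro exI[of _ M] conjI) simp_all
      from False have "\<not> (0 < edge_p \<gamma> z \<and> 0 < edge_Y \<gamma> z)" unfolding U_def by simp
      \<comment> \<open>Each alternative describes an open set of points that are outside
        \<open>U\<close> or satisfy \<open>bdl < edge_Y\<close>, so the field is \<open>C^1\<close>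
        near \<open>z\<close>.\<close>
      from edge_gap[OF bg KE[OF z] this] consider "edge_p \<gamma> z < 0" | "edge_Y \<gamma> z < 0" | "bdl \<beta> z < edge_Y \<gamma> z"
        unfolding bdl_def by blast
      then show ?thesis
      proof cases
        case 1
        show ?thesis
        proof (rule ex[of "NB \<inter> {z. edge_p \<gamma> z < 0}"])
          show "open (NB \<inter> {z. edge_p \<gamma> z < 0})"
            by (intro open_Int oNB open_Collect_less continuous_on_const continuous_edge)
        qed (use 1 KB(1)[OF z] in \<open>auto simp: U_def\<close>)
      next
        case 2
        show ?thesis
        proof (rule ex[of "NB \<inter> {z. edge_Y \<gamma> z < 0}"])
          show "open (NB \<inter> {z. edge_Y \<gamma> z < 0})"
            by (intro open_Int oNB open_Collect_less continuous_on_const continuous_edge)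
        qed (use 2 KB(1)[OF z] in \<open>auto simp: U_def\<close>)
      next
        case 3
        show ?thesis
        proof (rule ex[of "NB \<inter> (\<lambda>z. edge_Y \<gamma> z - bdl \<beta> z) -` {0<..}"])
          show "open (NB \<inter> (\<lambda>z. edge_Y \<gamma> z - bdl \<beta> z) -` {0<..})"
            by (rule continuous_open_preimage[OF cbdl oNB open_greaterThan])
        qed (use 3 KB(1)[OF z] in auto)
      qed
    qed
    have sb: "s\<^sup>2 * c' / (bdist ?E z)\<^sup>2 = c' * (s\<^sup>2 / (bdist ?E z)\<^sup>2)" by simp
    show "s\<^sup>2 * c' / (bdist ?E z)\<^sup>2 \<le> F1x z + F2y z - ((F1 z)\<^sup>2 + (F2 z)\<^sup>2)"
    proof (cases "z \<in> U")
      case True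
      then have p: "0 < edge_p \<gamma> z \<and> 0 < edge_Y \<gamma> z" unfolding U_def by simp
      have min: "min (edge_Y \<gamma> z) (bdl \<beta> z) \<le> bdist ?E z"
        unfolding bdl_def by (rule norm_mult_wD_le_bdist_E(1)[OF bg KE[OF z] p])
      have "s\<^sup>2 / (bdist ?E z)\<^sup>2 \<le> \<eta> z / (edge_Y \<gamma> z)\<^sup>2 + (1 - \<eta> z) / (bdl \<beta> z)\<^sup>2"
        unfolding \<eta>_def k_def by (rule field_lower_bound[OF bpos[OF z] min conjunct2[OF p] KY[OF z True] mR(1) s KB(2)[OF z]])
      then have "c' * (s\<^sup>2 / (bdist ?E z)\<^sup>2) \<le> c' * (\<eta> z / (edge_Y \<gamma> z)\<^sup>2 + (1 - \<eta> z) / (bdl \<beta> z)\<^sup>2)"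
        using c by (intro mult_left_mono) auto
      also have "\<dots> \<le> F1x z + F2y z - ((F1 z)\<^sup>2 + (F2 z)\<^sup>2)"
        by (rule F(5)) (use KB(1)[OF z] KA[OF z True] True in blast)
      finally show ?thesis unfolding sb .
    next
      case False
      then have n: "\<not> (0 < edge_p \<gamma> z \<and> 0 < edge_Y \<gamma> z)" unfolding U_def by simp
      have le: "bdl \<beta> z \<le> bdist ?E z" unfolding bdl_def by (rule norm_mult_wD_le_bdist_E(2)[OF bg KE[OF z] n])
      have "s\<^sup>2 \<le> 1" using s by (simp add: power_le_one)
      moreover have "(bdl \<beta> z)\<^sup>2 \<le> (bdist ?E z)\<^sup>2" using le KB(2)[OF z] by (intro power_mono) auto
      ultimately have "s\<^sup>2 / (bdist ?E z)\<^sup>2 \<le> 1 / (bdl \<beta> z)\<^sup>2"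
        using KB(2)[OF z] by (intro frac_le) auto
      then have "c' * (s\<^sup>2 / (bdist ?E z)\<^sup>2) \<le> c' * (1 / (bdl \<beta> z)\<^sup>2)" using c by (intro mult_left_mono) auto
      then show ?thesis unfolding sb F(4)[OF KB(1)[OF z] disjI1[OF False]] by simp
    qed
  qed
qed

lemma hardy_Lambda_imp_E:
  assumes c: "0 \<le> c" and H: "hardy_ineq (Lambda \<beta>) c"
  shows "hardy_ineq (E_polar \<beta> \<gamma>) c"
  unfolding hardy_ineq_def
proof (intro allI impI)
  let ?E = "E_polar \<beta> \<gamma>"
  fix u assume "test_fun ?E u"
  then obtain K ux uy where K: "compact K" "K \<subseteq> ?E" and u: "C1_on UNIV u ux uy"
    and g: "grad_sq u = (\<lambda>z. (ux z)\<^sup>2 + (uy z)\<^sup>2)" and supp: "\<And>z. z \<notin> K \<Longrightarrow> u z = 0 \<and> ux z = 0 \<and> uy z = 0"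
    by (rule test_funD) blast
  have oE: "open ?E" by (rule open_E_polar[OF bg'])
  have cont: "continuous_on S u" "continuous_on S ux" "continuous_on S uy" for S
    using C1_on_subset[OF u subset_UNIV] C1_on_cont unfolding C1_on_def by blast+
  define A B where "A = integral UNIV (\<lambda>z. (u z)\<^sup>2 / (bdist ?E z)\<^sup>2)" and "B = integral UNIV (\<lambda>z. (ux z)\<^sup>2 + (uy z)\<^sup>2)"
  have cA: "continuous_on ?E (\<lambda>z. (u z)\<^sup>2 / (bdist ?E z)\<^sup>2)"
  proof (intro continuous_on_divide continuous_on_power cont continuous_on_bdist ballI)
    fix z assume "z \<in> ?E"
    from bdist_pos[OF oE this E_polar_neq_UNIV] show "(bdist ?E z)\<^sup>2 \<noteq> 0" by simp
  qed
  have cB: "continuous_on ?E (\<lambda>z. (ux z)\<^sup>2 + (uy z)\<^sup>2)" by (intro continuous_on_add continuous_on_power cont)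
  have zA: "(u z)\<^sup>2 / (bdist ?E z)\<^sup>2 = 0" and zB: "(ux z)\<^sup>2 + (uy z)\<^sup>2 = 0" if "z \<notin> K" for z using supp[OF that] by simp_all
  note IA = integrable_compact_support[OF oE K cA zA, simplified] and IB = integrable_compact_support[OF oE K cB zB, simplified]
  have hA: "((\<lambda>z. (u z)\<^sup>2 / (bdist ?E z)\<^sup>2) has_integral A) UNIV" unfolding A_def by (rule integrable_integral[OF IA(1)])
  have hB: "((\<lambda>z. (ux z)\<^sup>2 + (uy z)\<^sup>2) has_integral B) UNIV" unfolding B_def by (rule integrable_integral[OF IB(1)])
  have B0: "0 \<le> B" by (rule has_integral_nonneg[OF hB]) simp
  have "c * A \<le> B"
  proof (cases "c = 0")
    case True
    then show ?thesis using B0 by simp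
  next
    case False
    then have c0: "0 < c" using c by simp
    \<comment> \<open>Two nested limits: \<open>c' = x * c\<close> and \<open>s = sqrt y\<close>,
      with \<open>x\<close> and \<open>y\<close> tending to 1 from below.\<close>
    have "x * (c * A) \<le> B" if x: "0 < x" "x < 1" for x
    proof (rule field_le_mult_one_interval)
      fix y :: real assume y: "0 < y" "y < 1"
      have "(sqrt y)\<^sup>2 * (x * c) * A \<le> B"
        by (rule hardy_E_approx[OF H _ _ _ _ K u supp hA hB]) (use c0 x y in auto)
      then show "y * (x * (c * A)) \<le> B" using y by (simp add: mult.assoc)
    qed
    then show ?thesis by (rule field_le_mult_one_interval)
  qed
  then show "c * integral ?E (\<lambda>x. (u x)\<^sup>2 / (bdist ?E x)\<^sup>2) \<le> integral ?E (grad_sq u)"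
    unfolding g A_def B_def IA(2) IB(2) .
qed

end

theorem theorem2:
  fixes \<beta> \<gamma> :: real
  assumes "0 < \<gamma>" "\<gamma> \<le> pi" "pi \<le> \<beta>" "\<beta> \<le> 2 * pi"
  shows "hardy_constant (E \<beta> \<gamma>) = c_beta \<beta>"
proof (cases "\<gamma> = pi")
  case True
  \<comment> \<open>For \<gamma> = \<pi> the halfline \<open>L1\<close> prolongs \<open>L2\<close>,
    and the domain is the sector itself.\<close>
  then show ?thesis using E_eq_E_polar[OF assms] E_polar_pi[OF assms(3,4)] unfolding c_beta_def by simp
next
  case False
  then have lt: "\<gamma> < pi" using assms(2) by simp
  have "hardy_ineq (E_polar \<beta> \<gamma>) c \<longleftrightarrow> hardy_ineq (Lambda \<beta>) c" if "0 \<le> c" for c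
    using hardy_E_imp_Lambda[OF assms(1) lt assms(3,4) that] hardy_Lambda_imp_E[OF assms(1) lt assms(3,4) that] by blast
  then have "{c. 0 \<le> c \<and> hardy_ineq (E_polar \<beta> \<gamma>) c} = {c. 0 \<le> c \<and> hardy_ineq (Lambda \<beta>) c}" by blast
  then show ?thesis unfolding c_beta_def hardy_constant_eq E_eq_E_polar[OF assms] by simp
qed

end
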